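(* Let $a,b,c$ be smooth real-valued $1$-periodic functions on $\mathbb{R}$, viewed as functions on $S^1=\mathbb{R}/\mathbb{Z}$, such that all zeroes of $a$ are of finite multiplicity. Let $P$ be the differential operator on $S^1$ $$P = d_x\, a(x)\, d_x - i b(x)\, d_x - \tfrac{i}{2} b'(x) + c(x),\qquad d_x=\frac{d}{dx},$$ and let $p(x,\xi) = -a(x)\xi^2 + b(x)\xi$ on $T^\star S^1$. Then the Hamiltonian flow of $p$ on $T^\star S^1$ is complete if and only if $P$, with domain $C^\infty(S^1)$, is essentially self-adjoint on $L^2(S^1,|dx|)$.
   Context: $S^1=\mathbb{R}/\mathbb{Z}$ carries the Lebesgue measure $|dx|$; functions acted on are complex valued. The notation $d_x a(x) d_x$ means the operator $f\mapsto (a f')'$. The Hamiltonian flow of $p$ is the flow of $dx/dt=\partial p/\partial \xi=-2a(x)\xi+b(x)$, $d\xi/dt=-\partial p/\partial x=a'(x)\xi^2-b'(x)\xi$; it is complete if the maximal interval of definition of every integral curve is $\mathbb{R}$. The operator $P$ is symmetric on $C^\infty(S^1)$. Its adjoint $P^\star$ has as domain the set of $f\in L^2$ such that $Pf$ (in the sense of distributions) belongs to $L^2$, and $P^\star f=Pf$. $P$ is essentially self-adjoint if the graph of $P^\star$ is the closure in $L^2\times L^2$ of the graph of $P$ restricted to $C^\infty(S^1)$; i.e. for all $u,v\in L^2$ with $v=Pu$ there are smooth $u_n$ with $(u_n,Pu_n)\to(u,v)$ in $L^2\times L^2$. *)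

theory Defs
  imports "HOL-Analysis.Analysis"
begin

text \<open>Functions on the circle \<open>\<real>/\<int>\<close> are represented by 1-periodic functions on the real line.\<close>

definition periodic1 :: "(real \<Rightarrow> 'a) \<Rightarrow> bool" where
  "periodic1 f \<longleftrightarrow> (\<forall>x. f (x + 1) = f x)"

definition ddx :: "(real \<Rightarrow> 'a::real_normed_vector) \<Rightarrow> real \<Rightarrow> 'a" where
  "ddx f x = vector_derivative f (at x)"

definition Cinf_S1 :: "(real \<Rightarrow> 'a::real_normed_vector) set" where
  "Cinf_S1 = {f. periodic1 f \<and> (\<forall>n x. (ddx ^^ n) f differentiable (at x))}"

definition finite_multiplicity_zero :: "(real \<Rightarrow> real) \<Rightarrow> real \<Rightarrow> bool" where
  "finite_multiplicity_zero f x \<longleftrightarrow> f x = 0 \<and> (\<exists>n. (ddx ^^ n) f x \<noteq> 0)"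


section \<open>Hamiltonian flow\<close>

text \<open>
  For a Hamiltonian \<open>p x \<xi>\<close> that is 1-periodic in \<open>x\<close>, curves in the cotangent bundle of the
  circle are given by their lifts \<open>t \<mapsto> (X t, \<Xi> t)\<close> to the universal cover; the lift
  exists on the whole interval of definition and is unique up to an integer shift of \<open>X\<close>, so the
  maximal intervals of definition are the same upstairs and downstairs.
\<close>

definition integral_curve ::
  "(real \<Rightarrow> real \<Rightarrow> real) \<Rightarrow> real set \<Rightarrow> (real \<Rightarrow> real) \<Rightarrow> (real \<Rightarrow> real) \<Rightarrow> bool" where
  "integral_curve p J X \<Xi> \<longleftrightarrow>
     open J \<and> is_interval J \<and> J \<noteq> {} \<and>
     (\<forall>t\<in>J. (X has_real_derivative deriv (\<lambda>\<xi>. p (X t) \<xi>) (\<Xi> t)) (at t) \<and>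
            (\<Xi> has_real_derivative - deriv (\<lambda>x. p x (\<Xi> t)) (X t)) (at t))"

definition maximal_integral_curve ::
  "(real \<Rightarrow> real \<Rightarrow> real) \<Rightarrow> real set \<Rightarrow> (real \<Rightarrow> real) \<Rightarrow> (real \<Rightarrow> real) \<Rightarrow> bool" where
  "maximal_integral_curve p J X \<Xi> \<longleftrightarrow>
     integral_curve p J X \<Xi> \<and>
     (\<forall>J' X' \<Xi>'. integral_curve p J' X' \<Xi>' \<and> J \<subseteq> J' \<and>
        (\<forall>t\<in>J. X' t = X t \<and> \<Xi>' t = \<Xi> t) \<longrightarrow> J' = J)"

definition hamiltonian_flow_complete :: "(real \<Rightarrow> real \<Rightarrow> real) \<Rightarrow> bool" where
  "hamiltonian_flow_complete p \<longleftrightarrow>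
     (\<forall>J X \<Xi>. maximal_integral_curve p J X \<Xi> \<longrightarrow> J = UNIV)"

definition symbol_p :: "(real \<Rightarrow> real) \<Rightarrow> (real \<Rightarrow> real) \<Rightarrow> real \<Rightarrow> real \<Rightarrow> real" where
  "symbol_p a b x \<xi> = - a x * \<xi>\<^sup>2 + b x * \<xi>"


section \<open>The Hilbert space \<open>L\<^sup>2\<close> of the circle\<close>

text \<open>
  Elements of \<open>L\<^sup>2\<close> are given by Borel representatives and are not quotiented by almost
  everywhere equality; every notion below is invariant under changing a representative on a null set.
\<close>

definition L2_S1 :: "(real \<Rightarrow> complex) set" where
  "L2_S1 = {u. periodic1 u \<and> u \<in> borel_measurable lborel \<and>
               set_integrable lborel {0..1} (\<lambda>x. (cmod (u x))\<^sup>2)}"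

definition L2_dist :: "(real \<Rightarrow> complex) \<Rightarrow> (real \<Rightarrow> complex) \<Rightarrow> real" where
  "L2_dist u v = sqrt (LINT x:{0..1}|lborel. (cmod (u x - v x))\<^sup>2)"

definition L2_graph_closure ::
  "((real \<Rightarrow> complex) \<times> (real \<Rightarrow> complex)) set \<Rightarrow> ((real \<Rightarrow> complex) \<times> (real \<Rightarrow> complex)) set" where
  "L2_graph_closure G =
     {(u, v). u \<in> L2_S1 \<and> v \<in> L2_S1 \<and>
        (\<exists>g h. (\<forall>n::nat. (g n, h n) \<in> G) \<and>
           (\<lambda>n. L2_dist (g n) u) \<longlonglongrightarrow> 0 \<and> (\<lambda>n. L2_dist (h n) v) \<longlonglongrightarrow> 0)}"


section \<open>Distributions on the circle\<close>

text \<open>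
  A distribution is used only through its values on test functions in \<^const>\<open>Cinf_S1\<close>.  The pairing
  is bilinear (no complex conjugation).
\<close>

type_synonym distr = "(real \<Rightarrow> complex) \<Rightarrow> complex"

definition distr_of :: "(real \<Rightarrow> complex) \<Rightarrow> distr" where
  "distr_of u \<phi> = (LINT x:{0..1}|lborel. u x * \<phi> x)"

definition distr_ddx :: "distr \<Rightarrow> distr" where
  "distr_ddx T \<phi> = - T (ddx \<phi>)"

definition distr_mult :: "(real \<Rightarrow> real) \<Rightarrow> distr \<Rightarrow> distr" where
  "distr_mult g T \<phi> = T (\<lambda>x. of_real (g x) * \<phi> x)"


section \<open>The operator\<close>

definition op_P ::
  "(real \<Rightarrow> real) \<Rightarrow> (real \<Rightarrow> real) \<Rightarrow> (real \<Rightarrow> real) \<Rightarrow> (real \<Rightarrow> complex) \<Rightarrow> real \<Rightarrow> complex" where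
  "op_P a b c f x =
     ddx (\<lambda>y. of_real (a y) * ddx f y) x - \<i> * of_real (b x) * ddx f x
       - \<i> / 2 * of_real (ddx b x) * f x + of_real (c x) * f x"

definition distr_P ::
  "(real \<Rightarrow> real) \<Rightarrow> (real \<Rightarrow> real) \<Rightarrow> (real \<Rightarrow> real) \<Rightarrow> distr \<Rightarrow> distr" where
  "distr_P a b c T \<phi> =
     distr_ddx (distr_mult a (distr_ddx T)) \<phi> - \<i> * distr_mult b (distr_ddx T) \<phi>
       - \<i> / 2 * distr_mult (ddx b) T \<phi> + distr_mult c T \<phi>"

definition graph_P ::
  "(real \<Rightarrow> real) \<Rightarrow> (real \<Rightarrow> real) \<Rightarrow> (real \<Rightarrow> real) \<Rightarrow> ((real \<Rightarrow> complex) \<times> (real \<Rightarrow> complex)) set" where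
  "graph_P a b c = {(f, op_P a b c f) |f. f \<in> Cinf_S1}"

definition graph_P_adj ::
  "(real \<Rightarrow> real) \<Rightarrow> (real \<Rightarrow> real) \<Rightarrow> (real \<Rightarrow> real) \<Rightarrow> ((real \<Rightarrow> complex) \<times> (real \<Rightarrow> complex)) set" where
  "graph_P_adj a b c =
     {(u, v). u \<in> L2_S1 \<and> v \<in> L2_S1 \<and>
        (\<forall>\<phi>\<in>Cinf_S1. distr_P a b c (distr_of u) \<phi> = distr_of v \<phi>)}"

definition essentially_self_adjoint_P ::
  "(real \<Rightarrow> real) \<Rightarrow> (real \<Rightarrow> real) \<Rightarrow> (real \<Rightarrow> real) \<Rightarrow> bool" where
  "essentially_self_adjoint_P a b c \<longleftrightarrow> graph_P_adj a b c = L2_graph_closure (graph_P a b c)"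

end

theory Submission
  imports Defs
begin

text \<open>
  Both properties are equivalent to the degeneracy condition that \<open>a'\<close> and \<open>b\<close> vanish at every zero
  of \<open>a\<close>.  Since the zeros have finite multiplicity, this condition yields a constant \<open>K\<close> with
  \<open>a'\<^sup>2 \<le> K \<bar>a\<bar>\<close> and \<open>\<bar>a' b\<bar> \<le> K \<bar>a\<bar>\<close>, and these two inequalities drive both halves of the argument.

  Flow: on the energy level \<open>b \<xi> - a \<xi>\<^sup>2 = E\<close> they give \<open>\<bar>\<xi>'\<bar> \<le> C \<bar>\<xi>\<bar>\<close>, so \<open>\<xi>\<close> stays bounded in finite
  time.  Conversely, if \<open>b (x\<^sub>0) \<noteq> 0\<close>, the curve \<open>x' = - b (x)\<close>, \<open>\<xi> = b (x) / a (x)\<close> blows up when it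
  reaches \<open>x\<^sub>0\<close>; if \<open>b (x\<^sub>0) = 0 \<noteq> a' (x\<^sub>0)\<close>, the fibre over \<open>x\<^sub>0\<close> carries a Riccati equation.

  Operator: the cutoff \<open>\<chi> = a\<^sup>2 / (a\<^sup>2 + \<epsilon>\<^sup>2)\<close> is smooth, it removes the zeros of \<open>a\<close>, and a Caccioppoli
  estimate shows \<open>P (\<chi> u) - \<chi> P u \<rightarrow> 0\<close> for \<open>u\<close> in the domain of the adjoint, while \<open>\<chi> u\<close> is of class
  \<open>H\<^sup>2\<close>.  Conversely, the boundary form of the adjoint does not vanish: if \<open>b (x\<^sub>0) \<noteq> 0\<close>, evaluate it at
  \<open>exp (i \<integral> b / a)\<close>, cut off to one side of \<open>x\<^sub>0\<close>; if \<open>b (x\<^sub>0) = 0 \<noteq> a' (x\<^sub>0)\<close>, at the pair formed by a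
  one-sided step and \<open>ln \<bar>a\<bar>\<close>.
\<close>

section \<open>Smooth functions\<close>

text \<open>The blow-up curves and the singular elements of the adjoint domain are one object seen
  twice. \<open>\<xi> = b / a\<close> is the second root of \<open>p = 0\<close>, so
  \<open>exp (i \<integral> b / a)\<close> is the wave whose phase follows the zero energy level.
  Since \<open>a u' - i b u\<close> vanishes on it, \<open>P\<close> maps it to a bounded function
  although it oscillates without limit at the zero. At a simple zero of \<open>a\<close> where
  \<open>b\<close> vanishes too, that root stays bounded and only the fibre escapes; there
  \<open>ln |a|\<close> takes over, because \<open>a (ln |a|)' = a'\<close> is smooth. For
  self-adjointness the obstacle is that the adjoint domain gives no control of \<open>u'\<close>
  near the zeros. The cutoff depends on x through \<open>a\<close> alone, so its derivative carries
  a factor \<open>a'\<close>, which the two inequalities convert into \<open>a\<close>. All error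
  terms are then bounded by one weight, \<open>k = chi (1 - chi)\<close>, which is at most 1/4 and
  tends to 0 off the zeros, so dominated convergence suffices and no rate has to be found.\<close>

definition smooth :: "(real \<Rightarrow> 'a::real_normed_vector) \<Rightarrow> bool" where
  "smooth f \<longleftrightarrow> (\<forall>n x. (ddx ^^ n) f differentiable (at x))"

lemma Cinf_S1_iff: "f \<in> Cinf_S1 \<longleftrightarrow> periodic1 f \<and> smooth f"
  by (simp add: Cinf_S1_def smooth_def)

lemma ddx_eq: "(f has_vector_derivative D) (at x) \<Longrightarrow> ddx f x = D"
  unfolding ddx_def by (rule vector_derivative_at)

lemma ddx_eqI: "(\<And>x. (f has_vector_derivative g x) (at x)) \<Longrightarrow> ddx f = g"
  by (rule ext) (rule ddx_eq)

lemma smooth_vd: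
  assumes "smooth f" shows "(f has_vector_derivative ddx f x) (at x)"
  using assms[unfolded smooth_def, rule_format, of 0 x]
  by (simp add: ddx_def vector_derivative_works)

lemma smooth_DERIV:
  fixes f :: "real \<Rightarrow> real"
  assumes "smooth f" shows "(f has_real_derivative ddx f x) (at x)"
  using smooth_vd[OF assms] by (simp add: has_real_derivative_iff_has_vector_derivative)

lemma smooth_ddx: "smooth f \<Longrightarrow> smooth (ddx f)"
  unfolding smooth_def by (metis funpow_Suc_right comp_apply)

lemma smooth_funpow: "smooth f \<Longrightarrow> smooth ((ddx ^^ n) f)"
  by (induction n) (auto intro: smooth_ddx)

text \<open>Smoothness quantifies over all iterates of \<open>ddx\<close>. A class of differentiable
  functions stable under \<open>ddx\<close> contains all of them, so exhibiting such a class
  replaces every formula for an n-th derivative.\<close>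

lemma smooth_coinduct:
  assumes "f \<in> S" and "\<And>g x. g \<in> S \<Longrightarrow> g differentiable (at x)" and "\<And>g. g \<in> S \<Longrightarrow> ddx g \<in> S"
  shows "smooth f"
proof -
  have "(ddx ^^ n) f \<in> S" for n by (induction n) (use assms in auto)
  then show ?thesis using assms(2) by (auto simp: smooth_def)
qed

lemma smooth_antideriv:
  assumes "\<And>x. (f has_vector_derivative g x) (at x)" and "smooth g"
  shows "smooth f"
proof (rule smooth_coinduct[where S="insert f {h. smooth h}"])
  show "h differentiable (at x)" if "h \<in> insert f {h. smooth h}" for h x
    using that assms(1) smooth_vd by (auto intro: differentiableI_vector)
  show "ddx h \<in> insert f {h. smooth h}" if "h \<in> insert f {h. smooth h}" for h
    using that assms(2) ddx_eqI[OF assms(1)] smooth_ddx by auto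
qed simp

lemma smooth_const [simp]: "smooth (\<lambda>x. k)"
  by (rule smooth_coinduct[where S="range (\<lambda>k x. k)"])
    (auto simp: ddx_eqI[where g="\<lambda>_. 0", OF has_vector_derivative_const])

text \<open>Products alone are not stable under differentiation, but sums, products and inverses
  together are: this is the class handed to \<open>smooth_coinduct\<close>, in place of the Leibniz
  formula.\<close>

inductive_set smooth_gen :: "(real \<Rightarrow> 'a::real_normed_field) set" where
  base: "smooth f \<Longrightarrow> f \<in> smooth_gen"
| add: "f \<in> smooth_gen \<Longrightarrow> g \<in> smooth_gen \<Longrightarrow> (\<lambda>x. f x + g x) \<in> smooth_gen"
| mult: "f \<in> smooth_gen \<Longrightarrow> g \<in> smooth_gen \<Longrightarrow> (\<lambda>x. f x * g x) \<in> smooth_gen"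
| inv: "f \<in> smooth_gen \<Longrightarrow> (\<And>x. f x \<noteq> 0) \<Longrightarrow> (\<lambda>x. inverse (f x)) \<in> smooth_gen"

lemma smooth_gen_deriv:
  fixes f :: "real \<Rightarrow> 'a::real_normed_field"
  assumes "f \<in> smooth_gen"
  shows "\<exists>g\<in>smooth_gen. \<forall>x. (f has_vector_derivative g x) (at x)"
  using assms
proof induction
  case (base f)
  then show ?case using smooth_vd smooth_ddx smooth_gen.base by blast
next
  case (add f g)
  then obtain f' g' where "f' \<in> smooth_gen" "g' \<in> smooth_gen"
    "\<And>x. (f has_vector_derivative f' x) (at x)" "\<And>x. (g has_vector_derivative g' x) (at x)" by blast
  then show ?case
    by (intro bexI[of _ "\<lambda>x. f' x + g' x"]) (auto intro: smooth_gen.add derivative_intros)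
next
  case (mult f g)
  then obtain f' g' where *: "f' \<in> smooth_gen" "g' \<in> smooth_gen"
    "\<And>x. (f has_vector_derivative f' x) (at x)" "\<And>x. (g has_vector_derivative g' x) (at x)" by blast
  have "((\<lambda>x. f x * g x) has_vector_derivative (f x * g' x + f' x * g x)) (at x)" for x
    using * by (intro has_vector_derivative_mult)
  then show ?case using * mult
    by (intro bexI[of _ "\<lambda>x. f x * g' x + f' x * g x"]) (auto intro!: smooth_gen.add smooth_gen.mult smooth_gen.inv)
next
  case (inv f)
  then obtain f' where *: "f' \<in> smooth_gen" "\<And>x. (f has_vector_derivative f' x) (at x)" by blast
  have "((\<lambda>x. inverse (f x)) has_vector_derivative ((-1) * (inverse (f x) * f' x * inverse (f x)))) (at x)" for x
  proof -
    have nz: "f x \<noteq> 0" and d: "(f has_derivative (\<lambda>h. h *\<^sub>R f' x)) (at x)"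
      using inv *(2)[of x] by (auto simp: has_vector_derivative_def)
    show ?thesis using Deriv.has_derivative_inverse[OF nz d] by (simp add: has_vector_derivative_def)
  qed
  moreover have "(\<lambda>x. -1 :: 'a) \<in> smooth_gen" by (simp add: smooth_gen.base)
  moreover have "(\<lambda>x. inverse (f x)) \<in> smooth_gen" using inv by (intro smooth_gen.inv)
  ultimately show ?case using *
    by (intro bexI[of _ "\<lambda>x. (-1) * (inverse (f x) * f' x * inverse (f x))"] smooth_gen.mult allI)
qed

lemma smooth_gen_smooth:
  assumes "f \<in> smooth_gen" shows "smooth f"
proof (rule smooth_coinduct[where S=smooth_gen])
  show "g differentiable (at x)" if "g \<in> smooth_gen" for g :: "real \<Rightarrow> 'a" and x
    using smooth_gen_deriv[OF that] by (auto intro: differentiableI_vector)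
  show "ddx g \<in> smooth_gen" if "g \<in> smooth_gen" for g :: "real \<Rightarrow> 'a"
    using smooth_gen_deriv[OF that] ddx_eqI by metis
qed (rule assms)

lemma smooth_add: "smooth f \<Longrightarrow> smooth g \<Longrightarrow> smooth (\<lambda>x. f x + g x)"
  for f g :: "real \<Rightarrow> 'a::real_normed_field"
  by (rule smooth_gen_smooth[OF smooth_gen.add[OF smooth_gen.base smooth_gen.base]])

lemma smooth_mult: "smooth f \<Longrightarrow> smooth g \<Longrightarrow> smooth (\<lambda>x. f x * g x)"
  for f g :: "real \<Rightarrow> 'a::real_normed_field"
  by (rule smooth_gen_smooth[OF smooth_gen.mult[OF smooth_gen.base smooth_gen.base]])

lemma smooth_inverse: "smooth f \<Longrightarrow> (\<And>x. f x \<noteq> 0) \<Longrightarrow> smooth (\<lambda>x. inverse (f x))"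
  for f :: "real \<Rightarrow> 'a::real_normed_field"
  by (rule smooth_gen_smooth[OF smooth_gen.inv[OF smooth_gen.base]])

lemma smooth_divide: "smooth f \<Longrightarrow> smooth g \<Longrightarrow> (\<And>x. g x \<noteq> 0) \<Longrightarrow> smooth (\<lambda>x. f x / g x)"
  for f g :: "real \<Rightarrow> 'a::real_normed_field"
  unfolding divide_inverse by (intro smooth_mult smooth_inverse)

lemma smooth_minus: "smooth f \<Longrightarrow> smooth (\<lambda>x. - f x)"
  for f :: "real \<Rightarrow> 'a::real_normed_field"
  using smooth_mult[OF smooth_const[of "-1"], of f] by simp

lemma smooth_diff: "smooth f \<Longrightarrow> smooth g \<Longrightarrow> smooth (\<lambda>x. f x - g x)"
  for f g :: "real \<Rightarrow> 'a::real_normed_field"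
  using smooth_add[OF _ smooth_minus, of f g] by simp

lemma smooth_power: "smooth f \<Longrightarrow> smooth (\<lambda>x. f x ^ n)"
  for f :: "real \<Rightarrow> 'a::real_normed_field"
  by (induction n) (auto intro: smooth_mult)

lemma smooth_bounded_linear:
  assumes "bounded_linear L" and "smooth f" shows "smooth (\<lambda>x. L (f x))"
proof (rule smooth_coinduct[where S="{\<lambda>x. L (g x) |g. smooth g}"])
  have *: "((\<lambda>x. L (g x)) has_vector_derivative L (ddx g x)) (at x)" if "smooth g" for g x
    using bounded_linear.has_vector_derivative[OF assms(1) smooth_vd[OF that]] .
  show "h differentiable (at x)" if "h \<in> {\<lambda>x. L (g x) |g. smooth g}" for h x
    using that * by (auto intro: differentiableI_vector)
  show "ddx h \<in> {\<lambda>x. L (g x) |g. smooth g}" if "h \<in> {\<lambda>x. L (g x) |g. smooth g}" for h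
    using that ddx_eqI[OF *] smooth_ddx by fastforce
qed (use assms(2) in auto)

lemma smooth_of_real: "smooth f \<Longrightarrow> smooth (\<lambda>x. complex_of_real (f x))"
  by (rule smooth_bounded_linear[OF bounded_linear_of_real])

lemma smooth_cnj: "smooth f \<Longrightarrow> smooth (\<lambda>x. cnj (f x))"
  by (rule smooth_bounded_linear[OF bounded_linear_cnj])

lemma smooth_continuous: "smooth f \<Longrightarrow> continuous_on S f"
  using smooth_vd has_vector_derivative_continuous
  by (metis continuous_at_imp_continuous_on)

lemmas smooth_intros = smooth_const smooth_add smooth_mult smooth_minus smooth_diff smooth_power
  smooth_of_real smooth_cnj smooth_ddx smooth_divide

section \<open>Periodic functions and the algebra of smooth functions on the circle\<close>

lemma periodic1_nat: "periodic1 f \<Longrightarrow> f (x + real n) = f x"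
proof (induction n)
  case (Suc n)
  have "f (x + real (Suc n)) = f ((x + real n) + 1)" by (rule arg_cong[where f=f]) simp
  with Suc show ?case by (metis periodic1_def)
qed simp

lemma periodic1_int: "periodic1 f \<Longrightarrow> f (x + of_int n) = f x"
proof (cases "n \<ge> 0")
  case True
  then show "periodic1 f \<Longrightarrow> ?thesis" using periodic1_nat[of f x "nat n"] by simp
next
  case False
  then show "periodic1 f \<Longrightarrow> ?thesis" using periodic1_nat[of f "x + of_int n" "nat (-n)"] by simp
qed

lemma periodic1_frac: "periodic1 f \<Longrightarrow> f (frac x) = f x"
  using periodic1_int[of f "frac x" "\<lfloor>x\<rfloor>"] by (simp add: frac_def)

lemma periodic1_bound:
  assumes "periodic1 f" and "\<And>x. 0 \<le> x \<Longrightarrow> x \<le> 1 \<Longrightarrow> P (f x)" shows "P (f x)"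
proof -
  have "0 \<le> frac x" "frac x \<le> 1" by (auto intro: less_imp_le[OF frac_lt_1])
  then show ?thesis using periodic1_frac[OF assms(1)] assms(2) by metis
qed

lemma has_vector_derivative_at_shift:
  assumes "(f has_vector_derivative D) (at (x + c))"
  shows "((\<lambda>y. f (y + c)) has_vector_derivative D) (at x)"
proof -
  have "((\<lambda>y. y + c) has_vector_derivative 1) (at x)"
    by (auto intro!: derivative_eq_intros)
  from vector_diff_chain_at[OF this assms] show ?thesis by (simp add: o_def)
qed

text \<open>\<open>vector_derivative\<close> is a choice among the derivatives at a point, and the
  set of derivatives is the same at \<open>x\<close> and at \<open>x + 1\<close>; the argument
  therefore covers points where \<open>f\<close> has none.\<close>

lemma periodic1_ddx:
  assumes "periodic1 f" shows "periodic1 (ddx f)"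
  unfolding periodic1_def
proof
  fix x
  have f: "(\<lambda>y. f (y + 1)) = f" "(\<lambda>y. f (y + -1)) = f"
    using assms periodic1_int[OF assms, of _ "-1"] by (auto simp: periodic1_def)
  have "(f has_vector_derivative D) (at (x + 1)) \<longleftrightarrow> (f has_vector_derivative D) (at x)" for D
    using has_vector_derivative_at_shift[of f D x 1] has_vector_derivative_at_shift[of f D "x + 1" "-1"]
    unfolding f by auto
  then show "ddx f (x + 1) = ddx f x" by (simp add: ddx_def vector_derivative_def)
qed

lemma Cinf_ddx: "f \<in> Cinf_S1 \<Longrightarrow> ddx f \<in> Cinf_S1"
  by (simp add: Cinf_S1_iff smooth_ddx periodic1_ddx)

lemma Cinf_vd: "f \<in> Cinf_S1 \<Longrightarrow> (f has_vector_derivative ddx f x) (at x)"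
  by (simp add: Cinf_S1_iff smooth_vd)

lemma Cinf_bounded:
  fixes f :: "real \<Rightarrow> 'a::real_normed_vector"
  assumes "f \<in> Cinf_S1" obtains B where "B > 0" "\<And>x. norm (f x) \<le> B"
proof -
  have "compact (f ` {0..1})"
    using assms by (intro compact_continuous_image smooth_continuous) (auto simp: Cinf_S1_iff)
  then obtain B where B: "B > 0" "\<And>y. y \<in> f ` {0..1} \<Longrightarrow> norm y \<le> B"
    by (meson bounded_pos compact_imp_bounded)
  have "norm (f x) \<le> B" for x
    by (rule periodic1_bound[where f=f]) (use assms B in \<open>auto simp: Cinf_S1_iff\<close>)
  then show ?thesis using B that by blast
qed

lemma Cinf_const [simp]: "(\<lambda>x. k) \<in> Cinf_S1"
  by (simp add: Cinf_S1_iff periodic1_def)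

lemma Cinf_add: "f \<in> Cinf_S1 \<Longrightarrow> g \<in> Cinf_S1 \<Longrightarrow> (\<lambda>x. f x + g x) \<in> Cinf_S1"
  and Cinf_diff: "f \<in> Cinf_S1 \<Longrightarrow> g \<in> Cinf_S1 \<Longrightarrow> (\<lambda>x. f x - g x) \<in> Cinf_S1"
  and Cinf_mult: "f \<in> Cinf_S1 \<Longrightarrow> g \<in> Cinf_S1 \<Longrightarrow> (\<lambda>x. f x * g x) \<in> Cinf_S1"
  and Cinf_minus: "f \<in> Cinf_S1 \<Longrightarrow> (\<lambda>x. - f x) \<in> Cinf_S1"
  and Cinf_power: "f \<in> Cinf_S1 \<Longrightarrow> (\<lambda>x. f x ^ n) \<in> Cinf_S1"
  and Cinf_divide: "f \<in> Cinf_S1 \<Longrightarrow> g \<in> Cinf_S1 \<Longrightarrow> (\<And>x. g x \<noteq> 0) \<Longrightarrow> (\<lambda>x. f x / g x) \<in> Cinf_S1"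
  for f g :: "real \<Rightarrow> 'a::real_normed_field"
  by (auto simp: Cinf_S1_iff periodic1_def smooth_intros)

lemma Cinf_of_real: "f \<in> Cinf_S1 \<Longrightarrow> (\<lambda>x. complex_of_real (f x)) \<in> Cinf_S1"
  and Cinf_cnj: "g \<in> Cinf_S1 \<Longrightarrow> (\<lambda>x. cnj (g x)) \<in> Cinf_S1"
  by (auto simp: Cinf_S1_iff periodic1_def smooth_intros)

lemmas Cinf_intros = Cinf_const Cinf_add Cinf_mult Cinf_minus Cinf_diff Cinf_power
  Cinf_of_real Cinf_cnj Cinf_ddx

lemma ddx_of_real: "smooth f \<Longrightarrow> ddx (\<lambda>x. complex_of_real (f x)) = (\<lambda>x. complex_of_real (ddx f x))"
  by (intro ddx_eqI has_vector_derivative_of_real smooth_DERIV)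

lemma ddx_cnj: "smooth f \<Longrightarrow> ddx (\<lambda>x. cnj (f x)) = (\<lambda>x. cnj (ddx f x))"
  by (intro ddx_eqI has_vector_derivative_cnj smooth_vd)

lemma ddx_mult: "smooth f \<Longrightarrow> smooth g \<Longrightarrow> ddx (\<lambda>x. f x * g x) = (\<lambda>x. f x * ddx g x + ddx f x * g x)"
  for f g :: "real \<Rightarrow> 'a::real_normed_field"
  by (intro ddx_eqI has_vector_derivative_mult smooth_vd)

lemma ddx_add: "smooth f \<Longrightarrow> smooth g \<Longrightarrow> ddx (\<lambda>x. f x + g x) = (\<lambda>x. ddx f x + ddx g x)"
  by (intro ddx_eqI has_vector_derivative_add smooth_vd)

section \<open>Zeros of finite multiplicity\<close>

lemma smooth_taylor:
  fixes f :: "real \<Rightarrow> real"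
  assumes "smooth f" and "\<And>k. k < m \<Longrightarrow> (ddx ^^ k) f x0 = 0"
  obtains t where "\<bar>t\<bar> \<le> \<bar>h\<bar>" "f (x0 + h) = (ddx ^^ m) f (x0 + t) / fact m * h ^ m"
proof -
  have "\<exists>t. \<bar>t\<bar> \<le> \<bar>h\<bar> \<and> f (x0 + h) =
      (\<Sum>k<m. (ddx ^^ k) f (x0 + 0) / fact k * h ^ k) + (ddx ^^ m) f (x0 + t) / fact m * h ^ m"
  proof (rule Maclaurin_all_le[where diff="\<lambda>n h. (ddx ^^ n) f (x0 + h)" and f="\<lambda>h. f (x0 + h)"])
    show "\<forall>n x. ((\<lambda>h. (ddx ^^ n) f (x0 + h)) has_real_derivative (ddx ^^ Suc n) f (x0 + x)) (at x)"
      using smooth_DERIV[OF smooth_funpow[OF assms(1)]]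
      by (auto simp: add.commute[of x0] DERIV_shift[symmetric])
  qed auto
  then show ?thesis using assms(2) that by auto
qed

lemma isCont_eps_delta:
  fixes f :: "real \<Rightarrow> real"
  assumes "isCont f x" and "e > 0"
  shows "\<exists>d>0. \<forall>y. \<bar>y - x\<bar> < d \<longrightarrow> \<bar>f y - f x\<bar> < e"
  using assms by (simp add: continuous_at_eps_delta dist_real_def)

text \<open>\<open>m\<close> is the order of the zero, the least index of a nonzero derivative.
  Taylor's formula with Lagrange remainder is applied to \<open>a\<close> up to order m and to
  \<open>a'\<close> up to order m - 1. Both remainders involve the same m-th derivative, which
  continuity keeps between \<open>A / 2\<close> and \<open>2 * A\<close> near
  \<open>x0\<close>.\<close>

lemma zero_order:
  fixes a :: "real \<Rightarrow> real"
  assumes "smooth a" and "finite_multiplicity_zero a x0"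
  obtains m c C d where "m \<ge> 1" "c > 0" "C > 0" "d > 0" "\<And>k. k < m \<Longrightarrow> (ddx ^^ k) a x0 = 0"
    "(ddx ^^ m) a x0 \<noteq> 0"
    "\<And>h. \<bar>h\<bar> < d \<Longrightarrow> c * \<bar>h\<bar> ^ m \<le> \<bar>a (x0 + h)\<bar>"
    "\<And>h. \<bar>h\<bar> < d \<Longrightarrow> \<bar>ddx a (x0 + h)\<bar> \<le> C * \<bar>h\<bar> ^ (m - 1)"
proof -
  obtain n where n: "(ddx ^^ n) a x0 \<noteq> 0" and a0: "a x0 = 0"
    using assms(2) by (auto simp: finite_multiplicity_zero_def)
  define m where "m = (LEAST n. (ddx ^^ n) a x0 \<noteq> 0)"
  have m: "(ddx ^^ m) a x0 \<noteq> 0" unfolding m_def by (rule LeastI[of _ n]) (rule n)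
  have m0: "(ddx ^^ k) a x0 = 0" if "k < m" for k using that not_less_Least[of k] m_def by blast
  have m1: "m \<ge> 1" using m a0 by (cases m) auto
  define A where "A = \<bar>(ddx ^^ m) a x0\<bar>"
  have A: "A > 0" using m A_def by simp
  have "isCont ((ddx ^^ m) a) x0"
    using smooth_continuous[OF smooth_funpow[OF assms(1)], of UNIV] by (simp add: continuous_on_eq_continuous_at)
  then obtain d where d: "d > 0" "\<And>y. \<bar>y - x0\<bar> < d \<Longrightarrow> \<bar>(ddx ^^ m) a y - (ddx ^^ m) a x0\<bar> < A / 2"
    using A isCont_eps_delta[of x0 "(ddx ^^ m) a" "A / 2"] by auto
  have bnd: "A / 2 \<le> \<bar>(ddx ^^ m) a (x0 + t)\<bar>" "\<bar>(ddx ^^ m) a (x0 + t)\<bar> \<le> 2 * A" if "\<bar>t\<bar> < d" for t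
  proof -
    have "\<bar>(ddx ^^ m) a (x0 + t) - (ddx ^^ m) a x0\<bar> < A / 2" using d(2)[of "x0 + t"] that by simp
    then show "A / 2 \<le> \<bar>(ddx ^^ m) a (x0 + t)\<bar>" "\<bar>(ddx ^^ m) a (x0 + t)\<bar> \<le> 2 * A"
      unfolding A_def by linarith+
  qed
  have 1: "A / 2 / fact m * \<bar>h\<bar> ^ m \<le> \<bar>a (x0 + h)\<bar>" if "\<bar>h\<bar> < d" for h
  proof -
    obtain t where t: "\<bar>t\<bar> \<le> \<bar>h\<bar>" "a (x0 + h) = (ddx ^^ m) a (x0 + t) / fact m * h ^ m"
      using smooth_taylor[OF assms(1) m0] by blast
    have "\<bar>a (x0 + h)\<bar> = \<bar>(ddx ^^ m) a (x0 + t)\<bar> / fact m * \<bar>h\<bar> ^ m"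
      unfolding t by (simp add: abs_mult power_abs)
    moreover have "A / 2 / fact m * \<bar>h\<bar> ^ m \<le> \<bar>(ddx ^^ m) a (x0 + t)\<bar> / fact m * \<bar>h\<bar> ^ m"
      using bnd(1)[of t] t(1) that by (intro mult_right_mono divide_right_mono) auto
    ultimately show ?thesis by simp
  qed
  have 2: "\<bar>ddx a (x0 + h)\<bar> \<le> 2 * A * \<bar>h\<bar> ^ (m - 1)" if "\<bar>h\<bar> < d" for h
  proof -
    have sw: "(ddx ^^ k) (ddx a) = (ddx ^^ Suc k) a" for k by (simp only: funpow_Suc_right comp_apply)
    obtain t where t: "\<bar>t\<bar> \<le> \<bar>h\<bar>" "ddx a (x0 + h) = (ddx ^^ (m - 1)) (ddx a) (x0 + t) / fact (m - 1) * h ^ (m - 1)"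
      using smooth_taylor[OF smooth_ddx[OF assms(1)], of "m - 1" x0 h] m0 unfolding sw by (metis Suc_less_eq Suc_pred' m1 less_eq_Suc_le One_nat_def)
    have "(ddx ^^ (m - 1)) (ddx a) = (ddx ^^ m) a" unfolding sw using m1 by simp
    then have "\<bar>ddx a (x0 + h)\<bar> = \<bar>(ddx ^^ m) a (x0 + t)\<bar> / fact (m - 1) * \<bar>h\<bar> ^ (m - 1)"
      unfolding t(2) by (simp add: abs_mult power_abs)
    also have "\<dots> \<le> 2 * A / 1 * \<bar>h\<bar> ^ (m - 1)"
      using bnd(2)[of t] t(1) that A
      by (intro mult_right_mono frac_le) auto
    finally show ?thesis by simp
  qed
  show ?thesis by (rule that[of m "A / 2 / fact m" "2 * A" d]) (use m1 A d m0 m 1 2 in auto)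
qed

lemma zeros_isolated:
  fixes a :: "real \<Rightarrow> real"
  assumes "smooth a" and "finite_multiplicity_zero a x0"
  shows "\<exists>d>0. \<forall>y. \<bar>y - x0\<bar> < d \<longrightarrow> y \<noteq> x0 \<longrightarrow> a y \<noteq> 0"
proof -
  obtain m c C d where *: "c > 0" "d > 0" "\<And>h. \<bar>h\<bar> < d \<Longrightarrow> c * \<bar>h\<bar> ^ m \<le> \<bar>a (x0 + h)\<bar>"
    using zero_order[OF assms] by metis
  have "a y \<noteq> 0" if "\<bar>y - x0\<bar> < d" "y \<noteq> x0" for y
  proof -
    have "0 < c * \<bar>y - x0\<bar> ^ m" using * that by simp
    then show ?thesis using *(3)[of "y - x0"] that by auto
  qed
  then show ?thesis using * by blast
qed

text \<open>An accumulation point would be a zero that is not isolated. The result makes the zeros a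
  null set, so that \<open>a\<close> is nonzero almost everywhere.\<close>

lemma zeros_finite:
  fixes a :: "real \<Rightarrow> real"
  assumes "smooth a" and "\<And>x. a x = 0 \<Longrightarrow> finite_multiplicity_zero a x"
  shows "finite {x \<in> {0..1}. a x = 0}"
proof (rule ccontr)
  define Z where "Z = {x \<in> {0..1}. a x = 0}"
  assume "infinite {x \<in> {0..1}. a x = 0}"
  then have "infinite Z" "Z \<subseteq> {0..1}" by (auto simp: Z_def)
  moreover have "\<forall>T. infinite T \<and> T \<subseteq> {0..1} \<longrightarrow> (\<exists>x\<in>{0..1::real}. x islimpt T)"
    using compact_Icc[of "0::real" 1] unfolding compact_eq_Bolzano_Weierstrass .
  ultimately obtain x where x: "x islimpt Z" by blast
  moreover have "closed Z" unfolding Z_def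
    by (rule continuous_closed_preimage_constant[OF smooth_continuous[OF assms(1)]]) simp
  ultimately have "x \<in> Z" unfolding closed_limpt by blast
  then have ax: "a x = 0" by (simp add: Z_def)
  obtain d where d: "d > 0" "\<And>y. \<bar>y - x\<bar> < d \<Longrightarrow> y \<noteq> x \<Longrightarrow> a y \<noteq> 0"
    using zeros_isolated[OF assms(1) assms(2)[OF ax]] by auto
  have "\<exists>y\<in>Z. y \<noteq> x \<and> dist y x < d"
    using x d(1) by (simp add: islimpt_approachable)
  then obtain y where y: "a y = 0" "y \<noteq> x" "dist y x < d" by (auto simp: Z_def)
  then show False using d(2)[of y] by (simp add: dist_real_def)
qed

definition degenerate_zeros :: "(real \<Rightarrow> real) \<Rightarrow> (real \<Rightarrow> real) \<Rightarrow> bool" where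
  "degenerate_zeros a b \<longleftrightarrow> (\<forall>x. a x = 0 \<longrightarrow> ddx a x = 0 \<and> b x = 0)"

text \<open>At a degenerate zero the order m is at least 2. With h the distance to it,
  \<open>a'\<close> is O(h^(m-1)) and \<open>b\<close> is O(h), so \<open>a' b\<close> is O(h^m) and
  \<open>a'^2\<close> is O(h^(2m-2)), which is O(h^m) because 2m - 2 >= m; and \<open>|a|\<close>
  dominates h^m. Away from the zeros \<open>|a|\<close> is bounded below, and compactness of a
  period makes the constant uniform.\<close>

lemma degenerate_bounds:
  assumes a: "a \<in> Cinf_S1" and b: "b \<in> Cinf_S1"
    and fm: "\<And>x. a x = 0 \<Longrightarrow> finite_multiplicity_zero a x" and C: "degenerate_zeros a b"
  obtains K where "K > 0" "\<And>x. (ddx a x)\<^sup>2 \<le> K * \<bar>a x\<bar>" "\<And>x. \<bar>ddx a x * b x\<bar> \<le> K * \<bar>a x\<bar>"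
proof -
  have sm: "smooth a" "smooth b" and pa: "periodic1 a" "periodic1 b" using a b by (auto simp: Cinf_S1_iff)
  \<comment> \<open>The sum of both quantities, so that a single covering argument yields one
    constant for the two inequalities.\<close>
  define G where "G x = (ddx a x)\<^sup>2 + \<bar>ddx a x * b x\<bar>" for x
  have contG: "continuous_on UNIV G" unfolding G_def
    by (intro continuous_intros smooth_continuous smooth_ddx sm)
  have loc: "\<exists>K d. d > 0 \<and> (\<forall>y. \<bar>y - x\<bar> < d \<longrightarrow> G y \<le> K * \<bar>a y\<bar>)" for x
  proof (cases "a x = 0")
    case False
    have "isCont a x" "isCont G x" using sm contG smooth_continuous[of a UNIV]
      by (auto simp: continuous_on_eq_continuous_at)
    moreover have "\<bar>a x\<bar> / 2 > 0" using False by simp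
    ultimately obtain d where d: "d > 0" "\<And>y. \<bar>y - x\<bar> < d \<Longrightarrow> \<bar>a y - a x\<bar> < \<bar>a x\<bar> / 2"
      using isCont_eps_delta[of x a "\<bar>a x\<bar> / 2"] by auto
    obtain e where e: "e > 0" "\<And>y. \<bar>y - x\<bar> < e \<Longrightarrow> \<bar>G y - G x\<bar> < 1"
      using isCont_eps_delta[OF \<open>isCont G x\<close> zero_less_one] by auto
    have "G x \<ge> 0" by (simp add: G_def)
    have "G y \<le> (G x + 1) / (\<bar>a x\<bar> / 2) * \<bar>a y\<bar>" if "\<bar>y - x\<bar> < min d e" for y
    proof -
      have "G y \<le> (G x + 1) / (\<bar>a x\<bar> / 2) * (\<bar>a x\<bar> / 2)" using e(2)[of y] that False by auto
      also have "\<bar>a y - a x\<bar> < \<bar>a x\<bar> / 2" using d(2)[of y] that by simp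
      then have "\<bar>a x\<bar> / 2 \<le> \<bar>a y\<bar>" by linarith
      then have "(G x + 1) / (\<bar>a x\<bar> / 2) * (\<bar>a x\<bar> / 2) \<le> (G x + 1) / (\<bar>a x\<bar> / 2) * \<bar>a y\<bar>"
        using \<open>G x \<ge> 0\<close> by (intro mult_left_mono) auto
      finally show ?thesis .
    qed
    then show ?thesis using d e by (metis min_less_iff_conj)
  next
    case True
    obtain m c A d where *: "m \<ge> 1" "c > 0" "A > 0" "d > 0" "(ddx ^^ m) a x \<noteq> 0"
      and lo: "\<And>h. \<bar>h\<bar> < d \<Longrightarrow> c * \<bar>h\<bar> ^ m \<le> \<bar>a (x + h)\<bar>"
      and up: "\<And>h. \<bar>h\<bar> < d \<Longrightarrow> \<bar>ddx a (x + h)\<bar> \<le> A * \<bar>h\<bar> ^ (m - 1)"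
      using zero_order[OF sm(1) fm[OF True]] by metis
    have "m \<noteq> 1" using *(5) C True by (auto simp: degenerate_zeros_def)
    then have m2: "m \<ge> 2" using *(1) by simp
    have b0: "b x = 0" using C True by (auto simp: degenerate_zeros_def)
    obtain B where B: "B > 0" "\<And>y. \<bar>ddx b y\<bar> \<le> B" using Cinf_bounded[OF Cinf_ddx[OF b]] by auto
    have bb: "\<bar>b (x + h)\<bar> \<le> B * \<bar>h\<bar>" for h
    proof -
      obtain t where "b (x + h) = (ddx ^^ 1) b (x + t) / fact 1 * h ^ 1"
        using smooth_taylor[OF sm(2), of 1 x h] b0 by auto
      then show ?thesis using B by (simp add: abs_mult mult_right_mono)
    qed
    have "G y \<le> (A\<^sup>2 + A * B) / c * \<bar>a y\<bar>" if "\<bar>y - x\<bar> < min d 1" for y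
    proof -
      define h where "h = y - x"
      have h: "\<bar>h\<bar> < d" "\<bar>h\<bar> \<le> 1" "y = x + h" using that by (auto simp: h_def)
      have "\<bar>h\<bar> ^ (2 * (m - 1)) \<le> \<bar>h\<bar> ^ m" using h m2 by (intro power_decreasing) auto
      moreover have "(ddx a y)\<^sup>2 \<le> (A * \<bar>h\<bar> ^ (m - 1))\<^sup>2"
        using up[OF h(1)] h(3) by (metis abs_ge_zero power2_abs power_mono)
      ultimately have 1: "(ddx a y)\<^sup>2 \<le> A\<^sup>2 * \<bar>h\<bar> ^ m"
        by (smt (verit, best) power_mult_distrib power_mult mult.commute mult_left_mono zero_le_power2)
      have "\<bar>ddx a y\<bar> * \<bar>b y\<bar> \<le> (A * \<bar>h\<bar> ^ (m - 1)) * (B * \<bar>h\<bar>)"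
        unfolding h(3) using up[OF h(1)] bb[of h] by (intro mult_mono) (use * in auto)
      also have "\<dots> = A * B * \<bar>h\<bar> ^ m" using m2 by (cases m) auto
      finally have 2: "\<bar>ddx a y * b y\<bar> \<le> A * B * \<bar>h\<bar> ^ m" by (simp add: abs_mult)
      have "(A\<^sup>2 + A * B) / c * (c * \<bar>h\<bar> ^ m) = A\<^sup>2 * \<bar>h\<bar> ^ m + A * B * \<bar>h\<bar> ^ m"
        using *(2) by (simp add: field_simps)
      then have "G y \<le> (A\<^sup>2 + A * B) / c * (c * \<bar>h\<bar> ^ m)"
        unfolding G_def using 1 2 by linarith
      also have "\<dots> \<le> (A\<^sup>2 + A * B) / c * \<bar>a y\<bar>"
        using lo[OF h(1)] h(3) * B by (intro mult_left_mono) auto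
      finally show ?thesis .
    qed
    then show ?thesis using *(4) by (metis min_less_iff_conj zero_less_one)
  qed
  then obtain Kf df where Kd: "\<And>x. df x > 0" "\<And>x y. \<bar>y - x\<bar> < df x \<Longrightarrow> G y \<le> Kf x * \<bar>a y\<bar>"
    by metis
  have "{0..1} \<subseteq> (\<Union>x\<in>{0..1}. ball x (df x))" using Kd(1) by force
  then obtain T where T: "T \<subseteq> {0..1}" "finite T" "{0..1} \<subseteq> (\<Union>x\<in>T. ball x (df x))"
    using compactE_image[OF compact_Icc, of "{0..1::real}" "\<lambda>x. ball x (df x)"] by (metis open_ball)
  define K where "K = 1 + (\<Sum>x\<in>T. \<bar>Kf x\<bar>)"
  have G1: "G y \<le> K * \<bar>a y\<bar>" if "0 \<le> y" "y \<le> 1" for y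
  proof -
    have "y \<in> (\<Union>x\<in>T. ball x (df x))"
      by (rule subsetD[OF T(3)]) (use that in simp)
    then obtain x where "x \<in> T" "y \<in> ball x (df x)" by blast
    then have x: "x \<in> T" "\<bar>y - x\<bar> < df x" by (auto simp: dist_real_def)
    have "Kf x \<le> K" unfolding K_def using member_le_sum[OF x(1), of "\<lambda>x. \<bar>Kf x\<bar>"] T(2) by auto
    then show ?thesis using Kd(2)[OF x(2)] by (meson abs_ge_zero mult_right_mono order_trans)
  qed
  \<comment> \<open>\<open>periodic1_bound\<close> handles a property of one function; pairing
    \<open>G\<close> with \<open>a\<close> lets it carry over a comparison of two.\<close>
  have per: "periodic1 (\<lambda>y. (G y, a y))"
    using pa periodic1_ddx[OF pa(1)] by (auto simp: periodic1_def G_def)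
  have "fst (G y, a y) \<le> K * \<bar>snd (G y, a y)\<bar>" for y
    by (rule periodic1_bound[OF per]) (use G1 in auto)
  then have G2: "G y \<le> K * \<bar>a y\<bar>" for y by simp
  have "K > 0" unfolding K_def by (smt (verit) sum_nonneg abs_ge_zero)
  moreover have "(ddx a x)\<^sup>2 \<le> G x" "\<bar>ddx a x * b x\<bar> \<le> G x" for x by (auto simp: G_def)
  ultimately show ?thesis using G2 that by (meson order_trans)
qed

section \<open>Local solutions of ordinary differential equations\<close>

text \<open>The fundamental theorem tolerates finitely many exceptional points, so \<open>f\<close>
  is a constant plus the integral of \<open>g\<close>, and that integral has derivative
  \<open>g\<close> at every interior point because \<open>g\<close> is continuous. It serves to join
  two solution pieces with a two-sided derivative at the junction.\<close>

lemma derivative_removable: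
  fixes f :: "real \<Rightarrow> 'a::banach"
  assumes f: "continuous_on {p..q} f" and g: "continuous_on {p..q} g" and K: "finite K"
    and d: "\<And>x. x \<in> {p<..<q} - K \<Longrightarrow> (f has_vector_derivative g x) (at x)" and t: "t \<in> {p<..<q}"
  shows "(f has_vector_derivative g t) (at t)"
proof -
  have eq: "f p + integral {p..u} g = f u" if "u \<in> {p..q}" for u
  proof -
    have "(g has_integral (f u - f p)) {p..u}"
      by (rule fundamental_theorem_of_calculus_interior_strong[OF K])
        (use that d in \<open>auto intro: continuous_on_subset[OF f]\<close>)
    then show ?thesis by (simp add: integral_unique)
  qed
  have "((\<lambda>u. integral {p..u} g) has_vector_derivative g t) (at t within {p..q})"
    by (rule integral_has_vector_derivative[OF g]) (use t in auto)
  then have "((\<lambda>u. integral {p..u} g) has_vector_derivative g t) (at t)"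
    using t at_within_Icc_at[of _ t] by simp
  from has_vector_derivative_add[OF has_vector_derivative_const[of "f p"] this]
  have "((\<lambda>u. f p + integral {p..u} g) has_vector_derivative g t) (at t)" by simp
  then show ?thesis
    by (rule has_vector_derivative_transform_within_open[of _ _ _ "{p<..<q}"]) (use t eq in auto)
qed

text \<open>Banach's fixed point theorem on the bounded continuous functions on the line. Freezing
  time outside the interval by \<open>s\<close> keeps the Picard operator on that complete space. At
  the initial time only continuity is claimed; where a derivative is wanted there,
  \<open>derivative_removable\<close> supplies it.\<close>

lemma picard_forward:
  fixes F :: "'a::banach \<Rightarrow> 'a"
  assumes L: "L-lipschitz_on UNIV F"
  shows "\<exists>\<delta>>0. \<exists>y. continuous_on {t0..t0+\<delta>} y \<and> y t0 = y0 \<and>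
    (\<forall>t\<in>{t0<..<t0+\<delta>}. (y has_vector_derivative F (y t)) (at t))"
proof -
  have L0: "L \<ge> 0" by (rule lipschitz_on_nonneg[OF L])
  \<comment> \<open>Short enough for the contraction factor 1/2; \<open>L + 1\<close> keeps the
    denominator positive when \<open>L\<close> is 0.\<close>
  define \<delta> where "\<delta> = 1 / (2 * (L + 1))"
  have \<delta>: "\<delta> > 0" "L * \<delta> \<le> 1 / 2" using L0 by (auto simp: \<delta>_def field_simps)
  define s where "s t = max t0 (min t (t0 + \<delta>))" for t
  have s: "s t \<in> {t0..t0+\<delta>}" for t using \<delta> by (auto simp: s_def)
  have sc: "continuous_on UNIV s" unfolding s_def by (intro continuous_intros)
  have Fc: "continuous_on UNIV (\<lambda>u. F (apply_bcontfun g u))" for g :: "real \<Rightarrow>\<^sub>C 'a"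
    by (rule continuous_on_compose2[OF lipschitz_on_continuous_on[OF L]]) (auto intro: continuous_intros)
  have FI: "(\<lambda>u. F (apply_bcontfun g u)) integrable_on {t0..t}" for g :: "real \<Rightarrow>\<^sub>C 'a" and t
    by (intro integrable_continuous_interval continuous_on_subset[OF Fc]) auto
  define T where "T g t = y0 + integral {t0..s t} (\<lambda>u. F (apply_bcontfun g u))" for g :: "real \<Rightarrow>\<^sub>C 'a" and t
  have Tb: "T g \<in> bcontfun" for g
  proof -
    have c: "continuous_on {t0..t0+\<delta>} (\<lambda>t. y0 + integral {t0..t} (\<lambda>u. F (apply_bcontfun g u)))"
      by (intro continuous_intros indefinite_integral_continuous_1 FI)
    have "continuous_on UNIV (T g)"
      unfolding T_def by (rule continuous_on_compose2[OF c sc]) (use s in auto)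
    moreover have "bounded (range (T g))"
    proof (rule bounded_subset)
      show "bounded ((\<lambda>t. y0 + integral {t0..t} (\<lambda>u. F (apply_bcontfun g u))) ` {t0..t0+\<delta>})"
        by (intro compact_imp_bounded compact_continuous_image c) simp
      show "range (T g) \<subseteq> (\<lambda>t. y0 + integral {t0..t} (\<lambda>u. F (apply_bcontfun g u))) ` {t0..t0+\<delta>}"
        using s by (auto simp: T_def)
    qed
    ultimately show ?thesis by (simp add: bcontfun_def)
  qed
  have "\<exists>!g. Bcontfun (T g) = g"
  proof (rule banach_fix_type[of "1/2"])
    show "\<forall>g h. dist (Bcontfun (T g)) (Bcontfun (T h)) \<le> 1 / 2 * dist g h"
    proof (intro allI dist_bound)
      fix g h :: "real \<Rightarrow>\<^sub>C 'a" and t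
      have "dist (T g t) (T h t) = norm (integral {t0..s t} (\<lambda>u. F (apply_bcontfun g u) - F (apply_bcontfun h u)))"
        by (simp add: T_def dist_norm integral_diff[OF FI FI])
      also have "\<dots> \<le> (L * dist g h) * (s t - t0)"
      proof (rule integral_bound)
        show "continuous_on {t0..s t} (\<lambda>u. F (apply_bcontfun g u) - F (apply_bcontfun h u))"
          by (intro continuous_on_diff continuous_on_subset[OF Fc]) auto
        fix u
        have "norm (F (apply_bcontfun g u) - F (apply_bcontfun h u)) \<le> L * dist (apply_bcontfun g u) (apply_bcontfun h u)"
          using lipschitz_onD[OF L, of "apply_bcontfun g u" "apply_bcontfun h u"] by (simp add: dist_norm)
        also have "\<dots> \<le> L * dist g h" by (intro mult_left_mono dist_bounded L0)
        finally show "norm (F (apply_bcontfun g u) - F (apply_bcontfun h u)) \<le> L * dist g h" .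
      qed (use s[of t] in auto)
      also have "\<dots> \<le> (L * dist g h) * \<delta>" using s[of t] L0 by (intro mult_left_mono) auto
      also have "\<dots> = (L * \<delta>) * dist g h" by simp
      also have "\<dots> \<le> 1 / 2 * dist g h" by (intro mult_right_mono \<delta>) simp
      finally show "dist (apply_bcontfun (Bcontfun (T g)) t) (apply_bcontfun (Bcontfun (T h)) t) \<le> 1 / 2 * dist g h"
        by (simp add: Bcontfun_inverse[OF Tb])
    qed
  qed auto
  then obtain g where g: "Bcontfun (T g) = g" by blast
  then have gT: "apply_bcontfun g = T g" using Bcontfun_inverse[OF Tb] by metis
  define y where "y = apply_bcontfun g"
  have yc: "continuous_on A y" for A unfolding y_def by simp
  have yt: "y t = y0 + integral {t0..t} (\<lambda>u. F (y u))" if "t \<in> {t0..t0+\<delta>}" for t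
    using that unfolding y_def by (subst gT) (auto simp: T_def s_def)
  have "(y has_vector_derivative F (y t)) (at t)" if t: "t \<in> {t0<..<t0+\<delta>}" for t
  proof -
    have "continuous_on {t0..t0+\<delta>} (\<lambda>u. F (y u))" unfolding y_def by (rule continuous_on_subset[OF Fc]) simp
    then have "((\<lambda>u. integral {t0..u} (\<lambda>u. F (y u))) has_vector_derivative F (y t)) (at t within {t0..t0+\<delta>})"
      by (rule integral_has_vector_derivative) (use t in auto)
    then have "((\<lambda>u. integral {t0..u} (\<lambda>u. F (y u))) has_vector_derivative F (y t)) (at t)"
      using t at_within_Icc_at[of _ t] by simp
    from has_vector_derivative_add[OF has_vector_derivative_const[of y0] this]
    have "((\<lambda>u. y0 + integral {t0..u} (\<lambda>u. F (y u))) has_vector_derivative F (y t)) (at t)" by simp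
    then show ?thesis
      by (rule has_vector_derivative_transform_within_open[of _ _ _ "{t0<..<t0+\<delta>}"]) (use t yt in auto)
  qed
  moreover have "y t0 = y0" using yt[of t0] \<delta> by simp
  ultimately show ?thesis using \<delta> yc by blast
qed

section \<open>Integral curves\<close>

definition field :: "(real \<Rightarrow> real) \<Rightarrow> (real \<Rightarrow> real) \<Rightarrow> real \<times> real \<Rightarrow> real \<times> real" where
  "field a b z = (- 2 * a (fst z) * snd z + b (fst z), ddx a (fst z) * (snd z)\<^sup>2 - ddx b (fst z) * snd z)"

lemma has_vector_derivative_Pair_iff:
  "((\<lambda>t. (X t, Y t)) has_vector_derivative (x', y')) (at t) \<longleftrightarrow>
     (X has_vector_derivative x') (at t) \<and> (Y has_vector_derivative y') (at t)"
proof
  assume h: "((\<lambda>t. (X t, Y t)) has_vector_derivative (x', y')) (at t)"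
  from bounded_linear.has_vector_derivative[OF bounded_linear_fst h] bounded_linear.has_vector_derivative[OF bounded_linear_snd h]
  show "(X has_vector_derivative x') (at t) \<and> (Y has_vector_derivative y') (at t)" by simp
qed (auto intro: has_vector_derivative_Pair)

lemma symbol_derivs:
  assumes "smooth a" "smooth b"
  shows "deriv (\<lambda>\<xi>. symbol_p a b x \<xi>) \<xi>0 = - 2 * a x * \<xi>0 + b x"
    "- deriv (\<lambda>x. symbol_p a b x \<xi>) x0 = ddx a x0 * \<xi>\<^sup>2 - ddx b x0 * \<xi>"
proof -
  have "((\<lambda>\<xi>. symbol_p a b x \<xi>) has_real_derivative - 2 * a x * \<xi>0 + b x) (at \<xi>0)"
    unfolding symbol_p_def by (auto intro!: derivative_eq_intros)
  then show "deriv (\<lambda>\<xi>. symbol_p a b x \<xi>) \<xi>0 = - 2 * a x * \<xi>0 + b x" by (rule DERIV_imp_deriv)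
  have "((\<lambda>x. symbol_p a b x \<xi>) has_real_derivative - (ddx a x0 * \<xi>\<^sup>2 - ddx b x0 * \<xi>)) (at x0)"
    unfolding symbol_p_def using assms by (auto intro!: derivative_eq_intros smooth_DERIV)
  then show "- deriv (\<lambda>x. symbol_p a b x \<xi>) x0 = ddx a x0 * \<xi>\<^sup>2 - ddx b x0 * \<xi>"
    using DERIV_imp_deriv by fastforce
qed

lemma integral_curve_iff:
  assumes "smooth a" "smooth b"
  shows "integral_curve (symbol_p a b) J X \<Xi> \<longleftrightarrow> open J \<and> is_interval J \<and> J \<noteq> {} \<and>
    (\<forall>t\<in>J. ((\<lambda>t. (X t, \<Xi> t)) has_vector_derivative field a b (X t, \<Xi> t)) (at t))"
  unfolding integral_curve_def symbol_derivs[OF assms] field_def fst_conv snd_conv has_vector_derivative_Pair_iff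
    has_real_derivative_iff_has_vector_derivative ..

section \<open>Continuation of curves along which the momentum stays bounded\<close>

definition clamp1 :: "real \<Rightarrow> real \<Rightarrow> real" where "clamp1 M k = max (- M) (min M k)"

lemma clamp1: assumes "M \<ge> 0" shows "\<bar>clamp1 M k\<bar> \<le> M" "\<bar>clamp1 M k - clamp1 M k'\<bar> \<le> \<bar>k - k'\<bar>"
  "\<bar>k\<bar> \<le> M \<Longrightarrow> clamp1 M k = k"
  using assms unfolding clamp1_def by (auto simp: max_def min_def abs_if split: if_splits)

lemma Cinf_lipschitz:
  fixes f :: "real \<Rightarrow> real"
  assumes "f \<in> Cinf_S1"
  shows "\<exists>B>0. (\<forall>x. \<bar>f x\<bar> \<le> B) \<and> (\<forall>x y. \<bar>f x - f y\<bar> \<le> B * \<bar>x - y\<bar>)"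
proof -
  obtain B1 where B1: "B1 > 0" "\<And>x. \<bar>f x\<bar> \<le> B1" using Cinf_bounded[OF assms] by auto
  obtain B2 where B2: "B2 > 0" "\<And>x. \<bar>ddx f x\<bar> \<le> B2" using Cinf_bounded[OF Cinf_ddx[OF assms]] by auto
  have sm: "smooth f" using assms by (simp add: Cinf_S1_iff)
  have l: "\<bar>f x - f y\<bar> \<le> B2 * \<bar>x - y\<bar>" for x y
    using field_differentiable_bound[of UNIV f "ddx f" B2 x y] smooth_DERIV[OF sm] B2 by auto
  have "\<bar>f x - f y\<bar> \<le> max B1 B2 * \<bar>x - y\<bar>" for x y
    by (rule order_trans[OF l]) (auto intro: mult_right_mono)
  moreover have "\<bar>f x\<bar> \<le> max B1 B2" for x using B1(2)[of x] by simp
  ultimately show ?thesis using B1 by (intro exI[of _ "max B1 B2"]) auto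
qed

lemma product_lipschitz:
  fixes f h :: "real \<Rightarrow> real"
  assumes f: "f \<in> Cinf_S1" and h: "\<And>k. \<bar>h k\<bar> \<le> H" "\<And>k k'. \<bar>h k - h k'\<bar> \<le> H * \<bar>k - k'\<bar>"
  shows "\<exists>C. \<forall>z w. \<bar>f (fst z) * h (snd z) - f (fst w) * h (snd w)\<bar> \<le> C * dist z w"
proof -
  obtain B where B: "B > 0" "\<And>x. \<bar>f x\<bar> \<le> B" "\<And>x y. \<bar>f x - f y\<bar> \<le> B * \<bar>x - y\<bar>"
    using Cinf_lipschitz[OF f] by blast
  have H: "H \<ge> 0" using h(1)[of 0] by linarith
  have "\<bar>f (fst z) * h (snd z) - f (fst w) * h (snd w)\<bar> \<le> (2 * B * H) * dist z w" for z w :: "real \<times> real"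
  proof -
    have d: "\<bar>fst z - fst w\<bar> \<le> dist z w" "\<bar>snd z - snd w\<bar> \<le> dist z w"
      using dist_fst_le[of z w] dist_snd_le[of z w] by (auto simp: dist_real_def)
    have "f (fst z) * h (snd z) - f (fst w) * h (snd w) = (f (fst z) - f (fst w)) * h (snd z) + f (fst w) * (h (snd z) - h (snd w))"
      by (simp add: algebra_simps)
    also have "\<bar>\<dots>\<bar> \<le> \<bar>f (fst z) - f (fst w)\<bar> * \<bar>h (snd z)\<bar> + \<bar>f (fst w)\<bar> * \<bar>h (snd z) - h (snd w)\<bar>"
      by (simp add: abs_mult[symmetric])
    also have "\<dots> \<le> (B * dist z w) * H + B * (H * dist z w)"
    proof (intro add_mono mult_mono)
      show "\<bar>f (fst z) - f (fst w)\<bar> \<le> B * dist z w"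
        by (rule order_trans[OF B(3)]) (use B(1) d in \<open>auto intro: mult_left_mono\<close>)
      show "\<bar>h (snd z) - h (snd w)\<bar> \<le> H * dist z w"
        by (rule order_trans[OF h(2)]) (use H d in \<open>auto intro: mult_left_mono\<close>)
    qed (use B h H in auto)
    finally show ?thesis by (simp add: algebra_simps)
  qed
  then show ?thesis by blast
qed

text \<open>The field is quadratic in the momentum, hence only locally Lipschitz. Clamping the
  momentum makes it globally so and leaves it unchanged for momenta up to \<open>M\<close>; in the
  position the periodic coefficients are uniformly Lipschitz already.\<close>

lemma clamped_field_lipschitz:
  assumes a: "a \<in> Cinf_S1" and b: "b \<in> Cinf_S1" and M: "M \<ge> 0"
  shows "\<exists>L. L-lipschitz_on UNIV (\<lambda>z. field a b (fst z, clamp1 M (snd z)))"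
proof -
  \<comment> \<open>\<open>product_lipschitz\<close> takes one constant \<open>H\<close> as bound
    and as Lipschitz constant: \<open>M + 1\<close> dominates M and 1, and in \<open>k2\<close> the
    constant \<open>M^2 + 2 M\<close> dominates M^2 and 2 M.\<close>
  have k1: "\<bar>clamp1 M k\<bar> \<le> M + 1" "\<bar>clamp1 M k - clamp1 M k'\<bar> \<le> (M + 1) * \<bar>k - k'\<bar>" for k k'
  proof -
    show "\<bar>clamp1 M k\<bar> \<le> M + 1" using clamp1(1)[OF M, of k] by simp
    have "1 * \<bar>k - k'\<bar> \<le> (M + 1) * \<bar>k - k'\<bar>" using M by (intro mult_right_mono) auto
    then show "\<bar>clamp1 M k - clamp1 M k'\<bar> \<le> (M + 1) * \<bar>k - k'\<bar>" using clamp1(2)[OF M, of k k'] by simp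
  qed
  have k2: "\<bar>(clamp1 M k)\<^sup>2\<bar> \<le> M\<^sup>2 + 2 * M" "\<bar>(clamp1 M k)\<^sup>2 - (clamp1 M k')\<^sup>2\<bar> \<le> (M\<^sup>2 + 2 * M) * \<bar>k - k'\<bar>" for k k'
  proof -
    have "\<bar>clamp1 M k\<bar>\<^sup>2 \<le> M\<^sup>2" using clamp1(1)[OF M, of k] by (intro power_mono) auto
    then show "\<bar>(clamp1 M k)\<^sup>2\<bar> \<le> M\<^sup>2 + 2 * M" using M by simp
    have "(clamp1 M k)\<^sup>2 - (clamp1 M k')\<^sup>2 = (clamp1 M k + clamp1 M k') * (clamp1 M k - clamp1 M k')"
      by (simp add: power2_eq_square algebra_simps)
    then have "\<bar>(clamp1 M k)\<^sup>2 - (clamp1 M k')\<^sup>2\<bar> = \<bar>clamp1 M k + clamp1 M k'\<bar> * \<bar>clamp1 M k - clamp1 M k'\<bar>"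
      by (simp add: abs_mult)
    also have "\<dots> \<le> (2 * M) * \<bar>k - k'\<bar>"
    proof (rule mult_mono)
      show "\<bar>clamp1 M k + clamp1 M k'\<bar> \<le> 2 * M" using clamp1(1)[OF M, of k] clamp1(1)[OF M, of k'] by linarith
    qed (use M clamp1(2)[OF M] in auto)
    also have "\<dots> \<le> (M\<^sup>2 + 2 * M) * \<bar>k - k'\<bar>" by (intro mult_right_mono) auto
    finally show "\<bar>(clamp1 M k)\<^sup>2 - (clamp1 M k')\<^sup>2\<bar> \<le> (M\<^sup>2 + 2 * M) * \<bar>k - k'\<bar>" .
  qed
  obtain C1 where C1: "\<And>z w. \<bar>a (fst z) * clamp1 M (snd z) - a (fst w) * clamp1 M (snd w)\<bar> \<le> C1 * dist z w"
    using product_lipschitz[OF a k1] by blast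
  have "\<exists>C. \<forall>z w :: real \<times> real. \<bar>b (fst z) * 1 - b (fst w) * 1\<bar> \<le> C * dist z w"
    by (rule product_lipschitz[OF b, of _ 1]) auto
  then obtain C2 where C2: "\<And>z w :: real \<times> real. \<bar>b (fst z) * 1 - b (fst w) * 1\<bar> \<le> C2 * dist z w" by blast
  obtain C3 where C3: "\<And>z w. \<bar>ddx a (fst z) * (clamp1 M (snd z))\<^sup>2 - ddx a (fst w) * (clamp1 M (snd w))\<^sup>2\<bar> \<le> C3 * dist z w"
    using product_lipschitz[OF Cinf_ddx[OF a] k2] by blast
  obtain C4 where C4: "\<And>z w. \<bar>ddx b (fst z) * clamp1 M (snd z) - ddx b (fst w) * clamp1 M (snd w)\<bar> \<le> C4 * dist z w"
    using product_lipschitz[OF Cinf_ddx[OF b] k1] by blast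
  define L where "L = max 0 (2 * C1 + C2 + C3 + C4)"
  have "L-lipschitz_on UNIV (\<lambda>z. field a b (fst z, clamp1 M (snd z)))"
  proof (rule lipschitz_onI)
    fix z w :: "real \<times> real"
    define p q where "p = - 2 * a (fst z) * clamp1 M (snd z) + b (fst z) - (- 2 * a (fst w) * clamp1 M (snd w) + b (fst w))"
      and "q = ddx a (fst z) * (clamp1 M (snd z))\<^sup>2 - ddx b (fst z) * clamp1 M (snd z) - (ddx a (fst w) * (clamp1 M (snd w))\<^sup>2 - ddx b (fst w) * clamp1 M (snd w))"
    have "dist (field a b (fst z, clamp1 M (snd z))) (field a b (fst w, clamp1 M (snd w))) = norm (p, q)"
      by (simp add: field_def dist_norm p_def q_def)
    also have "\<dots> \<le> \<bar>p\<bar> + \<bar>q\<bar>" using norm_Pair_le[of p q] by simp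
    also have "\<dots> \<le> (2 * C1 + C2 + C3 + C4) * dist z w"
    proof -
      have "p = - 2 * (a (fst z) * clamp1 M (snd z) - a (fst w) * clamp1 M (snd w)) + (b (fst z) * 1 - b (fst w) * 1)"
        by (simp add: p_def algebra_simps)
      moreover have "\<bar>- 2 * P + Q\<bar> \<le> 2 * x + y" if "\<bar>P\<bar> \<le> x" "\<bar>Q\<bar> \<le> y" for P Q x y :: real
        using that by linarith
      ultimately have 1: "\<bar>p\<bar> \<le> 2 * (C1 * dist z w) + C2 * dist z w" using C1[of z w] C2[of z w] by simp
      have "q = (ddx a (fst z) * (clamp1 M (snd z))\<^sup>2 - ddx a (fst w) * (clamp1 M (snd w))\<^sup>2) - (ddx b (fst z) * clamp1 M (snd z) - ddx b (fst w) * clamp1 M (snd w))"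
        by (simp add: q_def)
      then have 2: "\<bar>q\<bar> \<le> C3 * dist z w + C4 * dist z w" using C3[of z w] C4[of z w] by linarith
      show ?thesis using 1 2 by (simp add: algebra_simps)
    qed
    also have "\<dots> \<le> L * dist z w" by (intro mult_right_mono) (auto simp: L_def)
    finally show "dist (field a b (fst z, clamp1 M (snd z))) (field a b (fst w, clamp1 M (snd w))) \<le> L * dist z w" .
  qed (simp add: L_def)
  then show ?thesis by blast
qed

lemma field_continuous:
  assumes "a \<in> Cinf_S1" "b \<in> Cinf_S1" "continuous_on A z"
  shows "continuous_on A (\<lambda>t. field a b (z t))"
proof -
  have c: "continuous_on UNIV f" if "f \<in> Cinf_S1" for f :: "real \<Rightarrow> real"
    using that by (simp add: Cinf_S1_iff smooth_continuous)
  show ?thesis unfolding field_def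
    by (intro continuous_intros continuous_on_compose2[OF c[OF assms(1)]] continuous_on_compose2[OF c[OF assms(2)]]
      continuous_on_compose2[OF c[OF Cinf_ddx[OF assms(1)]]] continuous_on_compose2[OF c[OF Cinf_ddx[OF assms(2)]]] assms(3)) auto
qed

text \<open>Bounded momentum bounds the field along the curve, so the curve is Lipschitz up to
  \<open>\<beta>\<close> and has a limit there, from which a Picard solution restarts. On the circle
  the position cannot escape, so the momentum is the only obstruction to continuation.\<close>

lemma extend_bounded_curve:
  assumes a: "a \<in> Cinf_S1" and b: "b \<in> Cinf_S1"
    and ic: "integral_curve (symbol_p a b) J X \<Xi>"
    and t0: "t0 < \<beta>" "{t0..<\<beta>} \<subseteq> J" and J\<beta>: "\<And>t. t \<in> J \<Longrightarrow> t < \<beta>"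
    and bd: "\<And>t. t \<in> {t0..<\<beta>} \<Longrightarrow> \<bar>\<Xi> t\<bar> \<le> M"
  shows "\<exists>J' X' \<Xi>'. integral_curve (symbol_p a b) J' X' \<Xi>' \<and> J \<subseteq> J' \<and> J' \<noteq> J \<and> (\<forall>t\<in>J. X' t = X t \<and> \<Xi>' t = \<Xi> t)"
proof -
  have sm: "smooth a" "smooth b" using a b by (auto simp: Cinf_S1_iff)
  define z where "z t = (X t, \<Xi> t)" for t
  have J: "open J" "is_interval J" "J \<noteq> {}" and zd: "\<And>t. t \<in> J \<Longrightarrow> (z has_vector_derivative field a b (z t)) (at t)"
    using ic unfolding integral_curve_iff[OF sm] z_def[abs_def] by auto
  have M: "M \<ge> 0" using bd[of t0] t0 by simp
  \<comment> \<open>The clamp is at \<open>M + 1\<close>, not at \<open>M\<close>: the limit point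
    has momentum at most \<open>M\<close>, and the unit of slack keeps the new piece, for a short
    time, where the clamped field is the true one.\<close>
  obtain L where L: "L-lipschitz_on UNIV (\<lambda>z. field a b (fst z, clamp1 (M + 1) (snd z)))"
    using clamped_field_lipschitz[OF a b, of "M + 1"] M by auto
  define F where "F = (\<lambda>z. field a b (fst z, clamp1 (M + 1) (snd z)))"
  have Fz: "F w = field a b w" if "\<bar>snd w\<bar> \<le> M + 1" for w
    using that M by (cases w) (simp add: F_def clamp1(3))
  obtain Ba where Ba: "Ba > 0" "\<And>x. \<bar>a x\<bar> \<le> Ba" using Cinf_bounded[OF a] by auto
  obtain Bb where Bb: "Bb > 0" "\<And>x. \<bar>b x\<bar> \<le> Bb" using Cinf_bounded[OF b] by auto
  obtain Ca where Ca: "Ca > 0" "\<And>x. \<bar>ddx a x\<bar> \<le> Ca" using Cinf_bounded[OF Cinf_ddx[OF a]] by auto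
  obtain Cb where Cb: "Cb > 0" "\<And>x. \<bar>ddx b x\<bar> \<le> Cb" using Cinf_bounded[OF Cinf_ddx[OF b]] by auto
  define N where "N = (2 * Ba * M + Bb) + (Ca * M\<^sup>2 + Cb * M)"
  have N: "norm (field a b (z t)) \<le> N" if "t \<in> {t0..<\<beta>}" for t
  proof -
    have k: "\<bar>\<Xi> t\<bar> \<le> M" "\<bar>\<Xi> t\<bar>\<^sup>2 \<le> M\<^sup>2" by (rule bd[OF that], rule power_mono[OF bd[OF that] abs_ge_zero])
    have "\<bar>a (X t)\<bar> * \<bar>\<Xi> t\<bar> \<le> Ba * M" "\<bar>ddx a (X t)\<bar> * \<bar>\<Xi> t\<bar>\<^sup>2 \<le> Ca * M\<^sup>2" "\<bar>ddx b (X t)\<bar> * \<bar>\<Xi> t\<bar> \<le> Cb * M"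
      using Ba Ca Cb k by (auto intro!: mult_mono)
    then have m: "\<bar>a (X t) * \<Xi> t\<bar> \<le> Ba * M" "\<bar>ddx a (X t) * (\<Xi> t)\<^sup>2\<bar> \<le> Ca * M\<^sup>2" "\<bar>ddx b (X t) * \<Xi> t\<bar> \<le> Cb * M"
      by (simp_all add: abs_mult)
    have "norm (field a b (z t)) \<le> \<bar>- 2 * (a (X t) * \<Xi> t) + b (X t)\<bar> + \<bar>ddx a (X t) * (\<Xi> t)\<^sup>2 - ddx b (X t) * \<Xi> t\<bar>"
      using norm_Pair_le[of "- 2 * (a (X t) * \<Xi> t) + b (X t)" "ddx a (X t) * (\<Xi> t)\<^sup>2 - ddx b (X t) * \<Xi> t"]
      by (simp add: field_def z_def mult.assoc)
    also have "\<dots> \<le> N" unfolding N_def using m Bb(2)[of "X t"] by linarith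
    finally show ?thesis .
  qed
  have "N-lipschitz_on {t0..<\<beta>} z"
  proof (rule lipschitz_onI)
    show "N \<ge> 0" using order_trans[OF norm_ge_zero N[of t0]] t0(1) by simp
    fix s t assume st: "s \<in> {t0..<\<beta>}" "t \<in> {t0..<\<beta>}"
    have "norm (z s - z t) \<le> N * norm (s - t)"
    proof (rule differentiable_bound[of "{t0..<\<beta>}" z "\<lambda>x h. h *\<^sub>R field a b (z x)"])
      fix x assume x: "x \<in> {t0..<\<beta>}"
      show "(z has_derivative (\<lambda>h. h *\<^sub>R field a b (z x))) (at x within {t0..<\<beta>})"
      proof -
        have "x \<in> J" using x t0(2) by blast
        from zd[OF this] show ?thesis unfolding has_vector_derivative_def by (rule has_derivative_at_withinI)
      qed
      show "onorm (\<lambda>h. h *\<^sub>R field a b (z x)) \<le> N"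
      proof (rule onorm_bound)
        show "N \<ge> 0" by (rule order_trans[OF norm_ge_zero N[OF x]])
        show "norm (h *\<^sub>R field a b (z x)) \<le> N * norm h" for h
          using mult_right_mono[OF N[OF x], of "norm h"] by (simp add: mult.commute)
      qed
    qed (use st in auto)
    then show "dist (z s) (z t) \<le> N * dist s t" by (simp add: dist_norm)
  qed
  then have "uniformly_continuous_on {t0..<\<beta>} z" by (rule lipschitz_on_uniformly_continuous)
  from uniformly_continuous_on_extension_on_closure[OF this]
  have "\<exists>g. uniformly_continuous_on (closure {t0..<\<beta>}) g \<and> (\<forall>x\<in>{t0..<\<beta>}. z x = g x)" by metis
  then obtain g where g: "uniformly_continuous_on (closure {t0..<\<beta>}) g" "\<And>x. x \<in> {t0..<\<beta>} \<Longrightarrow> z x = g x"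
    by blast
  have gc: "continuous_on {t0..\<beta>} g"
    using uniformly_continuous_imp_continuous[OF g(1)] t0(1) by (simp add: closure_atLeastLessThan)
  have gM: "\<bar>snd (g \<beta>)\<bar> \<le> M"
  proof -
    have "(g \<longlongrightarrow> g \<beta>) (at \<beta> within {t0..\<beta>})" using gc t0 by (auto simp: continuous_on)
    then have "(g \<longlongrightarrow> g \<beta>) (at_left \<beta>)" using t0 by (simp add: at_within_Icc_at_left)
    then have lim: "((\<lambda>t. \<bar>snd (g t)\<bar>) \<longlongrightarrow> \<bar>snd (g \<beta>)\<bar>) (at_left \<beta>)" by (intro tendsto_intros)
    show ?thesis
    proof (rule tendsto_upperbound[OF lim])
      have "\<forall>\<^sub>F t in at_left \<beta>. t \<in> {t0<..<\<beta>}" using eventually_at_left_field t0(1) by (auto simp: eventually_at_left_field)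
      then show "\<forall>\<^sub>F t in at_left \<beta>. \<bar>snd (g t)\<bar> \<le> M"
      proof eventually_elim
        case (elim t)
        then show ?case using g(2)[of t] bd[of t] by (simp add: z_def) (metis less_imp_le snd_conv)
      qed
    qed simp
  qed
  obtain \<delta>1 y where \<delta>1: "\<delta>1 > 0" and yc: "continuous_on {\<beta>..\<beta>+\<delta>1} y" and y0: "y \<beta> = g \<beta>"
    and yd: "\<And>t. t \<in> {\<beta><..<\<beta>+\<delta>1} \<Longrightarrow> (y has_vector_derivative F (y t)) (at t)"
    using picard_forward[OF L, of \<beta> "g \<beta>"] unfolding F_def by blast
  have "\<exists>\<delta>>0. \<delta> \<le> \<delta>1 \<and> (\<forall>t\<in>{\<beta>..\<beta>+\<delta>}. \<bar>snd (y t)\<bar> \<le> M + 1)"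
  proof -
    have "continuous_on {\<beta>..\<beta>+\<delta>1} (\<lambda>t. snd (y t))" by (intro continuous_intros yc)
    then obtain e where e: "e > 0" "\<forall>t\<in>{\<beta>..\<beta>+\<delta>1}. dist t \<beta> < e \<longrightarrow> dist (snd (y t)) (snd (y \<beta>)) < 1"
      unfolding continuous_on_iff using \<delta>1 by (metis atLeastAtMost_iff le_add_same_cancel1 less_eq_real_def order_refl zero_less_one)
    have "\<bar>snd (y t)\<bar> \<le> M + 1" if "t \<in> {\<beta>..\<beta> + min \<delta>1 (e / 2)}" for t
    proof -
      have "t \<in> {\<beta>..\<beta>+\<delta>1}" "dist t \<beta> < e" using that e(1) by (auto simp: dist_real_def)
      then have "\<bar>snd (y t) - snd (g \<beta>)\<bar> < 1" using e(2) y0 by (auto simp: dist_real_def)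
      then show ?thesis using gM by linarith
    qed
    then show ?thesis using e(1) \<delta>1 by (intro exI[of _ "min \<delta>1 (e / 2)"]) auto
  qed
  then obtain \<delta> where \<delta>: "\<delta> > 0" "\<delta> \<le> \<delta>1" and yM: "\<And>t. t \<in> {\<beta>..\<beta>+\<delta>} \<Longrightarrow> \<bar>snd (y t)\<bar> \<le> M + 1" by blast
  define w where "w t = (if t < \<beta> then z t else y t)" for t
  have wg: "w t = (if t \<le> \<beta> then g t else y t)" if "t \<in> {t0..\<beta>+\<delta>}" for t
    using that g(2)[of t] y0 by (auto simp: w_def)
  have "continuous_on ({t0..\<beta>} \<union> {\<beta>..\<beta>+\<delta>}) (\<lambda>t. if t \<le> \<beta> then g t else y t)"
    by (rule continuous_on_If) (use gc y0 \<delta> in \<open>auto intro: continuous_on_subset[OF yc]\<close>)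
  moreover have "{t0..\<beta>} \<union> {\<beta>..\<beta>+\<delta>} = {t0..\<beta>+\<delta>}" using t0 \<delta> by auto
  ultimately have "continuous_on {t0..\<beta>+\<delta>} (\<lambda>t. if t \<le> \<beta> then g t else y t)" by simp
  then have wc: "continuous_on {t0..\<beta>+\<delta>} w"
    by (rule continuous_on_eq) (simp only: wg)
  have wd1: "(w has_vector_derivative field a b (w t)) (at t)" if "t \<in> J" for t
  proof -
    have "(z has_vector_derivative field a b (w t)) (at t)" using zd[OF that] J\<beta>[OF that] by (simp add: w_def)
    then show ?thesis
      by (rule has_vector_derivative_transform_within_open[OF _ J(1) that]) (use J\<beta> in \<open>auto simp: w_def\<close>)
  qed
  have wd2: "(w has_vector_derivative field a b (w t)) (at t)" if t: "t \<in> {\<beta><..<\<beta>+\<delta>}" for t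
  proof -
    have "(y has_vector_derivative field a b (w t)) (at t)"
      using yd[of t] t \<delta> Fz[OF yM, of t] by (auto simp: w_def)
    then show ?thesis
      by (rule has_vector_derivative_transform_within_open[of _ _ _ "{\<beta><..<\<beta>+\<delta>}"]) (use t in \<open>auto simp: w_def\<close>)
  qed
  \<comment> \<open>At the junction the two pieces give only continuity of \<open>w\<close>;
    continuity of the field along \<open>w\<close> upgrades it to a derivative.\<close>
  have wd3: "(w has_vector_derivative field a b (w \<beta>)) (at \<beta>)"
  proof (rule derivative_removable[OF wc field_continuous[OF a b wc], of "{\<beta>}"])
    fix t assume t: "t \<in> {t0<..<\<beta>+\<delta>} - {\<beta>}"
    then show "(w has_vector_derivative field a b (w t)) (at t)"
    proof (cases "t < \<beta>")
      case True
      then have "t \<in> J" using t t0 by auto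
      then show ?thesis by (rule wd1)
    qed (use t wd2 in auto)
  qed (use t0 \<delta> in auto)
  define J' where "J' = J \<union> {t0<..<\<beta>+\<delta>}"
  have tm: "(t0 + \<beta>) / 2 \<in> J \<inter> {t0<..<\<beta>+\<delta>}" using t0 \<delta> by (auto intro!: subsetD[OF t0(2)])
  have "is_interval J'" unfolding J'_def is_interval_connected_1
    by (rule connected_Un) (use J(2) tm in \<open>auto simp: is_interval_connected_1\<close>)
  moreover have "open J'" unfolding J'_def using J(1) by auto
  moreover have "(w has_vector_derivative field a b (w t)) (at t)" if "t \<in> J'" for t
  proof -
    have "t \<in> J \<or> t \<in> {\<beta><..<\<beta>+\<delta>} \<or> t = \<beta>"
    proof (cases "t < \<beta>")
      case True
      then show ?thesis using that subsetD[OF t0(2), of t] unfolding J'_def by auto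
    qed (use that J\<beta> in \<open>auto simp: J'_def\<close>)
    then show ?thesis using wd1 wd2 wd3 by auto
  qed
  ultimately have "integral_curve (symbol_p a b) J' (\<lambda>t. fst (w t)) (\<lambda>t. snd (w t))"
    unfolding integral_curve_iff[OF sm] using J(3) by (auto simp: J'_def)
  moreover have "\<beta> \<in> J'" "\<beta> \<notin> J" using t0 \<delta> J\<beta> by (auto simp: J'_def)
  moreover have "fst (w t) = X t \<and> snd (w t) = \<Xi> t" if "t \<in> J" for t using J\<beta>[OF that] by (simp add: w_def z_def)
  ultimately show ?thesis
    by (intro exI[of _ J'] exI[of _ "\<lambda>t. fst (w t)"] exI[of _ "\<lambda>t. snd (w t)"]) (auto simp: J'_def)
qed

text \<open>Here \<open>a1\<close> and \<open>b1\<close> are values of \<open>a'\<close> and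
  \<open>b'\<close>, and the point is to bound \<open>a1 * \<xi>\<close>. If
  \<open>|a| \<xi>^2 <= 2 |E|\<close>, the first inequality gives
  \<open>(a1 \<xi>)^2 <= 2 K |E|\<close>. Otherwise the energy equation forces
  \<open>|a \<xi>| <= 2 |b|\<close>, and the second inequality gives
  \<open>|a1 \<xi>| <= 2 K\<close>. This is how conservation of energy turns quadratic growth into
  linear growth.\<close>

lemma momentum_rate_bound:
  fixes a a1 b b1 \<xi> E K B :: real
  assumes E: "- a * \<xi>\<^sup>2 + b * \<xi> = E" and K: "a1\<^sup>2 \<le> K * \<bar>a\<bar>" "\<bar>a1 * b\<bar> \<le> K * \<bar>a\<bar>" "K > 0" and B: "\<bar>b1\<bar> \<le> B"
  shows "\<bar>a1 * \<xi>\<^sup>2 - b1 * \<xi>\<bar> \<le> (sqrt (2 * K * \<bar>E\<bar>) + 2 * K + B) * \<bar>\<xi>\<bar>"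
proof -
  have "\<bar>a1 * \<xi>\<bar> \<le> sqrt (2 * K * \<bar>E\<bar>) + 2 * K"
  proof (cases "\<bar>a\<bar> * \<xi>\<^sup>2 \<le> 2 * \<bar>E\<bar>")
    case True
    have "(a1 * \<xi>)\<^sup>2 = a1\<^sup>2 * \<xi>\<^sup>2" by (simp add: power_mult_distrib)
    also have "\<dots> \<le> K * \<bar>a\<bar> * \<xi>\<^sup>2" by (intro mult_right_mono K) simp
    also have "\<dots> = K * (\<bar>a\<bar> * \<xi>\<^sup>2)" by simp
    also have "\<dots> \<le> K * (2 * \<bar>E\<bar>)" using True K(3) by (intro mult_left_mono) auto
    finally have "\<bar>a1 * \<xi>\<bar> \<le> sqrt (2 * K * \<bar>E\<bar>)" by (intro real_le_rsqrt) (simp add: algebra_simps)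
    then show ?thesis using K(3) by simp
  next
    case False
    then have nz: "a \<noteq> 0" "\<xi> \<noteq> 0" by auto
    have "\<bar>a * \<xi>\<^sup>2\<bar> \<le> \<bar>b * \<xi>\<bar> + \<bar>E\<bar>" using E by linarith
    then have "\<bar>a\<bar> * \<xi>\<^sup>2 < 2 * \<bar>b * \<xi>\<bar>" using False by (simp add: abs_mult)
    then have "(\<bar>a\<bar> * \<bar>\<xi>\<bar>) * \<bar>\<xi>\<bar> < (2 * \<bar>b\<bar>) * \<bar>\<xi>\<bar>" by (simp add: abs_mult power2_eq_square mult.assoc)
    then have 1: "\<bar>a\<bar> * \<bar>\<xi>\<bar> \<le> 2 * \<bar>b\<bar>" using nz(2) by (simp add: mult_less_cancel_right)
    have "\<bar>a1 * \<xi>\<bar> * \<bar>a\<bar> = \<bar>a1\<bar> * (\<bar>a\<bar> * \<bar>\<xi>\<bar>)" by (simp add: abs_mult)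
    also have "\<dots> \<le> \<bar>a1\<bar> * (2 * \<bar>b\<bar>)" by (intro mult_left_mono 1) simp
    also have "\<dots> = 2 * \<bar>a1 * b\<bar>" by (simp add: abs_mult)
    also have "\<dots> \<le> (2 * K) * \<bar>a\<bar>" using K(2) by simp
    finally have "\<bar>a1 * \<xi>\<bar> \<le> 2 * K" using nz(1) by (simp add: mult_le_cancel_right)
    then show ?thesis using K(3) by (simp add: add_increasing)
  qed
  then have "\<bar>a1 * \<xi>\<bar> * \<bar>\<xi>\<bar> \<le> (sqrt (2 * K * \<bar>E\<bar>) + 2 * K) * \<bar>\<xi>\<bar>" by (rule mult_right_mono) simp
  moreover have "\<bar>b1\<bar> * \<bar>\<xi>\<bar> \<le> B * \<bar>\<xi>\<bar>" by (rule mult_right_mono[OF B]) simp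
  moreover have "\<bar>a1 * \<xi>\<^sup>2 - b1 * \<xi>\<bar> \<le> \<bar>a1 * \<xi>\<bar> * \<bar>\<xi>\<bar> + \<bar>b1\<bar> * \<bar>\<xi>\<bar>"
  proof -
    have "\<bar>a1 * \<xi>\<^sup>2\<bar> = \<bar>a1 * \<xi>\<bar> * \<bar>\<xi>\<bar>" by (simp add: abs_mult power2_eq_square mult.assoc)
    then show ?thesis using abs_triangle_ineq4[of "a1 * \<xi>\<^sup>2" "b1 * \<xi>"] by (simp only: abs_mult[of b1])
  qed
  ultimately show ?thesis by (simp add: distrib_right)
qed

text \<open>The energy is constant along the curve, so \<open>momentum_rate_bound\<close> applies
  with a fixed \<open>C\<close>, and Gronwall's argument bounds the momentum on a bounded time
  interval. The missing time \<open>s\<close> makes \<open>J\<close> bounded above, and the curve is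
  continued past its supremum.\<close>

lemma forward_extend:
  assumes a: "a \<in> Cinf_S1" and b: "b \<in> Cinf_S1"
    and K: "K > 0" "\<And>x. (ddx a x)\<^sup>2 \<le> K * \<bar>a x\<bar>" "\<And>x. \<bar>ddx a x * b x\<bar> \<le> K * \<bar>a x\<bar>"
    and ic: "integral_curve (symbol_p a b) J X \<Xi>" and t0: "t0 \<in> J" and s: "s \<notin> J" "t0 < s"
  shows "\<exists>J' X' \<Xi>'. integral_curve (symbol_p a b) J' X' \<Xi>' \<and> J \<subseteq> J' \<and> J' \<noteq> J \<and> (\<forall>t\<in>J. X' t = X t \<and> \<Xi>' t = \<Xi> t)"
proof -
  have sm: "smooth a" "smooth b" using a b by (auto simp: Cinf_S1_iff)
  have J: "open J" "is_interval J" "J \<noteq> {}"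
    and d: "\<And>t. t \<in> J \<Longrightarrow> (X has_real_derivative - 2 * a (X t) * \<Xi> t + b (X t)) (at t)"
      "\<And>t. t \<in> J \<Longrightarrow> (\<Xi> has_real_derivative ddx a (X t) * (\<Xi> t)\<^sup>2 - ddx b (X t) * \<Xi> t) (at t)"
    using ic unfolding integral_curve_def symbol_derivs[OF sm] by auto
  have ivl: "u \<in> J" if "x \<in> J" "y \<in> J" "x \<le> u" "u \<le> y" for x y u
    using J(2) that unfolding is_interval_1 by blast
  have Js: "t < s" if "t \<in> J" for t using ivl[OF t0 that, of s] s by (meson less_imp_le not_le)
  have bdd: "bdd_above J" using Js by (meson bdd_aboveI less_imp_le)
  define \<beta> where "\<beta> = Sup J"
  have le: "t \<le> \<beta>" if "t \<in> J" for t unfolding \<beta>_def by (rule cSup_upper[OF that bdd])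
  have J\<beta>: "t < \<beta>" if t: "t \<in> J" for t
  proof -
    obtain e where "e > 0" "ball t e \<subseteq> J" using J(1) t by (meson openE)
    then have "t + e / 2 \<in> J" by (auto simp: dist_real_def)
    then show ?thesis using le[of "t + e / 2"] \<open>e > 0\<close> by simp
  qed
  have sub: "{t0..<\<beta>} \<subseteq> J"
  proof
    fix t assume "t \<in> {t0..<\<beta>}"
    then obtain u where "u \<in> J" "t < u" using less_cSup_iff[OF J(3) bdd, of t] by (auto simp: \<beta>_def)
    then show "t \<in> J" using ivl[OF t0] \<open>t \<in> {t0..<\<beta>}\<close> by auto
  qed
  define E where "E = - a (X t0) * (\<Xi> t0)\<^sup>2 + b (X t0) * \<Xi> t0"
  have Et: "- a (X t) * (\<Xi> t)\<^sup>2 + b (X t) * \<Xi> t = E" if "t \<in> {t0..<\<beta>}" for t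
  proof (cases "t = t0")
    case False
    then have t: "t0 < t" using that by auto
    have "- a (X t) * (\<Xi> t)\<^sup>2 + b (X t) * \<Xi> t = - a (X t0) * (\<Xi> t0)\<^sup>2 + b (X t0) * \<Xi> t0"
    proof (rule DERIV_isconst_end[OF t])
      have dd: "((\<lambda>t. - a (X t) * (\<Xi> t)\<^sup>2 + b (X t) * \<Xi> t) has_real_derivative 0) (at u)" if "u \<in> J" for u
      proof -
        note da = DERIV_chain2[OF smooth_DERIV[OF sm(1)] d(1)[OF that]] and db = DERIV_chain2[OF smooth_DERIV[OF sm(2)] d(1)[OF that]]
        show ?thesis
          by (rule derivative_eq_intros da db d(2)[OF that] refl)+ (simp add: algebra_simps power2_eq_square)
      qed
      have uJ: "u \<in> J" if "u \<in> {t0..t}" for u using that \<open>t \<in> {t0..<\<beta>}\<close> sub by auto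
      show "continuous_on {t0..t} (\<lambda>t. - a (X t) * (\<Xi> t)\<^sup>2 + b (X t) * \<Xi> t)"
        using DERIV_isCont[OF dd[OF uJ]] by (intro continuous_at_imp_continuous_on) blast
      show "((\<lambda>t. - a (X t) * (\<Xi> t)\<^sup>2 + b (X t) * \<Xi> t) has_real_derivative 0) (at u)" if "t0 < u" "u < t" for u
        by (rule dd[OF uJ]) (use that in auto)
    qed
    then show ?thesis by (simp add: E_def)
  qed (simp add: E_def)
  obtain B where B: "B > 0" "\<And>x. \<bar>ddx b x\<bar> \<le> B" using Cinf_bounded[OF Cinf_ddx[OF b]] by auto
  define C where "C = sqrt (2 * K * \<bar>E\<bar>) + 2 * K + B"
  have C: "C > 0" using K(1) B(1) by (simp add: C_def add_nonneg_pos)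
  have rate: "\<bar>ddx a (X t) * (\<Xi> t)\<^sup>2 - ddx b (X t) * \<Xi> t\<bar> \<le> C * \<bar>\<Xi> t\<bar>" if "t \<in> {t0..<\<beta>}" for t
    unfolding C_def by (rule momentum_rate_bound[OF Et[OF that] K(2,3,1) B(2)])
  have bnd: "\<bar>\<Xi> t\<bar> \<le> \<bar>\<Xi> t0\<bar> * exp (C * (\<beta> - t0))" if t: "t \<in> {t0..<\<beta>}" for t
  proof -
    \<comment> \<open>Gronwall's argument in the form of a nonincreasing function; the square is
      taken because \<open>|\<Xi>|\<close> need not be differentiable where it vanishes.\<close>
    have "(\<Xi> t)\<^sup>2 * exp (- 2 * C * t) \<le> (\<Xi> t0)\<^sup>2 * exp (- 2 * C * t0)"
    proof (rule DERIV_nonpos_imp_nonincreasing[of t0 t])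
      fix u assume u: "t0 \<le> u" "u \<le> t"
      then have u': "u \<in> {t0..<\<beta>}" "u \<in> J" using t sub by auto
      define D where "D = ddx a (X u) * (\<Xi> u)\<^sup>2 - ddx b (X u) * \<Xi> u"
      have der: "((\<lambda>t. (\<Xi> t)\<^sup>2 * exp (- 2 * C * t)) has_real_derivative (2 * (\<Xi> u * D - C * (\<Xi> u)\<^sup>2)) * exp (- 2 * C * u)) (at u)"
        unfolding D_def by (rule derivative_eq_intros d(2)[OF u'(2)] refl)+ (simp add: algebra_simps)
      have "\<Xi> u * D \<le> \<bar>\<Xi> u\<bar> * \<bar>D\<bar>" using abs_ge_self[of "\<Xi> u * D"] by (simp add: abs_mult)
      also have "\<dots> \<le> \<bar>\<Xi> u\<bar> * (C * \<bar>\<Xi> u\<bar>)" using rate[OF u'(1)] unfolding D_def by (rule mult_left_mono) simp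
      also have "\<dots> = C * (\<Xi> u)\<^sup>2" by (simp add: power2_eq_square)
      finally have "2 * (\<Xi> u * D - C * (\<Xi> u)\<^sup>2) \<le> 0" by simp
      then have "(2 * (\<Xi> u * D - C * (\<Xi> u)\<^sup>2)) * exp (- 2 * C * u) \<le> 0"
        by (rule mult_nonpos_nonneg) simp
      with der show "\<exists>y. ((\<lambda>t. (\<Xi> t)\<^sup>2 * exp (- 2 * C * t)) has_real_derivative y) (at u) \<and> y \<le> 0"
        by blast
    qed (use t in auto)
    then have "(\<Xi> t)\<^sup>2 * exp (- 2 * C * t) * exp (2 * C * t) \<le> (\<Xi> t0)\<^sup>2 * exp (- 2 * C * t0) * exp (2 * C * t)"
      by (rule mult_right_mono) simp
    then have "(\<Xi> t)\<^sup>2 \<le> (\<Xi> t0)\<^sup>2 * exp (2 * C * (t - t0))"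
      by (simp add: mult.assoc exp_add[symmetric] algebra_simps)
    also have "\<dots> \<le> (\<Xi> t0)\<^sup>2 * exp (2 * C * (\<beta> - t0))" using t C by (intro mult_left_mono) auto
    also have "\<dots> = (\<bar>\<Xi> t0\<bar> * exp (C * (\<beta> - t0)))\<^sup>2"
      by (simp add: power_mult_distrib exp_double[symmetric] mult.assoc)
    finally show ?thesis by (intro power2_le_imp_le[of "\<bar>\<Xi> t\<bar>"]) auto
  qed
  show ?thesis by (rule extend_bounded_curve[OF a b ic J\<beta>[OF t0] sub J\<beta> bnd])
qed

text \<open>Reversing time replaces \<open>p\<close> by \<open>- p\<close>. The degeneracy bounds
  see only squares and absolute values, so they hold for \<open>- a\<close> and \<open>- b\<close>
  as well, and continuation backwards reduces to \<open>forward_extend\<close>.\<close>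

lemma reverse_curve:
  assumes sm: "smooth a" "smooth b" and ic: "integral_curve (symbol_p a b) J X \<Xi>"
  shows "integral_curve (symbol_p (\<lambda>x. - a x) (\<lambda>x. - b x)) (uminus ` J) (\<lambda>t. X (- t)) (\<lambda>t. \<Xi> (- t))"
proof -
  have sm': "smooth (\<lambda>x. - a x)" "smooth (\<lambda>x. - b x)" using sm by (auto intro: smooth_minus)
  have dn: "ddx (\<lambda>x. - a x) = (\<lambda>x. - ddx a x)" "ddx (\<lambda>x. - b x) = (\<lambda>x. - ddx b x)"
    by (intro ddx_eqI has_vector_derivative_minus smooth_vd sm)+
  have J: "open J" "is_interval J" "J \<noteq> {}"
    and d: "\<And>t. t \<in> J \<Longrightarrow> (X has_real_derivative - 2 * a (X t) * \<Xi> t + b (X t)) (at t)"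
      "\<And>t. t \<in> J \<Longrightarrow> (\<Xi> has_real_derivative ddx a (X t) * (\<Xi> t)\<^sup>2 - ddx b (X t) * \<Xi> t) (at t)"
    using ic unfolding integral_curve_def symbol_derivs[OF sm] by auto
  have n: "((\<lambda>t. - t) has_real_derivative - 1) (at t)" for t :: real by (auto intro!: derivative_eq_intros)
  show ?thesis
    unfolding integral_curve_def symbol_derivs[OF sm'] dn
  proof (intro conjI ballI)
    show "open (uminus ` J)" using J(1) by (simp add: open_negations)
    show "is_interval (uminus ` J)" using J(2) by (simp add: is_interval_neg_translationI is_interval_uminus)
    show "uminus ` J \<noteq> {}" using J(3) by simp
    fix t assume "t \<in> uminus ` J"
    then have t: "- t \<in> J" by auto
    show "((\<lambda>t. X (- t)) has_real_derivative - 2 * - a (X (- t)) * \<Xi> (- t) + - b (X (- t))) (at t)"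
      using DERIV_chain2[OF d(1)[OF t] n] by (simp add: algebra_simps)
    show "((\<lambda>t. \<Xi> (- t)) has_real_derivative - ddx a (X (- t)) * (\<Xi> (- t))\<^sup>2 - - ddx b (X (- t)) * \<Xi> (- t)) (at t)"
      using DERIV_chain2[OF d(2)[OF t] n] by (simp add: algebra_simps)
  qed
qed

lemma degenerate_flow_complete:
  assumes a: "a \<in> Cinf_S1" and b: "b \<in> Cinf_S1"
    and K: "K > 0" "\<And>x. (ddx a x)\<^sup>2 \<le> K * \<bar>a x\<bar>" "\<And>x. \<bar>ddx a x * b x\<bar> \<le> K * \<bar>a x\<bar>"
  shows "hamiltonian_flow_complete (symbol_p a b)"
  unfolding hamiltonian_flow_complete_def
proof (intro allI impI)
  fix J X \<Xi> assume mx: "maximal_integral_curve (symbol_p a b) J X \<Xi>"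
  then have ic: "integral_curve (symbol_p a b) J X \<Xi>" by (simp add: maximal_integral_curve_def)
  have noext: False if "integral_curve (symbol_p a b) J' X' \<Xi>'" "J \<subseteq> J'" "J' \<noteq> J" "\<forall>t\<in>J. X' t = X t \<and> \<Xi>' t = \<Xi> t" for J' X' \<Xi>'
    using mx that unfolding maximal_integral_curve_def by blast
  have sm: "smooth a" "smooth b" using a b by (auto simp: Cinf_S1_iff)
  show "J = UNIV"
  proof (rule ccontr)
    assume "J \<noteq> UNIV"
    then obtain s where s: "s \<notin> J" by blast
    obtain t0 where t0: "t0 \<in> J" using ic by (auto simp: integral_curve_def)
    consider "t0 < s" | "s < t0" using s t0 by (metis linorder_neqE_linordered_idom)
    then show False
    proof cases
      case 1
      show ?thesis using forward_extend[OF a b K ic t0 s 1] noext by blast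
    next
      case 2
      define a' b' where "a' = (\<lambda>x. - a x)" and "b' = (\<lambda>x. - b x)"
      have ab': "a' \<in> Cinf_S1" "b' \<in> Cinf_S1" unfolding a'_def b'_def by (intro Cinf_minus a b)+
      have sm': "smooth a'" "smooth b'" using ab' by (auto simp: Cinf_S1_iff)
      have dn: "ddx a' = (\<lambda>x. - ddx a x)" unfolding a'_def by (intro ddx_eqI has_vector_derivative_minus smooth_vd sm)
      have K': "(ddx a' x)\<^sup>2 \<le> K * \<bar>a' x\<bar>" "\<bar>ddx a' x * b' x\<bar> \<le> K * \<bar>a' x\<bar>" for x
        using K(2,3)[of x] unfolding dn by (simp_all add: a'_def b'_def)
      have "- t0 \<in> uminus ` J" "- s \<notin> uminus ` J" "- t0 < - s" using t0 s 2 by auto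
      from forward_extend[OF ab' K(1) K' reverse_curve[OF sm ic, folded a'_def b'_def] this]
      obtain J' X' \<Xi>' where e: "integral_curve (symbol_p a' b') J' X' \<Xi>'" "uminus ` J \<subseteq> J'" "J' \<noteq> uminus ` J"
        "\<forall>t\<in>uminus ` J. X' t = X (- t) \<and> \<Xi>' t = \<Xi> (- t)" by blast
      have "integral_curve (symbol_p (\<lambda>x. - a' x) (\<lambda>x. - b' x)) (uminus ` J') (\<lambda>t. X' (- t)) (\<lambda>t. \<Xi>' (- t))"
        by (rule reverse_curve[OF sm' e(1)])
      then have "integral_curve (symbol_p a b) (uminus ` J') (\<lambda>t. X' (- t)) (\<lambda>t. \<Xi>' (- t))"
        by (simp add: a'_def b'_def)
      moreover have "J \<subseteq> uminus ` J'" using image_mono[OF e(2), of uminus] by (simp add: image_image)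
      moreover have "uminus ` J' \<noteq> J"
      proof
        assume "uminus ` J' = J"
        then have "uminus ` uminus ` J' = uminus ` J" by simp
        then show False using e(3) by (simp add: image_image)
      qed
      moreover have "\<forall>t\<in>J. X' (- t) = X t \<and> \<Xi>' (- t) = \<Xi> t" using e(4) by auto
      ultimately show ?thesis by (rule noext)
    qed
  qed
qed

section \<open>Incomplete flows\<close>

text \<open>Zorn's lemma on graphs over the domains. The set \<open>gr\<close> forgets the values of
  \<open>X\<close> and \<open>\<Xi>\<close> outside \<open>J\<close>, which are arbitrary for total
  functions, so inclusion of graphs is exactly extension of curves. Along a chain the curves agree
  on overlaps, and their union is again a curve.\<close>

lemma maximal_extension:
  assumes ic: "integral_curve p J0 X0 \<Xi>0"
  shows "\<exists>J X \<Xi>. maximal_integral_curve p J X \<Xi> \<and> J0 \<subseteq> J \<and> (\<forall>t\<in>J0. X t = X0 t \<and> \<Xi> t = \<Xi>0 t)"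
proof -
  define gr where "gr J X \<Xi> = {(t, X t, \<Xi> t) |t. t \<in> J}" for J and X \<Xi> :: "real \<Rightarrow> real"
  define A where "A = {gr J X \<Xi> |J X \<Xi>. integral_curve p J X \<Xi> \<and> J0 \<subseteq> J \<and> (\<forall>t\<in>J0. X t = X0 t \<and> \<Xi> t = \<Xi>0 t)}"
  have J0: "J0 \<noteq> {}" using ic by (simp add: integral_curve_def)
  have gr_sub: "gr J X \<Xi> \<subseteq> gr J' X' \<Xi>' \<longleftrightarrow> J \<subseteq> J' \<and> (\<forall>t\<in>J. X' t = X t \<and> \<Xi>' t = \<Xi> t)" for J J' X X' \<Xi> \<Xi>'
    by (auto simp: gr_def)
  have "\<exists>M\<in>A. \<forall>G\<in>A. M \<subseteq> G \<longrightarrow> G = M"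
  proof (rule Zorn_Lemma2, rule ballI)
    fix C assume C: "C \<in> chains A"
    show "\<exists>U\<in>A. \<forall>G\<in>C. G \<subseteq> U"
    proof (cases "C = {}")
      case True
      have "gr J0 X0 \<Xi>0 \<in> A" using ic by (auto simp: A_def)
      then show ?thesis using True by blast
    next
      case False
      have CA: "C \<subseteq> A" and Cc: "\<And>G H. G \<in> C \<Longrightarrow> H \<in> C \<Longrightarrow> G \<subseteq> H \<or> H \<subseteq> G"
        using C by (auto simp: chains_def chain_subset_def)
      define U where "U = \<Union>C"
      define J where "J = fst ` U"
      have uniq: "x = x'" if "(t, x) \<in> U" "(t, x') \<in> U" for t x x'
      proof -
        obtain G H where GH: "G \<in> C" "H \<in> C" "(t, x) \<in> G" "(t, x') \<in> H" using \<open>(t, x) \<in> U\<close> \<open>(t, x') \<in> U\<close> by (auto simp: U_def)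
        have f: "x = x'" if "K \<in> C" "(t, x) \<in> K" "(t, x') \<in> K" for K
          using CA that by (auto simp: A_def gr_def)
        show ?thesis using Cc[OF GH(1,2)] f[of G] f[of H] GH by blast
      qed
      define Z where "Z t = (SOME z. (t, z) \<in> U)" for t
      have Z: "(t, Z t) \<in> U" if "t \<in> J" for t
        using that someI[of "\<lambda>z. (t, z) \<in> U"] unfolding J_def Z_def by auto
      have ZU: "Z t = z" if "(t, z) \<in> U" for t z
      proof -
        have "t \<in> J" using that by (force simp: J_def)
        from uniq[OF Z[OF this] that] show ?thesis .
      qed
      define X \<Xi> where "X t = fst (Z t)" and "\<Xi> t = snd (Z t)" for t
      have mem: "J' \<subseteq> J \<and> (\<forall>t\<in>J'. X t = X' t \<and> \<Xi> t = \<Xi>' t)" if "gr J' X' \<Xi>' \<in> C" for J' X' \<Xi>'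
      proof -
        have "(t, X' t, \<Xi>' t) \<in> U" if "t \<in> J'" for t
        proof -
          have "(t, X' t, \<Xi>' t) \<in> gr J' X' \<Xi>'" using that by (auto simp: gr_def)
          then show ?thesis unfolding U_def using \<open>gr J' X' \<Xi>' \<in> C\<close> by blast
        qed
        then show ?thesis using ZU by (force simp: J_def X_def \<Xi>_def)
      qed
      have ex: "\<exists>J' X' \<Xi>'. gr J' X' \<Xi>' \<in> C \<and> t \<in> J' \<and> integral_curve p J' X' \<Xi>' \<and> J0 \<subseteq> J' \<and> (\<forall>t\<in>J0. X' t = X0 t \<and> \<Xi>' t = \<Xi>0 t)"
        if t: "t \<in> J" for t
      proof -
        obtain G where G: "G \<in> C" "(t, Z t) \<in> G" using Z[OF t] by (auto simp: U_def)
        then obtain J' X' \<Xi>' where "G = gr J' X' \<Xi>'" "integral_curve p J' X' \<Xi>'" "J0 \<subseteq> J'" "\<forall>t\<in>J0. X' t = X0 t \<and> \<Xi>' t = \<Xi>0 t"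
          using CA by (auto simp: A_def)
        moreover have "t \<in> J'" using G(2) \<open>G = gr J' X' \<Xi>'\<close> by (auto simp: gr_def)
        ultimately show ?thesis using G(1) by blast
      qed
      have "\<exists>t. t \<in> J"
      proof -
        obtain G where "G \<in> C" using False by blast
        then obtain J' X' \<Xi>' where "gr J' X' \<Xi>' \<in> C" "J0 \<subseteq> J'" using CA by (auto simp: A_def)
        then show ?thesis using mem J0 by blast
      qed
      then obtain t1 where t1: "t1 \<in> J" by blast
      have J0J: "J0 \<subseteq> J" "\<forall>t\<in>J0. X t = X0 t \<and> \<Xi> t = \<Xi>0 t" 
      proof -
        obtain J' X' \<Xi>' where "gr J' X' \<Xi>' \<in> C" "J0 \<subseteq> J'" "\<forall>t\<in>J0. X' t = X0 t \<and> \<Xi>' t = \<Xi>0 t"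
          using ex[OF t1] by blast
        then show "J0 \<subseteq> J" "\<forall>t\<in>J0. X t = X0 t \<and> \<Xi> t = \<Xi>0 t"
          using mem[of J' X' \<Xi>'] by (blast, metis subsetD)
      qed
      have "integral_curve p J X \<Xi>"
        unfolding integral_curve_def
      proof (intro conjI ballI)
        show "open J"
          unfolding open_subopen[of J]
        proof (intro ballI allI impI)
          fix t assume "t \<in> J"
          from ex[OF this] obtain J' X' \<Xi>' where *: "gr J' X' \<Xi>' \<in> C" "t \<in> J'" "integral_curve p J' X' \<Xi>'" by blast
          then show "\<exists>T. open T \<and> t \<in> T \<and> T \<subseteq> J" using mem[OF *(1)] by (auto simp: integral_curve_def)
        qed
        show "J \<noteq> {}" using t1 by blast
        show "is_interval J"
          unfolding is_interval_1
        proof (intro ballI allI impI)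
          fix s t x assume st: "s \<in> J" "t \<in> J" and x: "s \<le> x \<and> x \<le> t"
          obtain t2 where t2: "t2 \<in> J0" using J0 by blast
          \<comment> \<open>Two points of the union may belong to different curves of the chain.
            Every curve covers the base time \<open>t2\<close>, so \<open>x\<close> lies between
            \<open>t2\<close> and a point of one and the same domain.\<close>
          have seg: "x \<in> J" if "u \<in> J" "(u \<le> x \<and> x \<le> t2) \<or> (t2 \<le> x \<and> x \<le> u)" for u
          proof -
            obtain J' X' \<Xi>' where *: "gr J' X' \<Xi>' \<in> C" "u \<in> J'" "integral_curve p J' X' \<Xi>'" "J0 \<subseteq> J'" using ex[OF \<open>u \<in> J\<close>] by blast
            have "is_interval J'" using *(3) by (simp add: integral_curve_def)
            then have "x \<in> J'" using *(2,4) t2 that(2) unfolding is_interval_1 by blast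
            then show ?thesis using mem[OF *(1)] by blast
          qed
          show "x \<in> J"
          proof (cases "x \<le> t2")
            case True
            then show ?thesis using seg[OF st(1)] x by blast
          next
            case False
            then show ?thesis using seg[OF st(2)] x by simp
          qed
        qed
        fix t assume "t \<in> J"
        from ex[OF this] obtain J' X' \<Xi>' where *: "gr J' X' \<Xi>' \<in> C" "t \<in> J'" "integral_curve p J' X' \<Xi>'" by blast
        note m = mem[OF *(1)]
        have o: "open J'" and d: "(X' has_real_derivative deriv (\<lambda>\<xi>. p (X' t) \<xi>) (\<Xi>' t)) (at t)"
          "(\<Xi>' has_real_derivative - deriv (\<lambda>x. p x (\<Xi>' t)) (X' t)) (at t)"
          using *(2,3) by (auto simp: integral_curve_def)
        have e: "X t = X' t" "\<Xi> t = \<Xi>' t" using m *(2) by auto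
        show "(X has_real_derivative deriv (\<lambda>\<xi>. p (X t) \<xi>) (\<Xi> t)) (at t)"
          unfolding e by (rule has_field_derivative_transform_within_open[OF d(1) o *(2)]) (use m in simp)
        show "(\<Xi> has_real_derivative - deriv (\<lambda>x. p x (\<Xi> t)) (X t)) (at t)"
          unfolding e by (rule has_field_derivative_transform_within_open[OF d(2) o *(2)]) (use m in simp)
      qed
      then have "gr J X \<Xi> \<in> A" using J0J by (auto simp: A_def)
      moreover have "G \<subseteq> gr J X \<Xi>" if "G \<in> C" for G
      proof -
        obtain J' X' \<Xi>' where G: "G = gr J' X' \<Xi>'" using CA \<open>G \<in> C\<close> by (auto simp: A_def)
        show ?thesis using mem[of J' X' \<Xi>'] \<open>G \<in> C\<close> unfolding G gr_sub by blast
      qed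
      ultimately show ?thesis by blast
    qed
  qed
  then obtain M' where M': "M' \<in> A" "\<forall>G\<in>A. M' \<subseteq> G \<longrightarrow> G = M'" by blast
  from M'(1) obtain J X \<Xi> where eq: "M' = gr J X \<Xi>"
    and M: "integral_curve p J X \<Xi>" "J0 \<subseteq> J" "\<forall>t\<in>J0. X t = X0 t \<and> \<Xi> t = \<Xi>0 t"
    unfolding A_def by blast
  have mx: "G = gr J X \<Xi>" if "G \<in> A" "gr J X \<Xi> \<subseteq> G" for G
    using M'(2) that unfolding eq by blast
  have "maximal_integral_curve p J X \<Xi>"
    unfolding maximal_integral_curve_def
  proof (intro conjI allI impI)
    fix J' X' \<Xi>' assume h: "integral_curve p J' X' \<Xi>' \<and> J \<subseteq> J' \<and> (\<forall>t\<in>J. X' t = X t \<and> \<Xi>' t = \<Xi> t)"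
    then have "gr J' X' \<Xi>' \<in> A" unfolding A_def using M by (intro CollectI exI[of _ J'] exI[of _ X'] exI[of _ \<Xi>']) auto
    moreover have "gr J X \<Xi> \<subseteq> gr J' X' \<Xi>'" using h unfolding gr_sub by blast
    ultimately have "gr J' X' \<Xi>' = gr J X \<Xi>" by (rule mx)
    then have "gr J' X' \<Xi>' \<subseteq> gr J X \<Xi>" by simp
    then have "J' \<subseteq> J" unfolding gr_sub by blast
    then show "J' = J" using h by blast
  qed (rule M(1))
  then show ?thesis using M by blast
qed

text \<open>A maximal extension defined for all times would be continuous at 0, against the blow-up.
  The singular time is the left end of the interval, so examples can be built as forward solutions
  that leave the singularity.\<close>

lemma blow_up_incomplete:
  assumes ic: "integral_curve p {0<..<\<tau>} X0 \<Xi>0" and \<tau>: "\<tau> > 0"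
    and lim: "filterlim (\<lambda>t. \<bar>\<Xi>0 t\<bar>) at_top (at_right 0)"
  shows "\<not> hamiltonian_flow_complete p"
proof
  assume "hamiltonian_flow_complete p"
  moreover obtain J X \<Xi> where M: "maximal_integral_curve p J X \<Xi>" "{0<..<\<tau>} \<subseteq> J" "\<forall>t\<in>{0<..<\<tau>}. X t = X0 t \<and> \<Xi> t = \<Xi>0 t"
    using maximal_extension[OF ic] by blast
  ultimately have "J = UNIV" by (auto simp: hamiltonian_flow_complete_def)
  then have "(\<Xi> has_real_derivative - deriv (\<lambda>x. p x (\<Xi> 0)) (X 0)) (at 0)"
    using M(1) by (simp add: maximal_integral_curve_def integral_curve_def)
  then have "isCont \<Xi> 0" by (rule DERIV_isCont)
  then have "(\<Xi> \<longlongrightarrow> \<Xi> 0) (at_right 0)"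
    unfolding isCont_def by (rule tendsto_mono[rotated]) (simp add: at_le)
  then have l1: "((\<lambda>t. \<bar>\<Xi> t\<bar>) \<longlongrightarrow> \<bar>\<Xi> 0\<bar>) (at_right 0)" by (rule tendsto_rabs)
  have "\<forall>\<^sub>F t in at_right 0. t \<in> {0<..<\<tau>}" using \<tau> by (simp add: eventually_at_right_field) blast
  then have "\<forall>\<^sub>F t in at_right 0. \<bar>\<Xi>0 t\<bar> = \<bar>\<Xi> t\<bar>" by eventually_elim (use M(3) in simp)
  then have "filterlim (\<lambda>t. \<bar>\<Xi> t\<bar>) at_top (at_right 0)" using lim by (simp add: filterlim_cong)
  then show False using l1 not_tendsto_and_filterlim_at_infinity[of "at_right (0::real)"] filterlim_at_top_imp_at_infinity
    by (metis trivial_limit_at_right_real)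
qed

text \<open>Over a common zero of \<open>a\<close> and \<open>b\<close> the position stays put and
  the momentum obeys \<open>\<xi>' = \<alpha> \<xi>^2 - \<beta> \<xi>\<close>. The substitution
  \<open>\<xi> = - 1 / (\<alpha> g)\<close> turns this into the linear equation
  \<open>g' = 1 + \<beta> g\<close>; the solution with \<open>g 0 = 0\<close> has a simple zero,
  which is the blow-up.\<close>

lemma incomplete_vertical:
  assumes a: "a \<in> Cinf_S1" and b: "b \<in> Cinf_S1" and a0: "a x0 = 0" and b0: "b x0 = 0" and a1: "ddx a x0 \<noteq> 0"
  shows "\<not> hamiltonian_flow_complete (symbol_p a b)"
proof -
  have sm: "smooth a" "smooth b" using a b by (auto simp: Cinf_S1_iff)
  define \<alpha> \<beta> where "\<alpha> = ddx a x0" and "\<beta> = ddx b x0"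
  have \<alpha>: "\<alpha> \<noteq> 0" using a1 by (simp add: \<alpha>_def)
  define g where "g t = (if \<beta> = 0 then t else (exp (\<beta> * t) - 1) / \<beta>)" for t
  have gd: "(g has_real_derivative 1 + \<beta> * g t) (at t)" for t
  proof (cases "\<beta> = 0")
    case True
    have "g = (\<lambda>t. t)" using True by (auto simp: g_def)
    then show ?thesis using True by (auto intro!: derivative_eq_intros)
  next
    case False
    have "g = (\<lambda>t. (exp (\<beta> * t) - 1) / \<beta>)" using False by (auto simp: g_def)
    then show ?thesis using False by (auto intro!: derivative_eq_intros simp: g_def)
  qed
  have g0: "g 0 = 0" by (simp add: g_def)
  have gp: "g t > 0" if "t > 0" for t
  proof (cases "\<beta> > 0")
    case True
    then show ?thesis using that by (simp add: g_def)
  next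
    case False
    show ?thesis
    proof (cases "\<beta> = 0")
      case False
      then have "\<beta> < 0" using \<open>\<not> \<beta> > 0\<close> by simp
      moreover from this have "exp (\<beta> * t) < 1" using that by (simp add: mult_neg_pos)
      ultimately show ?thesis by (simp add: g_def divide_neg_neg)
    qed (use that in \<open>simp add: g_def\<close>)
  qed
  define \<Xi> where "\<Xi> t = - 1 / (\<alpha> * g t)" for t
  have "integral_curve (symbol_p a b) {0<..<1} (\<lambda>t. x0) \<Xi>"
    unfolding integral_curve_def symbol_derivs[OF sm]
  proof (intro conjI ballI)
    fix t :: real assume "t \<in> {0<..<1}"
    then have t: "g t > 0" using gp by simp
    show "((\<lambda>t. x0) has_real_derivative - 2 * a x0 * \<Xi> t + b x0) (at t)" using a0 b0 by simp
    have "((\<lambda>t. - 1 / (\<alpha> * g t)) has_real_derivative (0 * (\<alpha> * g t) - (- 1) * (\<alpha> * (1 + \<beta> * g t))) / ((\<alpha> * g t) * (\<alpha> * g t))) (at t)"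
      by (rule DERIV_divide) (use t \<alpha> in \<open>auto intro!: DERIV_cmult gd\<close>)
    moreover have "(0 * (\<alpha> * g t) - (- 1) * (\<alpha> * (1 + \<beta> * g t))) / ((\<alpha> * g t) * (\<alpha> * g t)) = \<alpha> * (\<Xi> t)\<^sup>2 - \<beta> * \<Xi> t"
      using t \<alpha> by (simp add: \<Xi>_def field_simps power2_eq_square)
    ultimately show "(\<Xi> has_real_derivative ddx a x0 * (\<Xi> t)\<^sup>2 - ddx b x0 * \<Xi> t) (at t)"
      by (simp add: \<Xi>_def[abs_def] \<alpha>_def \<beta>_def)
  qed (auto intro: exI[of _ "1/2"])
  moreover have "filterlim (\<lambda>t. \<bar>\<Xi> t\<bar>) at_top (at_right 0)"
  proof -
    have "isCont g 0" using DERIV_isCont[OF gd] .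
    then have "(g \<longlongrightarrow> 0) (at_right 0)"
      unfolding isCont_def g0 by (rule tendsto_mono[rotated]) (simp add: at_le)
    then have "((\<lambda>t. \<bar>\<alpha> * g t\<bar>) \<longlongrightarrow> 0) (at_right 0)" by (intro tendsto_rabs_zero tendsto_mult_right_zero)
    moreover have "\<forall>\<^sub>F t in at_right 0. \<bar>\<alpha> * g t\<bar> > 0"
      using eventually_at_right_less[of "0::real"] by eventually_elim (use gp \<alpha> in force)
    ultimately have "filterlim (\<lambda>t. inverse \<bar>\<alpha> * g t\<bar>) at_top (at_right 0)"
      by (rule filterlim_inverse_at_top)
    moreover have "\<bar>\<Xi> t\<bar> = inverse \<bar>\<alpha> * g t\<bar>" for t by (simp add: \<Xi>_def inverse_eq_divide)
    ultimately show ?thesis by simp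
  qed
  ultimately show ?thesis using blow_up_incomplete zero_less_one by blast
qed

text \<open>The curve lies on the zero energy level, where \<open>\<xi> = b / a\<close> makes the
  position equation regular. Started at \<open>x0\<close>, the position leaves with nonzero speed,
  while the momentum is infinite at the starting time.\<close>

lemma incomplete_transversal:
  assumes a: "a \<in> Cinf_S1" and b: "b \<in> Cinf_S1" and fm: "finite_multiplicity_zero a x0" and b0: "b x0 \<noteq> 0"
  shows "\<not> hamiltonian_flow_complete (symbol_p a b)"
proof -
  have sm: "smooth a" "smooth b" using a b by (auto simp: Cinf_S1_iff)
  have a0: "a x0 = 0" using fm by (simp add: finite_multiplicity_zero_def)
  obtain d where d: "d > 0" "\<And>y. \<bar>y - x0\<bar> < d \<Longrightarrow> y \<noteq> x0 \<Longrightarrow> a y \<noteq> 0"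
    using zeros_isolated[OF sm(1) fm] by auto
  have bc: "isCont b x0" using smooth_continuous[OF sm(2), of UNIV] by (simp add: continuous_on_eq_continuous_at)
  obtain e where e: "e > 0" "\<And>y. \<bar>y - x0\<bar> < e \<Longrightarrow> \<bar>b y - b x0\<bar> < \<bar>b x0\<bar> / 2"
    using isCont_eps_delta[OF bc, of "\<bar>b x0\<bar> / 2"] b0 by auto
  have bl: "\<bar>b x0\<bar> / 2 \<le> \<bar>b y\<bar>" if "\<bar>y - x0\<bar> < e" for y using e(2)[OF that] by linarith
  obtain B where B: "B > 0" "\<And>x y. \<bar>b x - b y\<bar> \<le> B * \<bar>x - y\<bar>" using Cinf_lipschitz[OF b] by blast
  have "B-lipschitz_on UNIV (\<lambda>x. - b x)"
    by (rule lipschitz_onI) (use B in \<open>auto simp: dist_real_def abs_minus_commute\<close>)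
  from picard_forward[OF this, of 0 x0] obtain \<delta> y where \<delta>: "\<delta> > 0" and yc: "continuous_on {0..\<delta>} y" and y0: "y 0 = x0"
    and yd: "\<And>t. t \<in> {0<..<\<delta>} \<Longrightarrow> (y has_vector_derivative - b (y t)) (at t)" by auto
  obtain e2 where e2: "e2 > 0" "\<And>t. t \<in> {0..\<delta>} \<Longrightarrow> dist t 0 < e2 \<Longrightarrow> dist (y t) (y 0) < min d e"
    using yc[unfolded continuous_on_iff, rule_format, of 0 "min d e"] \<delta> d(1) e(1) by auto
  define \<tau> where "\<tau> = min \<delta> e2"
  have \<tau>: "\<tau> > 0" "\<tau> \<le> \<delta>" using \<delta> e2 by (auto simp: \<tau>_def)
  have near: "\<bar>y t - x0\<bar> < d" "\<bar>y t - x0\<bar> < e" if "t \<in> {0..<\<tau>}" for t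
    using e2(2)[of t] that y0 by (auto simp: \<tau>_def dist_real_def)
  have yd': "(y has_real_derivative - b (y t)) (at t)" if "t \<in> {0<..<\<tau>}" for t
    using yd[of t] that \<tau> by (auto simp: has_real_derivative_iff_has_vector_derivative)
  have yn: "y t \<noteq> x0" if t: "t \<in> {0<..<\<tau>}" for t
  proof -
    \<comment> \<open>\<open>b\<close> stays away from 0 near \<open>x0\<close>, so the mean value
      theorem forbids a return to \<open>x0\<close>; hence \<open>a\<close> does not vanish along
      the curve.\<close>
    have "\<exists>l z. 0 < z \<and> z < t \<and> (y has_real_derivative l) (at z) \<and> y t - y 0 = (t - 0) * l"
    proof (rule MVT)
      show "continuous_on {0..t} y" by (rule continuous_on_subset[OF yc]) (use t \<tau> in auto)
      show "y differentiable (at z)" if "0 < z" "z < t" for z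
        using yd'[of z] that t by (auto simp: real_differentiable_def)
    qed (use t in simp)
    then obtain l z where z: "0 < z" "z < t" "(y has_real_derivative l) (at z)" "y t - y 0 = t * l" by auto
    then have "l = - b (y z)" using yd'[of z] t DERIV_unique by auto
    moreover have "b (y z) \<noteq> 0" using bl[OF near(2)[of z]] z t b0 by auto
    ultimately show ?thesis using z(4) y0 t by auto
  qed
  have an: "a (y t) \<noteq> 0" if "t \<in> {0<..<\<tau>}" for t using d(2)[OF near(1) yn] that by auto
  define \<Xi> where "\<Xi> t = b (y t) / a (y t)" for t
  have "integral_curve (symbol_p a b) {0<..<\<tau>} y \<Xi>"
    unfolding integral_curve_def symbol_derivs[OF sm]
  proof (intro conjI ballI)
    show "{0<..<\<tau>} \<noteq> {}" using \<tau> by simp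
    fix t assume t: "t \<in> {0<..<\<tau>}"
    note A = an[OF t]
    have "- 2 * a (y t) * \<Xi> t + b (y t) = - b (y t)" using A by (simp add: \<Xi>_def)
    then show "(y has_real_derivative - 2 * a (y t) * \<Xi> t + b (y t)) (at t)" using yd'[OF t] by (simp only:)
    have "((\<lambda>t. b (y t) / a (y t)) has_real_derivative
       ((ddx b (y t) * - b (y t)) * a (y t) - b (y t) * (ddx a (y t) * - b (y t))) / (a (y t) * a (y t))) (at t)"
      by (rule DERIV_divide[OF DERIV_chain2[OF smooth_DERIV[OF sm(2)] yd'[OF t]] DERIV_chain2[OF smooth_DERIV[OF sm(1)] yd'[OF t]] A])
    moreover have "((ddx b (y t) * - b (y t)) * a (y t) - b (y t) * (ddx a (y t) * - b (y t))) / (a (y t) * a (y t)) = ddx a (y t) * (\<Xi> t)\<^sup>2 - ddx b (y t) * \<Xi> t"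
      using A by (simp add: \<Xi>_def field_simps power2_eq_square)
    ultimately show "(\<Xi> has_real_derivative ddx a (y t) * (\<Xi> t)\<^sup>2 - ddx b (y t) * \<Xi> t) (at t)"
      by (simp add: \<Xi>_def[abs_def])
  qed auto
  moreover have "filterlim (\<lambda>t. \<bar>\<Xi> t\<bar>) at_top (at_right 0)"
  proof (rule filterlim_at_top_mono)
    have ac: "isCont a x0" using smooth_continuous[OF sm(1), of UNIV] by (simp add: continuous_on_eq_continuous_at)
    have ev: "\<forall>\<^sub>F t in at_right 0. t \<in> {0<..<\<tau>}" using \<tau> by (simp add: eventually_at_right_field) blast
    have "(y \<longlongrightarrow> x0) (at 0 within {0..\<delta>})" using yc \<delta> y0 by (auto simp: continuous_on)
    then have "(y \<longlongrightarrow> x0) (at_right 0)" using \<delta> by (simp add: at_within_Icc_at_right)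
    then have "((\<lambda>t. a (y t)) \<longlongrightarrow> a x0) (at_right 0)" by (rule isCont_tendsto_compose[OF ac])
    then have "((\<lambda>t. 2 / \<bar>b x0\<bar> * \<bar>a (y t)\<bar>) \<longlongrightarrow> 0) (at_right 0)"
      unfolding a0 by (intro tendsto_mult_right_zero tendsto_rabs_zero)
    moreover have "\<forall>\<^sub>F t in at_right 0. 2 / \<bar>b x0\<bar> * \<bar>a (y t)\<bar> > 0"
      using ev by eventually_elim (use an b0 in simp)
    ultimately show "filterlim (\<lambda>t. inverse (2 / \<bar>b x0\<bar> * \<bar>a (y t)\<bar>)) at_top (at_right 0)"
      by (rule filterlim_inverse_at_top)
    show "\<forall>\<^sub>F t in at_right 0. inverse (2 / \<bar>b x0\<bar> * \<bar>a (y t)\<bar>) \<le> \<bar>\<Xi> t\<bar>"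
      using ev
    proof eventually_elim
      case (elim t)
      have "inverse (2 / \<bar>b x0\<bar> * \<bar>a (y t)\<bar>) = (\<bar>b x0\<bar> / 2) / \<bar>a (y t)\<bar>" by (simp add: field_simps)
      also have "\<dots> \<le> \<bar>b (y t)\<bar> / \<bar>a (y t)\<bar>" using bl[OF near(2)[of t]] elim by (intro divide_right_mono) auto
      finally show ?case by (simp add: \<Xi>_def)
    qed
  qed
  ultimately show ?thesis using blow_up_incomplete \<tau>(1) by blast
qed

section \<open>Square integrable functions on the circle\<close>

abbreviation S1 :: "real measure" where "S1 \<equiv> restrict_space lborel {0..1}"

text \<open>The square of the L2 norm. A sum costs a factor 2 (\<open>sqn_add\<close>) in place of a
  triangle inequality, which explains the divided epsilons later on.\<close>

definition sqn :: "(real \<Rightarrow> complex) \<Rightarrow> real" where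
  "sqn u = (LINT x|S1. (cmod (u x))\<^sup>2)"

lemma set_integral_S1: "(LINT x:{0..1}|lborel. f x) = (LINT x|S1. f x)"
  for f :: "real \<Rightarrow> 'a::{banach, second_countable_topology}"
  by (simp add: integral_restrict_space set_lebesgue_integral_def)

lemma set_integrable_S1: "set_integrable lborel {0..1} f \<longleftrightarrow> integrable S1 f"
  for f :: "real \<Rightarrow> 'a::{banach, second_countable_topology}"
  by (simp add: integrable_restrict_space set_integrable_def)

lemma L2_dist_sqn: "L2_dist u v = sqrt (sqn (\<lambda>x. u x - v x))"
  by (simp add: L2_dist_def sqn_def set_integral_S1)

lemma finite_measure_S1: "finite_measure S1"
  by (rule finite_measureI) (simp add: emeasure_restrict_space space_restrict_space)

lemma measure_S1 [simp]: "measure S1 {0..1} = 1"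
  by (simp add: measure_restrict_space space_restrict_space)

lemma measurable_S1: "f \<in> borel_measurable borel \<Longrightarrow> f \<in> borel_measurable S1"
  by (simp add: measurable_restrict_space1)

lemma integrable_S1_bounded:
  fixes f :: "real \<Rightarrow> 'a::{banach, second_countable_topology}"
  assumes "f \<in> borel_measurable borel" and "\<And>x. norm (f x) \<le> B"
  shows "integrable S1 f"
  by (rule finite_measure.integrable_const_bound[OF finite_measure_S1, where B=B])
    (use assms in \<open>auto intro: measurable_S1\<close>)

lemma L2_S1_iff: "u \<in> L2_S1 \<longleftrightarrow> periodic1 u \<and> u \<in> borel_measurable borel \<and> integrable S1 (\<lambda>x. (cmod (u x))\<^sup>2)"
  by (simp add: L2_S1_def set_integrable_S1)

lemma L2_measurable: "u \<in> L2_S1 \<Longrightarrow> u \<in> borel_measurable S1"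
  by (simp add: L2_S1_iff measurable_S1)

lemma L2_sq_integrable: "u \<in> L2_S1 \<Longrightarrow> integrable S1 (\<lambda>x. (cmod (u x))\<^sup>2)"
  by (simp add: L2_S1_iff)

lemma sum_sq_bound: "(cmod (x + y))\<^sup>2 \<le> 2 * (cmod x)\<^sup>2 + 2 * (cmod y)\<^sup>2"
proof -
  have "(cmod (x + y))\<^sup>2 \<le> (cmod x + cmod y)\<^sup>2" by (intro power_mono norm_triangle_ineq) simp
  also have "\<dots> \<le> 2 * (cmod x)\<^sup>2 + 2 * (cmod y)\<^sup>2"
    using sum_squares_bound[of "cmod x" "cmod y"] by (simp add: power2_sum)
  finally show ?thesis .
qed

lemma L2_boundI:
  assumes "periodic1 u" "u \<in> borel_measurable borel" "integrable S1 g" "\<And>x. (cmod (u x))\<^sup>2 \<le> g x"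
  shows "u \<in> L2_S1"
proof -
  have "integrable S1 (\<lambda>x. (cmod (u x))\<^sup>2)"
  proof (rule Bochner_Integration.integrable_bound[OF assms(3)])
    show "(\<lambda>x. (cmod (u x))\<^sup>2) \<in> borel_measurable S1" using assms(2) by (intro measurable_S1) simp
    have "norm ((cmod (u x))\<^sup>2) \<le> norm (g x)" for x
      using assms(4)[of x] zero_le_power2[of "cmod (u x)"] by simp
    then show "AE x in S1. norm ((cmod (u x))\<^sup>2) \<le> norm (g x)" by simp
  qed
  then show ?thesis using assms by (simp add: L2_S1_iff)
qed

lemma L2_bounded:
  assumes "periodic1 u" "u \<in> borel_measurable borel" "\<And>x. cmod (u x) \<le> B"
  shows "u \<in> L2_S1"
proof (rule L2_boundI[where g="\<lambda>x. B\<^sup>2"])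
  show "integrable S1 (\<lambda>x. B\<^sup>2)" by (rule integrable_S1_bounded[where B="B\<^sup>2"]) auto
  show "(cmod (u x))\<^sup>2 \<le> B\<^sup>2" for x using assms(3) by (intro power_mono) auto
qed (use assms in auto)

lemma Cinf_measurable:
  fixes f :: "real \<Rightarrow> 'a::real_normed_vector"
  shows "f \<in> Cinf_S1 \<Longrightarrow> f \<in> borel_measurable borel"
  by (intro borel_measurable_continuous_onI) (simp add: Cinf_S1_iff smooth_continuous)

lemma Cinf_L2: "f \<in> Cinf_S1 \<Longrightarrow> f \<in> L2_S1"
  using Cinf_bounded[of f] Cinf_measurable[of f] L2_bounded[of f] by (metis Cinf_S1_iff)

lemma L2_add: assumes "u \<in> L2_S1" "v \<in> L2_S1" shows "(\<lambda>x. u x + v x) \<in> L2_S1"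
proof (rule L2_boundI[where g="\<lambda>x. 2 * (cmod (u x))\<^sup>2 + 2 * (cmod (v x))\<^sup>2"])
  show "integrable S1 (\<lambda>x. 2 * (cmod (u x))\<^sup>2 + 2 * (cmod (v x))\<^sup>2)"
    by (intro Bochner_Integration.integrable_add integrable_mult_right L2_sq_integrable assms)
qed (use assms in \<open>auto simp: L2_S1_iff periodic1_def sum_sq_bound\<close>)

lemma L2_bmult:
  assumes u: "u \<in> L2_S1" and g: "periodic1 g" "g \<in> borel_measurable borel" "\<And>x. cmod (g x) \<le> B"
  shows "(\<lambda>x. g x * u x) \<in> L2_S1"
proof (rule L2_boundI[where g="\<lambda>x. B\<^sup>2 * (cmod (u x))\<^sup>2"])
  show "(cmod (g x * u x))\<^sup>2 \<le> B\<^sup>2 * (cmod (u x))\<^sup>2" for x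
    using g(3)[of x] by (auto simp: norm_mult power_mult_distrib intro!: mult_right_mono power_mono)
qed (use assms L2_sq_integrable[OF u] in \<open>auto simp: L2_S1_iff periodic1_def\<close>)

lemma L2_Cmult: assumes "u \<in> L2_S1" "g \<in> Cinf_S1" shows "(\<lambda>x. g x * u x) \<in> L2_S1"
proof -
  obtain B where "\<And>x. cmod (g x) \<le> B" using Cinf_bounded[OF assms(2)] by metis
  then show ?thesis using assms by (intro L2_bmult[where B=B]) (auto simp: Cinf_measurable Cinf_S1_iff)
qed

lemma L2_cmult: "u \<in> L2_S1 \<Longrightarrow> (\<lambda>x. k * u x) \<in> L2_S1"
  using L2_Cmult[of u "\<lambda>x. k"] by simp

lemma L2_minus: "u \<in> L2_S1 \<Longrightarrow> (\<lambda>x. - u x) \<in> L2_S1"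
  using L2_cmult[of u "-1"] by simp

lemma L2_diff: "u \<in> L2_S1 \<Longrightarrow> v \<in> L2_S1 \<Longrightarrow> (\<lambda>x. u x - v x) \<in> L2_S1"
  using L2_add[OF _ L2_minus, of u v] by simp

lemma L2_cnj: "u \<in> L2_S1 \<Longrightarrow> (\<lambda>x. cnj (u x)) \<in> L2_S1"
  unfolding L2_S1_iff
  by (intro conjI borel_measurable_continuous_on[OF continuous_on_cnj[OF continuous_on_id]])
    (auto simp: periodic1_def)

lemma L2_const [simp]: "(\<lambda>x. k) \<in> L2_S1"
  by (rule Cinf_L2) simp

lemma L2_prod_integrable:
  assumes "u \<in> L2_S1" "v \<in> L2_S1" shows "integrable S1 (\<lambda>x. u x * v x)"
proof (rule Bochner_Integration.integrable_bound)
  show "integrable S1 (\<lambda>x. (cmod (u x))\<^sup>2 + (cmod (v x))\<^sup>2)"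
    using assms by (auto intro: L2_sq_integrable)
  show "(\<lambda>x. u x * v x) \<in> borel_measurable S1"
    by (rule borel_measurable_times[OF L2_measurable L2_measurable]) (rule assms)+
  have "cmod (u x * v x) \<le> (cmod (u x))\<^sup>2 + (cmod (v x))\<^sup>2" for x
  proof -
    have "2 * (cmod (u x) * cmod (v x)) \<le> (cmod (u x))\<^sup>2 + (cmod (v x))\<^sup>2"
      using sum_squares_bound[of "cmod (u x)" "cmod (v x)"] by (simp add: mult.assoc)
    moreover have "0 \<le> cmod (u x) * cmod (v x)" by simp
    ultimately show ?thesis unfolding norm_mult by linarith
  qed
  then show "AE x in S1. norm (u x * v x) \<le> norm ((cmod (u x))\<^sup>2 + (cmod (v x))\<^sup>2)" by simp
qed

lemma L2_integrable: "u \<in> L2_S1 \<Longrightarrow> integrable S1 u"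
  using L2_prod_integrable[of u "\<lambda>x. 1"] by simp

lemma sqn_nonneg [simp]: "sqn u \<ge> 0"
  by (simp add: sqn_def integral_nonneg_AE)

lemma sqn_mono:
  assumes "u \<in> L2_S1" "v \<in> L2_S1" "AE x in S1. cmod (u x) \<le> B * cmod (v x)"
  shows "sqn u \<le> B\<^sup>2 * sqn v"
proof -
  have "sqn u \<le> (LINT x|S1. B\<^sup>2 * (cmod (v x))\<^sup>2)"
    unfolding sqn_def
  proof (rule integral_mono_AE)
    show "AE x in S1. (cmod (u x))\<^sup>2 \<le> B\<^sup>2 * (cmod (v x))\<^sup>2"
      using assms(3) by eventually_elim (metis norm_ge_zero power_mono power_mult_distrib)
  qed (use assms in \<open>auto intro: L2_sq_integrable\<close>)
  then show ?thesis by (simp add: sqn_def)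
qed

lemma sqn_mono1:
  assumes "u \<in> L2_S1" "v \<in> L2_S1" "AE x in S1. cmod (u x) \<le> cmod (v x)"
  shows "sqn u \<le> sqn v"
  using sqn_mono[of u v 1] assms by simp

lemma sqn_const [simp]: "sqn (\<lambda>x. k) = (cmod k)\<^sup>2"
  by (simp add: sqn_def)

lemma sqn_bound:
  assumes "u \<in> L2_S1" "AE x in S1. cmod (u x) \<le> B" "B \<ge> 0" shows "sqn u \<le> B\<^sup>2"
  using sqn_mono1[of u "\<lambda>x. of_real B"] assms by simp

lemma sqn_add:
  assumes "u \<in> L2_S1" "v \<in> L2_S1" shows "sqn (\<lambda>x. u x + v x) \<le> 2 * sqn u + 2 * sqn v"
proof -
  have "sqn (\<lambda>x. u x + v x) \<le> (LINT x|S1. 2 * (cmod (u x))\<^sup>2 + 2 * (cmod (v x))\<^sup>2)"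
    unfolding sqn_def
    by (rule integral_mono)
      (use assms L2_add[OF assms] in \<open>auto intro!: L2_sq_integrable sum_sq_bound\<close>)
  also have "\<dots> = 2 * sqn u + 2 * sqn v"
    using assms by (simp add: sqn_def L2_sq_integrable)
  finally show ?thesis .
qed

lemma sqn_commute: "sqn (\<lambda>x. u x - v x) = sqn (\<lambda>x. v x - u x)"
  by (simp add: sqn_def norm_minus_commute)

lemma sqn_trans:
  assumes "u \<in> L2_S1" "v \<in> L2_S1" "w \<in> L2_S1"
  shows "sqn (\<lambda>x. u x - w x) \<le> 2 * sqn (\<lambda>x. u x - v x) + 2 * sqn (\<lambda>x. v x - w x)"
  using sqn_add[OF L2_diff[OF assms(1,2)] L2_diff[OF assms(2,3)]] by simp

lemma sqn_eq_integral: "of_real (sqn u) = (LINT x|S1. u x * cnj (u x))"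
  by (simp add: sqn_def complex_norm_square[symmetric] integral_complex_of_real[symmetric])

lemma sqn_zero_AE:
  assumes "u \<in> L2_S1" "sqn u = 0" shows "AE x in S1. u x = 0"
  using assms integral_nonneg_eq_0_iff_AE[OF L2_sq_integrable[OF assms(1)]] by (simp add: sqn_def)

lemma Cauchy_Schwarz_abs:
  assumes u: "u \<in> L2_S1" and v: "v \<in> L2_S1"
  shows "(LINT x|S1. cmod (u x * v x)) \<le> sqrt (sqn u) * sqrt (sqn v)"
proof -
  define X where "X = (LINT x|S1. cmod (u x * v x))"
  have iX: "integrable S1 (\<lambda>x. cmod (u x * v x))"
    using L2_prod_integrable[OF u v] by (rule integrable_norm)
  have X0: "X \<ge> 0" by (simp add: X_def)
  have Q: "0 \<le> s\<^sup>2 * sqn u - 2 * s * r * X + r\<^sup>2 * sqn v" for s r :: real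
  proof -
    \<comment> \<open>A nonnegative quadratic form in s and r. Evaluated at
      \<open>s = sqn v\<close>, \<open>r = X\<close> it is the discriminant inequality; if
      \<open>sqn v = 0\<close> it is affine in r, which forces \<open>X = 0\<close>.\<close>
    have "0 \<le> (LINT x|S1. (s * cmod (u x) - r * cmod (v x))\<^sup>2)" by simp
    also have "\<dots> = (LINT x|S1. s\<^sup>2 * (cmod (u x))\<^sup>2 - 2 * s * r * cmod (u x * v x) + r\<^sup>2 * (cmod (v x))\<^sup>2)"
      by (rule Bochner_Integration.integral_cong) (auto simp: power2_eq_square norm_mult algebra_simps)
    also have "\<dots> = s\<^sup>2 * sqn u - 2 * s * r * X + r\<^sup>2 * sqn v"
      using iX u v by (simp add: X_def sqn_def L2_sq_integrable)
    finally show ?thesis .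
  qed
  have "X\<^sup>2 \<le> sqn u * sqn v"
  proof (cases "sqn v = 0")
    case True
    have "X = 0"
    proof (rule ccontr)
      assume "X \<noteq> 0"
      then show False using Q[of 1 "(sqn u + 1) / (2 * X)"] True by simp
    qed
    then show ?thesis by (simp add: True)
  next
    case False
    then have "sqn v > 0" using sqn_nonneg[of v] by linarith
    moreover have "0 \<le> sqn v * (sqn u * sqn v - X\<^sup>2)"
      using Q[of "sqn v" X] by (simp add: power2_eq_square algebra_simps)
    ultimately show ?thesis by (simp add: zero_le_mult_iff)
  qed
  then have "sqrt (X\<^sup>2) \<le> sqrt (sqn u * sqn v)" by (rule real_sqrt_le_mono)
  then show ?thesis using X0 by (simp add: X_def real_sqrt_mult)
qed

lemma Cauchy_Schwarz:
  assumes u: "u \<in> L2_S1" and v: "v \<in> L2_S1"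
  shows "cmod (LINT x|S1. u x * v x) \<le> sqrt (sqn u) * sqrt (sqn v)"
  by (rule order_trans[OF integral_norm_bound Cauchy_Schwarz_abs[OF assms]])

lemma integral_L1_bound:
  assumes "u \<in> L2_S1" shows "(LINT x|S1. cmod (u x)) \<le> sqrt (sqn u)"
  using Cauchy_Schwarz_abs[OF assms L2_const[of 1]] by simp

lemma L2_pairing_tendsto:
  assumes U: "\<And>n. U n \<in> L2_S1" and u: "u \<in> L2_S1" and w: "w \<in> L2_S1"
    and lim: "(\<lambda>n. sqn (\<lambda>x. U n x - u x)) \<longlonglongrightarrow> 0"
  shows "(\<lambda>n. LINT x|S1. U n x * w x) \<longlonglongrightarrow> (LINT x|S1. u x * w x)"
proof -
  have "cmod ((LINT x|S1. U n x * w x) - (LINT x|S1. u x * w x)) \<le> sqrt (sqn (\<lambda>x. U n x - u x)) * sqrt (sqn w)" for n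
  proof -
    have "(LINT x|S1. U n x * w x) - (LINT x|S1. u x * w x) = (LINT x|S1. (U n x - u x) * w x)"
      using L2_prod_integrable[OF U w] L2_prod_integrable[OF u w] by (simp add: algebra_simps)
    then show ?thesis using Cauchy_Schwarz[OF L2_diff[OF U u] w] by simp
  qed
  moreover have "(\<lambda>n. sqrt (sqn (\<lambda>x. U n x - u x)) * sqrt (sqn w)) \<longlonglongrightarrow> sqrt 0 * sqrt (sqn w)"
    by (intro tendsto_intros lim)
  then have "(\<lambda>n. sqrt (sqn (\<lambda>x. U n x - u x)) * sqrt (sqn w)) \<longlonglongrightarrow> 0"
    by (simp only: real_sqrt_zero mult_zero_left)
  ultimately have "(\<lambda>n. (LINT x|S1. U n x * w x) - (LINT x|S1. u x * w x)) \<longlonglongrightarrow> 0"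
    by (rule Lim_null_comparison[OF always_eventually[OF allI]])
  then show ?thesis by (rule LIM_zero_cancel)
qed

section \<open>Density of smooth functions\<close>

lemma sqn_tendsto_0:
  assumes G: "\<And>n. G n \<in> borel_measurable S1" and lim: "AE x in S1. (\<lambda>n. G n x) \<longlonglongrightarrow> 0"
    and w: "integrable S1 w" and bd: "\<And>n. AE x in S1. (cmod (G n x))\<^sup>2 \<le> w x"
  shows "(\<lambda>n. sqn (G n)) \<longlonglongrightarrow> 0"
proof -
  have "(\<lambda>n. LINT x|S1. (cmod (G n x))\<^sup>2) \<longlonglongrightarrow> (LINT x|S1. (0::real))"
  proof (rule integral_dominated_convergence[where w=w])
    show "AE x in S1. (\<lambda>n. (cmod (G n x))\<^sup>2) \<longlonglongrightarrow> 0"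
      using lim by eventually_elim (auto intro!: tendsto_eq_intros)
  qed (use assms in auto)
  then show ?thesis by (simp add: sqn_def)
qed

lemma small_of_tendsto_0:
  fixes X :: "nat \<Rightarrow> real" assumes "X \<longlonglongrightarrow> 0" "e > 0" shows "\<exists>n. X n < e"
  using order_tendstoD(2)[OF assms] by (auto simp: eventually_sequentially)

lemma L2_truncate:
  assumes u: "u \<in> L2_S1" and e: "e > 0"
  shows "\<exists>g B. g \<in> L2_S1 \<and> (\<forall>x. cmod (g x) \<le> B) \<and> sqn (\<lambda>x. u x - g x) < e"
proof -
  define g where "g n x = (if cmod (u x) \<le> real n then u x else 0)" for n x
  have m: "u \<in> borel_measurable borel" using u by (simp add: L2_S1_iff)
  have gm: "g n \<in> borel_measurable borel" for n unfolding g_def using m by measurable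
  have gb: "cmod (g n x) \<le> real n" for n x by (simp add: g_def)
  have gL: "g n \<in> L2_S1" for n
    using u gm gb[of n] by (intro L2_bounded) (auto simp: L2_S1_iff periodic1_def g_def)
  have "(\<lambda>n. sqn (\<lambda>x. u x - g n x)) \<longlonglongrightarrow> 0"
  proof (rule sqn_tendsto_0[where w="\<lambda>x. (cmod (u x))\<^sup>2"])
    have "(\<lambda>n. u x - g n x) \<longlonglongrightarrow> 0" for x
    proof (rule tendsto_eventually)
      obtain N where "cmod (u x) \<le> real N" using real_arch_simple by blast
      then show "\<forall>\<^sub>F n in sequentially. u x - g n x = 0"
        unfolding eventually_sequentially g_def by (intro exI[of _ N]) auto
    qed
    then show "AE x in S1. (\<lambda>n. u x - g n x) \<longlonglongrightarrow> 0" by simp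
    show "(\<lambda>x. u x - g n x) \<in> borel_measurable S1" for n using m gm by (intro measurable_S1) simp
    show "AE x in S1. (cmod (u x - g n x))\<^sup>2 \<le> (cmod (u x))\<^sup>2" for n
      by (auto simp: g_def)
  qed (rule L2_sq_integrable[OF u])
  from small_of_tendsto_0[OF this e] show ?thesis using gL gb by blast
qed

text \<open>The radial projection of the plane onto the closed disc of radius
  \<open>B\<close>.\<close>

definition clip :: "real \<Rightarrow> complex \<Rightarrow> complex" where
  "clip B z = z * of_real (B / max B (cmod z))"

lemma clip_cont: "B > 0 \<Longrightarrow> continuous_on UNIV (clip B)"
  unfolding clip_def by (intro continuous_intros) auto

lemma clip_bound: assumes "B > 0" shows "cmod (clip B z) \<le> B"
proof -
  have "cmod (clip B z) = B * (cmod z / max B (cmod z))"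
    using assms by (simp add: clip_def norm_mult norm_divide)
  also have "\<dots> \<le> B * 1" using assms by (intro mult_left_mono) (auto simp: divide_le_eq)
  finally show ?thesis by simp
qed

lemma clip_id: "B > 0 \<Longrightarrow> cmod z \<le> B \<Longrightarrow> clip B z = z"
  by (simp add: clip_def max_def)

text \<open>A measurable function is almost everywhere a limit of continuous ones.
  \<open>clip\<close> supplies the dominating constant, and the factor
  \<open>min 1 (n x (1 - x))\<close>, which tends to 1 inside the period, makes the approximants
  vanish at its ends, so that they live on the circle.\<close>

lemma bounded_approx_continuous:
  assumes g: "g \<in> L2_S1" and B: "\<And>x. cmod (g x) \<le> B" and e: "e > 0"
  shows "\<exists>h. continuous_on UNIV h \<and> h 0 = 0 \<and> h 1 = 0 \<and> (LINT x|S1. (cmod (g x - h x))\<^sup>2) < e"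
proof -
  have gm: "g \<in> borel_measurable borel" using g by (simp add: L2_S1_iff)
  then have "g \<in> borel_measurable lebesgue" by (simp add: measurable_completion)
  then have "g measurable_on UNIV"
    using measurable_on_iff_borel_measurable[of UNIV g] by (simp add: lebesgue_on_UNIV_eq)
  then obtain N G where N: "negligible N" and Gc: "\<And>n. continuous_on UNIV (G n)"
    and Gl: "\<And>x. x \<notin> N \<Longrightarrow> (\<lambda>n. G n x) \<longlonglongrightarrow> g x"
    unfolding measurable_on_def by auto
  define M where "M = \<bar>B\<bar> + 1"
  have M: "M > 0" "cmod (g x) \<le> M" for x unfolding M_def using B[of x] by linarith+
  define h where "h n x = clip M (G n x) * of_real (min 1 (real n * (x * (1 - x))))" for n x
  have hc: "continuous_on UNIV (h n)" for n
    unfolding h_def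
    by (intro continuous_intros continuous_on_compose2[OF clip_cont[OF M(1)] Gc]) auto
  have hb: "cmod (h n x) \<le> M" if "x \<in> {0..1}" for n x
  proof -
    have "0 \<le> x * (1 - x)" using that by simp
    then have "\<bar>min 1 (real n * (x * (1 - x)))\<bar> \<le> 1" by (auto simp: abs_le_iff min_le_iff_disj intro: order_trans[of _ 0])
    then have "cmod (h n x) \<le> M * 1"
      unfolding h_def norm_mult norm_of_real using clip_bound[OF M(1)] M(1) by (intro mult_mono) auto
    then show ?thesis by simp
  qed
  have hl: "(\<lambda>n. h n x) \<longlonglongrightarrow> g x" if "x \<notin> N" "x \<in> {0<..<1}" for x
  proof -
    have "isCont (clip M) (g x)" using clip_cont[OF M(1)] by (simp add: continuous_on_eq_continuous_at)
    then have "(\<lambda>n. clip M (G n x)) \<longlonglongrightarrow> clip M (g x)"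
      using Gl[OF that(1)] isCont_tendsto_compose by blast
    then have 1: "(\<lambda>n. clip M (G n x)) \<longlonglongrightarrow> g x" using clip_id[OF M] by simp
    have p: "x * (1 - x) > 0" using that by simp
    obtain K where K: "1 / (x * (1 - x)) \<le> real K" using real_arch_simple by blast
    have "\<forall>\<^sub>F n in sequentially. complex_of_real (min 1 (real n * (x * (1 - x)))) = 1"
      unfolding eventually_sequentially
    proof (intro exI[of _ K] allI impI)
      fix n assume "n \<ge> K"
      then have "1 / (x * (1 - x)) \<le> real n" using K by simp
      then have "1 \<le> real n * (x * (1 - x))" using p by (simp add: divide_le_eq)
      then show "complex_of_real (min 1 (real n * (x * (1 - x)))) = 1" by simp
    qed
    then have "(\<lambda>n. complex_of_real (min 1 (real n * (x * (1 - x))))) \<longlonglongrightarrow> 1" by (rule tendsto_eventually)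
    from tendsto_mult[OF 1 this] show ?thesis by (simp add: h_def)
  qed
  have "(\<lambda>n. sqn (\<lambda>x. g x - h n x)) \<longlonglongrightarrow> 0"
  proof (rule sqn_tendsto_0[where w="\<lambda>x. (2 * M)\<^sup>2"])
    show "(\<lambda>x. g x - h n x) \<in> borel_measurable S1" for n
      by (rule measurable_S1[OF borel_measurable_diff[OF gm borel_measurable_continuous_onI[OF hc]]])
    have "AE x in lebesgue. x \<notin> N"
      using N by (simp add: negligible_iff_null_sets AE_not_in)
    then have 1: "AE x in lborel. x \<notin> N" by (simp add: AE_completion_iff)
    have "AE x in lborel. x \<noteq> 0" "AE x in lborel. x \<noteq> (1::real)" by (rule AE_lborel_singleton)+
    with 1 have "AE x in lborel. x \<in> {0..1} \<longrightarrow> (\<lambda>n. g x - h n x) \<longlonglongrightarrow> 0"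
    proof eventually_elim
      case (elim x)
      show ?case using tendsto_diff[OF tendsto_const hl[of x], of "g x"] elim by auto
    qed
    then show "AE x in S1. (\<lambda>n. g x - h n x) \<longlonglongrightarrow> 0" by (simp add: AE_restrict_space_iff)
    have "(cmod (g x - h n x))\<^sup>2 \<le> (2 * M)\<^sup>2" if "x \<in> {0..1}" for n x
      using norm_triangle_ineq4[of "g x" "h n x"] M(2)[of x] hb[OF that, of n] by (intro power_mono) auto
    then show "AE x in S1. (cmod (g x - h n x))\<^sup>2 \<le> (2 * M)\<^sup>2" for n
      by (intro AE_I2) (simp add: space_restrict_space)
    show "integrable S1 (\<lambda>x. (2 * M)\<^sup>2)" by (rule integrable_S1_bounded[where B="(2 * M)\<^sup>2"]) auto
  qed
  from small_of_tendsto_0[OF this e] obtain n where "sqn (\<lambda>x. g x - h n x) < e" by blast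
  moreover have "h n 0 = 0" "h n 1 = 0" by (auto simp: h_def)
  ultimately show ?thesis using hc[of n] unfolding sqn_def by blast
qed

lemma smooth_cis: "smooth (\<lambda>x. k * cis (2 * pi * x))"
proof (rule smooth_coinduct[where S="range (\<lambda>k x. k * cis (2 * pi * x))"])
  have *: "((\<lambda>x. k * cis (2 * pi * x)) has_vector_derivative (k * (of_real (2 * pi) * \<i>)) * cis (2 * pi * x)) (at x)"
    for k :: complex and x :: real
  proof -
    have "((\<lambda>x::real. 2 * pi * x) has_derivative (\<lambda>h. 2 * pi * h)) (at x)"
      by (auto intro!: derivative_eq_intros)
    from has_derivative_cis[OF this]
    have "((\<lambda>x. cis (2 * pi * x)) has_vector_derivative (2 * pi) *\<^sub>R (\<i> * cis (2 * pi * x))) (at x)"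
      by (simp add: has_vector_derivative_def mult_ac)
    from has_vector_derivative_mult_right[OF this, of k] show ?thesis
      by (simp add: scaleR_conv_of_real mult_ac)
  qed
  show "g differentiable (at x)" if "g \<in> range (\<lambda>k x. k * cis (2 * pi * x))" for g x
    using that * by (auto intro: differentiableI_vector)
  show "ddx g \<in> range (\<lambda>k x. k * cis (2 * pi * x))" if "g \<in> range (\<lambda>k x. k * cis (2 * pi * x))" for g
    using that ddx_eqI[OF *] by auto
qed auto

lemma smooth_real_polynomial_cis:
  "real_polynomial_function p \<Longrightarrow> smooth (\<lambda>x. p (cis (2 * pi * x)))"
proof (induction rule: real_polynomial_function.induct)
  case (linear f)
  then show ?case using smooth_bounded_linear[OF linear smooth_cis[of 1]] by simp
qed (auto intro: smooth_intros)

lemma Cinf_polynomial_cis: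
  fixes p :: "complex \<Rightarrow> complex"
  assumes "polynomial_function p" shows "(\<lambda>x. p (cis (2 * pi * x))) \<in> Cinf_S1"
proof -
  have "real_polynomial_function (Re \<circ> p)" "real_polynomial_function (Im \<circ> p)"
    using assms bounded_linear_Re bounded_linear_Im by (auto simp: polynomial_function_def)
  from this[THEN smooth_real_polynomial_cis]
  have "smooth (\<lambda>x. complex_of_real (Re (p (cis (2 * pi * x)))) + \<i> * complex_of_real (Im (p (cis (2 * pi * x)))))"
    by (intro smooth_intros) (auto simp: o_def)
  then have "smooth (\<lambda>x. p (cis (2 * pi * x)))" by (simp add: complex_eq[symmetric])
  moreover have "cis (2 * pi * (x + 1)) = cis (2 * pi * x)" for x
    by (simp add: distrib_left cis_mult[symmetric])
  ultimately show ?thesis by (simp add: Cinf_S1_iff periodic1_def)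
qed

text \<open>Winding the interval onto the unit circle by \<open>c\<close> turns \<open>h\<close>
  into a continuous function \<open>W\<close> on a compact set of the plane. A Stone-Weierstrass
  polynomial for \<open>W\<close>, composed with \<open>c\<close>, is a trigonometric polynomial and
  therefore smooth and periodic.\<close>

lemma continuous_approx_smooth:
  assumes h: "continuous_on UNIV h" "h 0 = (0::complex)" "h 1 = 0" and e: "e > 0"
  shows "\<exists>\<psi>\<in>Cinf_S1. \<forall>x\<in>{0..1}. cmod (h x - \<psi> x) < e"
proof -
  define c where "c x = cis (2 * pi * x)" for x
  define T where "T = c ` {0..1}"
  have cc: "continuous_on A c" for A unfolding c_def by (intro continuous_intros)
  have T: "compact T" unfolding T_def by (intro compact_continuous_image cc) simp
  \<comment> \<open>\<open>c\<close> identifies only the two ends of the interval, and there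
    \<open>h\<close> vanishes.\<close>
  have inj: "h x = h y" if "x \<in> {0..1}" "y \<in> {0..1}" "c x = c y" for x y
  proof -
    have "cos (2 * pi * x) = cos (2 * pi * y)" "sin (2 * pi * x) = sin (2 * pi * y)"
      using that(3) by (auto simp: c_def complex_eq_iff)
    then obtain n where "2 * pi * x = 2 * pi * y + 2 * of_int n * pi"
      using sin_cos_eq_iff[of "2 * pi * x" "2 * pi * y"] by auto
    then have "2 * pi * x = 2 * pi * (y + of_int n)" by (simp add: algebra_simps)
    then have xy: "x = y + of_int n" by simp
    then have "of_int n \<le> (1::real)" "of_int n \<ge> (-1::real)" using that by auto
    then have "n = 0 \<or> n = 1 \<or> n = -1" by linarith
    then show ?thesis using xy that h by auto
  qed
  define W where "W z = h (SOME x. x \<in> {0..1} \<and> c x = z)" for z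
  have W: "W (c x) = h x" if "x \<in> {0..1}" for x
  proof -
    have "(SOME y. y \<in> {0..1} \<and> c y = c x) \<in> {0..1} \<and> c (SOME y. y \<in> {0..1} \<and> c y = c x) = c x"
      by (rule someI[of _ x]) (use that in auto)
    then show ?thesis unfolding W_def using inj that by blast
  qed
  \<comment> \<open>\<open>c\<close> maps closed subsets of the compact interval to closed sets, so
    it is a quotient map and continuity passes from \<open>h\<close> to \<open>W\<close>.\<close>
  have contW: "continuous_on T W"
    unfolding continuous_on_closed_invariant
  proof (intro allI impI)
    fix B :: "complex set" assume B: "closed B"
    have "closed ({0..1} \<inter> h -` B)"
      using continuous_on_subset[OF h(1), of "{0..1}"] B by (intro continuous_closed_preimage) auto
    then have "compact ({0..1} \<inter> ({0..1} \<inter> h -` B))" by (rule compact_Int_closed[OF compact_Icc])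
    then have "compact (c ` ({0..1} \<inter> h -` B))" by (intro compact_continuous_image cc) simp
    then have "closed (c ` ({0..1} \<inter> h -` B))" by (rule compact_imp_closed)
    moreover have "z \<in> c ` ({0..1} \<inter> h -` B) \<longleftrightarrow> z \<in> W -` B" if z: "z \<in> T" for z
    proof -
      obtain x where x: "x \<in> {0..1}" "z = c x" using z unfolding T_def by blast
      have "z \<in> c ` ({0..1} \<inter> h -` B) \<longleftrightarrow> h x \<in> B"
      proof
        assume "z \<in> c ` ({0..1} \<inter> h -` B)"
        then obtain y where "y \<in> {0..1}" "h y \<in> B" "z = c y" by blast
        then show "h x \<in> B" using inj[of y x] x by simp
      qed (use x in blast)
      then show ?thesis using W[OF x(1)] x(2) by simp
    qed
    then have "c ` ({0..1} \<inter> h -` B) \<inter> T = W -` B \<inter> T" by blast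
    ultimately show "\<exists>A. closed A \<and> A \<inter> T = W -` B \<inter> T" by blast
  qed
  from Stone_Weierstrass_polynomial_function[OF T contW e]
  obtain p where p: "polynomial_function p" "\<forall>z\<in>T. cmod (W z - p z) < e" by blast
  have "cmod (h x - p (c x)) < e" if "x \<in> {0..1}" for x
    using p(2)[rule_format, of "c x"] W[OF that] that by (auto simp: T_def)
  moreover have "(\<lambda>x. p (c x)) \<in> Cinf_S1" unfolding c_def by (rule Cinf_polynomial_cis[OF p(1)])
  ultimately show ?thesis by (intro bexI[of _ "\<lambda>x. p (c x)"] ballI)
qed

lemma Cinf_dense:
  assumes u: "u \<in> L2_S1" and e: "e > 0"
  shows "\<exists>\<psi>\<in>Cinf_S1. sqn (\<lambda>x. u x - \<psi> x) < e"
proof -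
  obtain g B where g: "g \<in> L2_S1" "\<And>x. cmod (g x) \<le> B" "sqn (\<lambda>x. u x - g x) < e / 8"
    using L2_truncate[OF u, of "e / 8"] e by auto
  obtain h where h: "continuous_on UNIV h" "h 0 = 0" "h 1 = 0" "(LINT x|S1. (cmod (g x - h x))\<^sup>2) < e / 16"
    using bounded_approx_continuous[OF g(1,2), of "e / 16"] e by auto
  define d where "d = sqrt (e / 16)"
  have d: "d > 0" "d\<^sup>2 = e / 16" using e by (auto simp: d_def)
  obtain \<psi> where \<psi>: "\<psi> \<in> Cinf_S1" "\<And>x. x \<in> {0..1} \<Longrightarrow> cmod (h x - \<psi> x) < d"
    using continuous_approx_smooth[OF h(1-3) d(1)] by auto
  have hm: "h \<in> borel_measurable S1" by (intro measurable_S1 borel_measurable_continuous_onI h)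
  have bh: "\<exists>C. \<forall>x\<in>{0..1}. cmod (h x) \<le> C"
  proof -
    have "compact (h ` {0..1})" by (intro compact_continuous_image continuous_on_subset[OF h(1)]) auto
    then show ?thesis by (meson bounded_iff compact_imp_bounded imageI)
  qed
  \<comment> \<open>\<open>h\<close> is controlled on one period only and may fail to be periodic,
    so it can lie outside \<open>L2_S1\<close>; its integrals are treated by hand.\<close>
  have int1: "integrable S1 (\<lambda>x. (cmod (g x - h x))\<^sup>2)"
  proof -
    obtain C where C: "\<And>x. x \<in> {0..1} \<Longrightarrow> cmod (h x) \<le> C" using bh by blast
    show ?thesis
    proof (rule finite_measure.integrable_const_bound[OF finite_measure_S1, where B="(B + C)\<^sup>2"])
      have "(cmod (g x - h x))\<^sup>2 \<le> (B + C)\<^sup>2" if "x \<in> {0..1}" for x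
        using norm_triangle_ineq4[of "g x" "h x"] g(2)[of x] C[OF that] by (intro power_mono) auto
      then show "AE x in S1. norm ((cmod (g x - h x))\<^sup>2) \<le> (B + C)\<^sup>2"
        by (intro AE_I2) (simp add: space_restrict_space)
    qed (use g(1) hm L2_measurable in auto)
  qed
  have int2: "integrable S1 (\<lambda>x. 2 * d\<^sup>2)" by (rule integrable_S1_bounded[where B="\<bar>2 * d\<^sup>2\<bar>"]) auto
  have g\<psi>: "sqn (\<lambda>x. g x - \<psi> x) \<le> e / 4"
  proof -
    have "sqn (\<lambda>x. g x - \<psi> x) \<le> (LINT x|S1. 2 * (cmod (g x - h x))\<^sup>2 + 2 * d\<^sup>2)"
      unfolding sqn_def
    proof (rule integral_mono_AE)
      show "integrable S1 (\<lambda>x. (cmod (g x - \<psi> x))\<^sup>2)"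
        by (intro L2_sq_integrable L2_diff g Cinf_L2 \<psi>)
      show "integrable S1 (\<lambda>x. 2 * (cmod (g x - h x))\<^sup>2 + 2 * d\<^sup>2)"
        by (rule Bochner_Integration.integrable_add[OF integrable_mult_right[OF int1] int2])
      have "(cmod (g x - \<psi> x))\<^sup>2 \<le> 2 * (cmod (g x - h x))\<^sup>2 + 2 * d\<^sup>2" if "x \<in> {0..1}" for x
      proof -
        have "(cmod (g x - \<psi> x))\<^sup>2 \<le> 2 * (cmod (g x - h x))\<^sup>2 + 2 * (cmod (h x - \<psi> x))\<^sup>2"
          using sum_sq_bound[of "g x - h x" "h x - \<psi> x"] by simp
        also have "(cmod (h x - \<psi> x))\<^sup>2 \<le> d\<^sup>2" using \<psi>(2)[OF that] by (intro power_mono) auto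
        finally show ?thesis by simp
      qed
      then show "AE x in S1. (cmod (g x - \<psi> x))\<^sup>2 \<le> 2 * (cmod (g x - h x))\<^sup>2 + 2 * d\<^sup>2"
        by (intro AE_I2) (simp add: space_restrict_space)
    qed
    also have "\<dots> = 2 * (LINT x|S1. (cmod (g x - h x))\<^sup>2) + 2 * d\<^sup>2"
      by (subst Bochner_Integration.integral_add[OF integrable_mult_right[OF int1] int2]) simp
    also have "\<dots> \<le> e / 4" using h(4) d(2) by simp
    finally show ?thesis .
  qed
  have "sqn (\<lambda>x. u x - \<psi> x) \<le> 2 * sqn (\<lambda>x. u x - g x) + 2 * sqn (\<lambda>x. g x - \<psi> x)"
    by (rule sqn_trans) (use u g \<psi> Cinf_L2 in auto)
  also have "\<dots> < e" using g(3) g\<psi> e by simp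
  finally show ?thesis using \<psi>(1) by blast
qed


section \<open>Weak derivatives on the circle\<close>

lemma integral_ddx:
  fixes \<phi> :: "real \<Rightarrow> complex"
  assumes "\<phi> \<in> Cinf_S1" shows "(LINT x|S1. ddx \<phi> x) = 0"
proof -
  have sm: "smooth \<phi>" and "periodic1 \<phi>" using assms by (auto simp: Cinf_S1_iff)
  have "(LINT x|S1. ddx \<phi> x) = integral\<^sup>L lborel (\<lambda>x. indicator {0..1} x *\<^sub>R ddx \<phi> x)"
    by (simp add: integral_restrict_space)
  also have "\<dots> = \<phi> 1 - \<phi> 0"
    by (rule integral_FTC_atLeastAtMost)
      (auto intro: has_vector_derivative_at_within smooth_vd smooth_continuous smooth_ddx sm)
  also have "\<phi> 1 = \<phi> 0" using \<open>periodic1 \<phi>\<close> unfolding periodic1_def by (metis add_0)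
  finally show ?thesis by simp
qed

text \<open>Membership of \<open>F\<close> in the Sobolev space H^1 of the circle, with
  \<open>h\<close> as its distributional derivative.\<close>

definition weak_deriv :: "(real \<Rightarrow> complex) \<Rightarrow> (real \<Rightarrow> complex) \<Rightarrow> bool" where
  "weak_deriv F h \<longleftrightarrow> F \<in> L2_S1 \<and> h \<in> L2_S1 \<and>
     (\<forall>\<phi>\<in>Cinf_S1. (LINT x|S1. F x * ddx \<phi> x) = - (LINT x|S1. h x * \<phi> x))"

lemma weak_deriv_L2: "weak_deriv F h \<Longrightarrow> F \<in> L2_S1" "weak_deriv F h \<Longrightarrow> h \<in> L2_S1"
  by (auto simp: weak_deriv_def)

lemma weak_deriv_smooth:
  assumes "\<phi> \<in> Cinf_S1" shows "weak_deriv \<phi> (ddx \<phi>)"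
  unfolding weak_deriv_def
proof (intro conjI ballI)
  fix \<psi> :: "real \<Rightarrow> complex" assume \<psi>: "\<psi> \<in> Cinf_S1"
  have "0 = (LINT x|S1. ddx (\<lambda>x. \<phi> x * \<psi> x) x)" using integral_ddx[OF Cinf_mult[OF assms \<psi>]] by simp
  also have "\<dots> = (LINT x|S1. \<phi> x * ddx \<psi> x + ddx \<phi> x * \<psi> x)"
    using assms \<psi> by (subst ddx_mult) (auto simp: Cinf_S1_iff)
  also have "\<dots> = (LINT x|S1. \<phi> x * ddx \<psi> x) + (LINT x|S1. ddx \<phi> x * \<psi> x)"
    by (rule Bochner_Integration.integral_add) (intro L2_prod_integrable Cinf_L2 Cinf_ddx assms \<psi>)+
  finally show "(LINT x|S1. \<phi> x * ddx \<psi> x) = - (LINT x|S1. ddx \<phi> x * \<psi> x)"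
    by (simp add: eq_neg_iff_add_eq_0)
qed (intro Cinf_L2 Cinf_ddx assms)+

lemma weak_deriv_add:
  assumes "weak_deriv F h" "weak_deriv G r" shows "weak_deriv (\<lambda>x. F x + G x) (\<lambda>x. h x + r x)"
  unfolding weak_deriv_def
proof (intro conjI ballI)
  fix \<psi> :: "real \<Rightarrow> complex" assume \<psi>: "\<psi> \<in> Cinf_S1"
  note L = L2_prod_integrable[OF _ Cinf_L2[OF \<psi>]] L2_prod_integrable[OF _ Cinf_L2[OF Cinf_ddx[OF \<psi>]]]
  show "(LINT x|S1. (F x + G x) * ddx \<psi> x) = - (LINT x|S1. (h x + r x) * \<psi> x)"
    using assms \<psi> L by (simp add: weak_deriv_def distrib_right)
qed (use assms in \<open>auto simp: weak_deriv_def intro: L2_add\<close>)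

lemma weak_deriv_mult:
  assumes F: "weak_deriv F h" and s: "s \<in> Cinf_S1"
  shows "weak_deriv (\<lambda>x. s x * F x) (\<lambda>x. ddx s x * F x + s x * h x)"
  unfolding weak_deriv_def
proof (intro conjI ballI)
  fix \<psi> :: "real \<Rightarrow> complex" assume \<psi>: "\<psi> \<in> Cinf_S1"
  have L: "F \<in> L2_S1" "h \<in> L2_S1" using F by (auto simp: weak_deriv_def)
  have "(LINT x|S1. F x * ddx (\<lambda>x. s x * \<psi> x) x) = - (LINT x|S1. h x * (s x * \<psi> x))"
    using F Cinf_mult[OF s \<psi>] by (simp add: weak_deriv_def)
  also have "ddx (\<lambda>x. s x * \<psi> x) = (\<lambda>x. s x * ddx \<psi> x + ddx s x * \<psi> x)"
    using s \<psi> by (intro ddx_mult) (auto simp: Cinf_S1_iff)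
  finally have *: "(LINT x|S1. F x * (s x * ddx \<psi> x + ddx s x * \<psi> x)) = - (LINT x|S1. h x * (s x * \<psi> x))" .
  have i1: "integrable S1 (\<lambda>x. s x * F x * ddx \<psi> x)" "integrable S1 (\<lambda>x. ddx s x * F x * \<psi> x)" "integrable S1 (\<lambda>x. s x * h x * \<psi> x)"
    by (intro L2_prod_integrable L2_Cmult L Cinf_L2 Cinf_ddx s \<psi>)+
  have "(LINT x|S1. F x * (s x * ddx \<psi> x + ddx s x * \<psi> x)) = (LINT x|S1. s x * F x * ddx \<psi> x + ddx s x * F x * \<psi> x)"
    by (rule Bochner_Integration.integral_cong) (auto simp: algebra_simps)
  also have "\<dots> = (LINT x|S1. s x * F x * ddx \<psi> x) + (LINT x|S1. ddx s x * F x * \<psi> x)"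
    by (rule Bochner_Integration.integral_add[OF i1(1,2)])
  finally have "(LINT x|S1. s x * F x * ddx \<psi> x) = - (LINT x|S1. h x * (s x * \<psi> x)) - (LINT x|S1. ddx s x * F x * \<psi> x)"
    using * by (simp add: eq_diff_eq)
  also have "\<dots> = - ((LINT x|S1. ddx s x * F x * \<psi> x) + (LINT x|S1. s x * h x * \<psi> x))"
    by (simp add: mult_ac)
  also have "\<dots> = - (LINT x|S1. (ddx s x * F x + s x * h x) * \<psi> x)"
    by (subst Bochner_Integration.integral_add[OF i1(2,3), symmetric]) (simp add: distrib_right)
  finally show "(LINT x|S1. s x * F x * ddx \<psi> x) = - (LINT x|S1. (ddx s x * F x + s x * h x) * \<psi> x)" .
qed (use F s in \<open>auto simp: weak_deriv_def intro!: L2_add L2_Cmult Cinf_ddx\<close>)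

lemma weak_deriv_cnj:
  assumes "weak_deriv F h" shows "weak_deriv (\<lambda>x. cnj (F x)) (\<lambda>x. cnj (h x))"
  unfolding weak_deriv_def
proof (intro conjI ballI)
  fix \<psi> :: "real \<Rightarrow> complex" assume \<psi>: "\<psi> \<in> Cinf_S1"
  have d: "ddx (\<lambda>x. cnj (\<psi> x)) = (\<lambda>x. cnj (ddx \<psi> x))" using \<psi> by (simp add: ddx_cnj Cinf_S1_iff)
  have "(LINT x|S1. F x * ddx (\<lambda>x. cnj (\<psi> x)) x) = - (LINT x|S1. h x * cnj (\<psi> x))"
    using assms Cinf_cnj[OF \<psi>] by (simp add: weak_deriv_def)
  then have "cnj (LINT x|S1. F x * cnj (ddx \<psi> x)) = cnj (- (LINT x|S1. h x * cnj (\<psi> x)))" unfolding d by simp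
  then have "(LINT x|S1. cnj (F x * cnj (ddx \<psi> x))) = - (LINT x|S1. cnj (h x * cnj (\<psi> x)))"
    by (simp only: Bochner_Integration.integral_cnj complex_cnj_minus)
  then show "(LINT x|S1. cnj (F x) * ddx \<psi> x) = - (LINT x|S1. cnj (h x) * \<psi> x)"
    by simp
qed (use assms in \<open>auto simp: weak_deriv_def intro: L2_cnj\<close>)

lemma weak_deriv_mean: assumes "weak_deriv F h" shows "(LINT x|S1. h x) = 0"
proof -
  have "ddx (\<lambda>x. 1 :: complex) = (\<lambda>x. 0)" by (rule ddx_eqI) auto
  moreover have "(LINT x|S1. F x * ddx (\<lambda>x. 1) x) = - (LINT x|S1. h x * 1)"
    using assms Cinf_const[of 1] unfolding weak_deriv_def by blast
  ultimately show ?thesis by simp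
qed

lemma Cinf_seq:
  assumes "u \<in> L2_S1"
  shows "\<exists>\<psi>. (\<forall>n. \<psi> n \<in> Cinf_S1) \<and> (\<lambda>n. sqn (\<lambda>x. \<psi> n x - u x)) \<longlonglongrightarrow> 0"
proof -
  have "\<forall>n. \<exists>\<psi>\<in>Cinf_S1. sqn (\<lambda>x. u x - \<psi> x) < inverse (real (Suc n))"
    using Cinf_dense[OF assms] by simp
  then obtain \<psi> where \<psi>: "\<And>n. \<psi> n \<in> Cinf_S1" "\<And>n. sqn (\<lambda>x. u x - \<psi> n x) < inverse (real (Suc n))"
    by metis
  have "(\<lambda>n. sqn (\<lambda>x. u x - \<psi> n x)) \<longlonglongrightarrow> 0"
    by (rule tendsto_sandwich[OF _ _ tendsto_const LIMSEQ_inverse_real_of_nat])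
      (use \<psi>(2) in \<open>auto intro!: always_eventually less_imp_le\<close>)
  then show ?thesis using \<psi>(1) by (auto simp: sqn_commute)
qed

text \<open>Density makes \<open>cnj D\<close> itself a limit of test functions.\<close>

lemma L2_orthogonal_zero:
  assumes D: "D \<in> L2_S1" and 0: "\<And>\<psi>. \<psi> \<in> Cinf_S1 \<Longrightarrow> (LINT x|S1. \<psi> x * D x) = 0"
  shows "AE x in S1. D x = 0"
proof -
  obtain \<psi> where \<psi>: "\<And>n. \<psi> n \<in> Cinf_S1" "(\<lambda>n. sqn (\<lambda>x. \<psi> n x - cnj (D x))) \<longlonglongrightarrow> 0"
    using Cinf_seq[OF L2_cnj[OF D]] by auto
  have "(\<lambda>n. LINT x|S1. \<psi> n x * D x) \<longlonglongrightarrow> (LINT x|S1. cnj (D x) * D x)"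
    by (rule L2_pairing_tendsto[OF Cinf_L2[OF \<psi>(1)] L2_cnj[OF D] D \<psi>(2)])
  then have "(LINT x|S1. cnj (D x) * D x) = 0"
    using 0[OF \<psi>(1)] by (simp add: LIMSEQ_const_iff)
  then have "sqn D = 0"
    using sqn_eq_integral[of D] by (simp add: mult.commute)
  then show ?thesis by (rule sqn_zero_AE[OF D])
qed

text \<open>The increment of the primitive over a period is constant because \<open>\<psi>\<close>
  is periodic, and it equals the mean; a vanishing mean is what closes the primitive up on the
  circle.\<close>

lemma smooth_antiderivative:
  fixes \<psi> :: "real \<Rightarrow> complex"
  assumes \<psi>: "\<psi> \<in> Cinf_S1" and 0: "(LINT x|S1. \<psi> x) = 0"
  shows "\<exists>\<phi>\<in>Cinf_S1. ddx \<phi> = \<psi> \<and> \<phi> 0 = 0 \<and> (\<forall>x\<in>{0..1}. \<phi> x = (LINT y|S1. indicator {0..x} y * \<psi> y))"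
proof -
  have sm: "smooth \<psi>" and per: "periodic1 \<psi>" using \<psi> by (auto simp: Cinf_S1_iff)
  define \<phi> where "\<phi> x = (LBINT y=ereal 0..ereal x. \<psi> y)" for x
  have d: "(\<phi> has_vector_derivative \<psi> x) (at x)" for x
  proof -
    define R where "R = \<bar>x\<bar> + 1"
    have "((\<lambda>u. LBINT y=ereal 0..ereal u. \<psi> y) has_vector_derivative \<psi> x) (at x within {-R..R})"
      by (rule interval_integral_FTC2) (use smooth_continuous[OF sm] in \<open>auto simp: R_def\<close>)
    moreover have "x \<in> interior {-R..R}" by (auto simp: R_def)
    ultimately show ?thesis unfolding \<phi>_def[abs_def] by (simp only: at_within_interior)
  qed
  have \<phi>0: "\<phi> 0 = 0" by (simp add: \<phi>_def)
  have val: "(LINT y|S1. indicator {0..x} y * \<psi> y) = \<phi> x" if x: "x \<in> {0..1}" for x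
  proof -
    have "(LINT y|S1. indicator {0..x} y * \<psi> y) = integral\<^sup>L lborel (\<lambda>y. indicator {0..x} y *\<^sub>R \<psi> y)"
      unfolding integral_restrict_space[of "{0..1::real}" lborel, simplified]
      by (rule Bochner_Integration.integral_cong) (use x in \<open>auto simp: indicator_def\<close>)
    also have "\<dots> = \<phi> x - \<phi> 0"
      by (rule integral_FTC_atLeastAtMost)
        (use x in \<open>auto intro: has_vector_derivative_at_within d smooth_continuous sm\<close>)
    finally show ?thesis using \<phi>0 by simp
  qed
  have \<phi>1: "\<phi> 1 = 0"
  proof -
    have "\<phi> 1 = (LINT y|S1. indicator {0..1} y * \<psi> y)" using val[of 1] by simp
    also have "\<dots> = (LINT y|S1. \<psi> y)"
      by (rule Bochner_Integration.integral_cong) (auto simp: space_restrict_space)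
    finally show ?thesis using 0 by simp
  qed
  have "\<exists>c. \<forall>x\<in>UNIV. \<phi> (x + 1) - \<phi> x = c"
  proof (rule has_derivative_zero_constant)
    show "((\<lambda>x. \<phi> (x + 1) - \<phi> x) has_derivative (\<lambda>h. 0)) (at x within UNIV)" for x
    proof -
      have "((\<lambda>x. \<phi> (x + 1)) has_vector_derivative \<psi> (x + 1)) (at x)"
        by (rule has_vector_derivative_at_shift[OF d])
      then have "((\<lambda>x. \<phi> (x + 1) - \<phi> x) has_vector_derivative (\<psi> (x + 1) - \<psi> x)) (at x)"
        by (intro has_vector_derivative_diff d)
      then show ?thesis using per by (simp add: periodic1_def has_vector_derivative_def)
    qed
  qed simp
  then obtain k where k: "\<And>x. \<phi> (x + 1) - \<phi> x = k" by blast
  then have "\<phi> (x + 1) - \<phi> x = \<phi> (0 + 1) - \<phi> 0" for x by (simp only: k)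
  then have "periodic1 \<phi>" using \<phi>0 \<phi>1 by (simp add: periodic1_def)
  moreover have "smooth \<phi>" by (rule smooth_antideriv[OF d sm])
  ultimately have "\<phi> \<in> Cinf_S1" by (simp add: Cinf_S1_iff)
  then show ?thesis using ddx_eqI[OF d] \<phi>0 val by auto
qed

text \<open>The primitive that vanishes at the integers. \<open>frac\<close> makes it periodic for
  any \<open>h\<close>, but it is a weak primitive only if \<open>h\<close> has mean zero.\<close>

definition prim :: "(real \<Rightarrow> complex) \<Rightarrow> real \<Rightarrow> complex" where
  "prim h x = (LINT y|S1. indicator {0..frac x} y * h y)"

lemma indicator_L2: "h \<in> L2_S1 \<Longrightarrow> integrable S1 (\<lambda>y. indicator {0..t} y * h y)"
  for h :: "real \<Rightarrow> complex"
proof (rule Bochner_Integration.integrable_bound[OF L2_integrable])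
  assume h: "h \<in> L2_S1"
  have "(\<lambda>y. indicator {0..t} y :: complex) \<in> borel_measurable S1" by (intro measurable_S1) measurable
  then show "(\<lambda>y. indicator {0..t} y * h y) \<in> borel_measurable S1"
    by (rule borel_measurable_times[OF _ L2_measurable[OF h]])
qed (auto simp: indicator_def)

text \<open>Integration over part of a period maps L2 into the sup norm with norm at most 1. Every
  limit passage for primitives rests on this one-dimensional Sobolev bound.\<close>

lemma prim_diff_bound:
  assumes "h \<in> L2_S1" "k \<in> L2_S1"
  shows "cmod (prim h x - prim k x) \<le> sqrt (sqn (\<lambda>x. h x - k x))"
proof -
  have hk: "(\<lambda>x. h x - k x) \<in> L2_S1" by (intro L2_diff assms)
  have "prim h x - prim k x = (LINT y|S1. indicator {0..frac x} y * (h y - k y))"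
    unfolding prim_def using indicator_L2 assms by (simp add: right_diff_distrib)
  also have "cmod \<dots> \<le> (LINT y|S1. cmod (indicator {0..frac x} y * (h y - k y)))"
    by (rule integral_norm_bound)
  also have "\<dots> \<le> (LINT y|S1. cmod (h y - k y))"
    by (rule integral_mono)
      (use indicator_L2[OF hk] L2_integrable[OF hk] in \<open>auto simp: indicator_def intro: integrable_norm\<close>)
  also have "\<dots> \<le> sqrt (sqn (\<lambda>x. h x - k x))" by (rule integral_L1_bound[OF hk])
  finally show ?thesis .
qed

lemma prim_smooth:
  assumes "\<psi> \<in> Cinf_S1" "(LINT x|S1. \<psi> x) = 0"
  shows "prim \<psi> \<in> Cinf_S1" "ddx (prim \<psi>) = \<psi>"
proof -
  obtain \<phi> where \<phi>: "\<phi> \<in> Cinf_S1" "ddx \<phi> = \<psi>" "\<forall>x\<in>{0..1}. \<phi> x = (LINT y|S1. indicator {0..x} y * \<psi> y)"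
    using smooth_antiderivative[OF assms] by blast
  have "prim \<psi> x = \<phi> x" for x
  proof -
    have "frac x \<in> {0..1}" by (auto intro: less_imp_le frac_lt_1)
    then have "prim \<psi> x = \<phi> (frac x)" using \<phi>(3) by (simp add: prim_def)
    also have "\<dots> = \<phi> x" using \<phi>(1) by (intro periodic1_frac) (simp add: Cinf_S1_iff)
    finally show ?thesis .
  qed
  then have "prim \<psi> = \<phi>" by blast
  then show "prim \<psi> \<in> Cinf_S1" "ddx (prim \<psi>) = \<psi>" using \<phi> by auto
qed

text \<open>Its mean \<open>m\<close> is subtracted from a smooth approximant. As \<open>u\<close>
  has mean zero, \<open>|m|\<close> is at most the distance to \<open>u\<close>, so the correction
  costs a factor 4 in the squared distance, whence \<open>e / 4\<close>.\<close>

lemma Cinf_mean_zero_dense: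
  assumes u: "u \<in> L2_S1" and 0: "(LINT x|S1. u x) = 0" and e: "e > 0"
  shows "\<exists>\<psi>\<in>Cinf_S1. (LINT x|S1. \<psi> x) = 0 \<and> sqn (\<lambda>x. u x - \<psi> x) < e"
proof -
  obtain \<psi> where \<psi>: "\<psi> \<in> Cinf_S1" "sqn (\<lambda>x. u x - \<psi> x) < e / 4"
    using Cinf_dense[OF u, of "e / 4"] e by auto
  define m where "m = (LINT x|S1. \<psi> x)"
  have \<psi>L: "\<psi> \<in> L2_S1" by (rule Cinf_L2[OF \<psi>(1)])
  have "m = - (LINT x|S1. (u x - \<psi> x) * 1)"
    using 0 L2_integrable[OF u] L2_integrable[OF \<psi>L] by (simp add: m_def)
  then have "cmod m = cmod (LINT x|S1. (u x - \<psi> x) * 1)" by simp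
  then have "cmod m \<le> sqrt (sqn (\<lambda>x. u x - \<psi> x))"
    using Cauchy_Schwarz[OF L2_diff[OF u \<psi>L] L2_const[of 1]] by simp
  then have "(cmod m)\<^sup>2 \<le> (sqrt (sqn (\<lambda>x. u x - \<psi> x)))\<^sup>2" by (intro power_mono) auto
  then have m: "(cmod m)\<^sup>2 \<le> sqn (\<lambda>x. u x - \<psi> x)" by simp
  have "sqn (\<lambda>x. u x - (\<psi> x - m)) = sqn (\<lambda>x. (u x - \<psi> x) + m)" by (simp add: algebra_simps)
  also have "\<dots> \<le> 2 * sqn (\<lambda>x. u x - \<psi> x) + 2 * (cmod m)\<^sup>2"
    using sqn_add[OF L2_diff[OF u \<psi>L] L2_const[of m]] by simp
  also have "\<dots> < e" using m \<psi>(2) by simp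
  finally have "sqn (\<lambda>x. u x - (\<psi> x - m)) < e" .
  moreover have "(LINT x|S1. \<psi> x - m) = 0"
    using L2_integrable[OF \<psi>L] L2_integrable[OF L2_const[of m]] by (simp add: m_def)
  moreover have "(\<lambda>x. \<psi> x - m) \<in> Cinf_S1" by (intro Cinf_intros \<psi>)
  ultimately show ?thesis by (intro bexI[of _ "\<lambda>x. \<psi> x - m"]) auto
qed

lemma Cinf_mean_zero_seq:
  assumes "u \<in> L2_S1" "(LINT x|S1. u x) = 0"
  shows "\<exists>\<psi>. (\<forall>n. \<psi> n \<in> Cinf_S1 \<and> (LINT x|S1. \<psi> n x) = 0) \<and> (\<lambda>n. sqn (\<lambda>x. \<psi> n x - u x)) \<longlonglongrightarrow> 0"
proof -
  have "\<forall>n. \<exists>\<psi>. \<psi> \<in> Cinf_S1 \<and> (LINT x|S1. \<psi> x) = 0 \<and> sqn (\<lambda>x. u x - \<psi> x) < inverse (real (Suc n))"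
    using Cinf_mean_zero_dense[OF assms] by (simp add: Bex_def)
  from choice[OF this] obtain \<psi> where \<psi>: "\<And>n. \<psi> n \<in> Cinf_S1" "\<And>n. (LINT x|S1. \<psi> n x) = 0"
    "\<And>n. sqn (\<lambda>x. u x - \<psi> n x) < inverse (real (Suc n))"
    by auto
  have "(\<lambda>n. sqn (\<lambda>x. u x - \<psi> n x)) \<longlonglongrightarrow> 0"
    by (rule tendsto_sandwich[OF _ _ tendsto_const LIMSEQ_inverse_real_of_nat])
      (use \<psi>(3) in \<open>auto intro!: always_eventually less_imp_le\<close>)
  then show ?thesis using \<psi>(1,2) by (auto simp: sqn_commute)
qed

lemma prim_weak_deriv:
  assumes h: "h \<in> L2_S1" and 0: "(LINT x|S1. h x) = 0"
  shows "weak_deriv (prim h) h"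
proof -
  obtain \<psi> where \<psi>: "\<And>n. \<psi> n \<in> Cinf_S1" "\<And>n. (LINT x|S1. \<psi> n x) = 0"
    "(\<lambda>n. sqn (\<lambda>x. \<psi> n x - h x)) \<longlonglongrightarrow> 0"
    using Cinf_mean_zero_seq[OF assms] by auto
  have sq: "(\<lambda>n. sqrt (sqn (\<lambda>x. \<psi> n x - h x))) \<longlonglongrightarrow> 0"
    using tendsto_real_sqrt[OF \<psi>(3)] by simp
  have b: "cmod (prim (\<psi> n) x - prim h x) \<le> sqrt (sqn (\<lambda>x. \<psi> n x - h x))" for n x
    by (rule prim_diff_bound[OF Cinf_L2[OF \<psi>(1)] h])
  have pt: "(\<lambda>n. prim (\<psi> n) x) \<longlonglongrightarrow> prim h x" for x
    by (rule LIM_zero_cancel[OF Lim_null_comparison[OF always_eventually[OF allI[OF b]] sq]])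
  \<comment> \<open>Measurability of the primitive is inherited from its smooth
    approximants.\<close>
  have m: "prim h \<in> borel_measurable borel"
    by (rule borel_measurable_LIMSEQ_metric[OF Cinf_measurable[OF prim_smooth(1)[OF \<psi>(1,2)]] pt])
  have per: "periodic1 (prim h)"
    by (simp add: periodic1_def prim_def frac_def)
  have bd: "cmod (prim h x) \<le> sqrt (sqn h)" for x
    using prim_diff_bound[OF h L2_const[of 0], of x] by (simp add: prim_def)
  have L: "prim h \<in> L2_S1" by (rule L2_bounded[OF per m bd])
  have pL: "prim (\<psi> n) \<in> L2_S1" for n by (rule Cinf_L2[OF prim_smooth(1)[OF \<psi>(1,2)]])
  have "sqn (\<lambda>x. prim (\<psi> n) x - prim h x) \<le> sqn (\<lambda>x. \<psi> n x - h x)" for n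
    using sqn_bound[OF L2_diff[OF pL L], where B="sqrt (sqn (\<lambda>x. \<psi> n x - h x))"] b by simp
  then have pl: "(\<lambda>n. sqn (\<lambda>x. prim (\<psi> n) x - prim h x)) \<longlonglongrightarrow> 0"
    by (intro tendsto_sandwich[OF _ _ tendsto_const \<psi>(3)] always_eventually) auto
  show ?thesis unfolding weak_deriv_def
  proof (intro conjI ballI L h)
    fix \<theta> :: "real \<Rightarrow> complex" assume \<theta>: "\<theta> \<in> Cinf_S1"
    have "(\<lambda>n. LINT x|S1. prim (\<psi> n) x * ddx \<theta> x) \<longlonglongrightarrow> (LINT x|S1. prim h x * ddx \<theta> x)"
      by (rule L2_pairing_tendsto[OF pL L Cinf_L2[OF Cinf_ddx[OF \<theta>]] pl])
    moreover have "(\<lambda>n. - (LINT x|S1. \<psi> n x * \<theta> x)) \<longlonglongrightarrow> - (LINT x|S1. h x * \<theta> x)"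
      by (intro tendsto_minus L2_pairing_tendsto[OF Cinf_L2[OF \<psi>(1)] h Cinf_L2[OF \<theta>] \<psi>(3)])
    moreover have "(LINT x|S1. prim (\<psi> n) x * ddx \<theta> x) = - (LINT x|S1. \<psi> n x * \<theta> x)" for n
      using weak_deriv_smooth[OF prim_smooth(1)[OF \<psi>(1,2)]] \<theta> unfolding prim_smooth(2)[OF \<psi>(1,2)]
      by (simp add: weak_deriv_def)
    ultimately show "(LINT x|S1. prim h x * ddx \<theta> x) = - (LINT x|S1. h x * \<theta> x)"
      using LIMSEQ_unique by simp
  qed
qed

text \<open>The du Bois-Reymond lemma. A smooth function minus its mean is a derivative, so
  \<open>D\<close> annihilates it; and \<open>D - K\<close> annihilates constants, since
  \<open>K\<close> is the mean of \<open>D\<close>.\<close>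

lemma weak_deriv_zero:
  assumes D: "D \<in> L2_S1" and 0: "\<And>\<phi>. \<phi> \<in> Cinf_S1 \<Longrightarrow> (LINT x|S1. D x * ddx \<phi> x) = 0"
  shows "\<exists>K. AE x in S1. D x = K"
proof -
  define K where "K = (LINT x|S1. D x)"
  have D': "(\<lambda>x. D x - K) \<in> L2_S1" by (intro L2_diff D L2_const)
  have D'0: "(LINT x|S1. D x - K) = 0"
    using L2_integrable[OF D] L2_integrable[OF L2_const[of K]] by (simp add: K_def)
  have "AE x in S1. D x - K = 0"
  proof (rule L2_orthogonal_zero[OF D'])
    fix \<psi> :: "real \<Rightarrow> complex" assume \<psi>: "\<psi> \<in> Cinf_S1"
    define m where "m = (LINT x|S1. \<psi> x)"
    have \<psi>L: "\<psi> \<in> L2_S1" by (rule Cinf_L2[OF \<psi>])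
    have \<psi>': "(\<lambda>x. \<psi> x - m) \<in> Cinf_S1" by (intro Cinf_intros \<psi>)
    have m0: "(LINT x|S1. \<psi> x - m) = 0"
      using L2_integrable[OF \<psi>L] L2_integrable[OF L2_const[of m]] by (simp add: m_def)
    have "(LINT x|S1. \<psi> x * (D x - K)) = (LINT x|S1. D x * (\<psi> x - m) + (m * (D x - K) - K * (\<psi> x - m)))"
      by (rule Bochner_Integration.integral_cong) (auto simp: algebra_simps)
    also have "\<dots> = (LINT x|S1. D x * (\<psi> x - m)) + ((LINT x|S1. m * (D x - K)) - (LINT x|S1. K * (\<psi> x - m)))"
      using L2_prod_integrable[OF D Cinf_L2[OF \<psi>']] L2_integrable[OF L2_cmult[OF D', of m]]
        L2_integrable[OF L2_cmult[OF Cinf_L2[OF \<psi>'], of K]]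
      by (subst Bochner_Integration.integral_add) (auto intro: Bochner_Integration.integral_diff)
    also have "\<dots> = (LINT x|S1. D x * (\<psi> x - m))" unfolding integral_mult_right_zero D'0 m0 by simp
    also have "\<dots> = 0" using 0[OF prim_smooth(1)[OF \<psi>' m0]] unfolding prim_smooth(2)[OF \<psi>' m0] .
    finally show "(LINT x|S1. \<psi> x * (D x - K)) = 0" .
  qed
  then have "AE x in S1. D x = K" by eventually_elim simp
  then show ?thesis by blast
qed

lemma weak_deriv_prim:
  assumes "weak_deriv F h" shows "\<exists>K. AE x in S1. F x = prim h x + K"
proof -
  have p: "weak_deriv (prim h) h"
    by (rule prim_weak_deriv[OF weak_deriv_L2(2)[OF assms] weak_deriv_mean[OF assms]])
  have "\<exists>K. AE x in S1. F x - prim h x = K"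
  proof (rule weak_deriv_zero)
    show "(\<lambda>x. F x - prim h x) \<in> L2_S1" by (intro L2_diff weak_deriv_L2(1)[OF assms] weak_deriv_L2(1)[OF p])
    fix \<phi> :: "real \<Rightarrow> complex" assume \<phi>: "\<phi> \<in> Cinf_S1"
    have "(LINT x|S1. (F x - prim h x) * ddx \<phi> x) = (LINT x|S1. F x * ddx \<phi> x) - (LINT x|S1. prim h x * ddx \<phi> x)"
      using L2_prod_integrable[OF weak_deriv_L2(1)[OF assms] Cinf_L2[OF Cinf_ddx[OF \<phi>]]]
        L2_prod_integrable[OF weak_deriv_L2(1)[OF p] Cinf_L2[OF Cinf_ddx[OF \<phi>]]]
      by (simp add: left_diff_distrib)
    then show "(LINT x|S1. (F x - prim h x) * ddx \<phi> x) = 0"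
      using assms p \<phi> by (simp add: weak_deriv_def)
  qed
  then obtain K where "AE x in S1. F x - prim h x = K" by blast
  then have "AE x in S1. F x = prim h x + K" by eventually_elim (simp add: algebra_simps)
  then show ?thesis by blast
qed

text \<open>Approximation in the H^1 norm comes from the derivative alone: an approximant of
  \<open>h\<close> is integrated, and the constant \<open>K\<close> that separates \<open>F\<close>
  from \<open>prim h\<close> is added.\<close>

lemma weak_deriv_approx:
  assumes F: "weak_deriv F h" and \<psi>: "\<psi> \<in> Cinf_S1" "(LINT x|S1. \<psi> x) = 0"
  shows "\<exists>\<phi>\<in>Cinf_S1. ddx \<phi> = \<psi> \<and> sqn (\<lambda>x. F x - \<phi> x) \<le> sqn (\<lambda>x. h x - \<psi> x)"
proof -
  obtain K where K: "AE x in S1. F x = prim h x + K" using weak_deriv_prim[OF F] by blast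
  define \<phi> where "\<phi> x = prim \<psi> x + K" for x
  have \<phi>: "\<phi> \<in> Cinf_S1" unfolding \<phi>_def by (intro Cinf_intros prim_smooth[OF \<psi>])
  have "ddx \<phi> = (\<lambda>x. ddx (prim \<psi>) x + ddx (\<lambda>x. K) x)"
    unfolding \<phi>_def using prim_smooth[OF \<psi>] by (intro ddx_add) (auto simp: Cinf_S1_iff)
  also have "ddx (\<lambda>x. K) = (\<lambda>x. 0)" by (rule ddx_eqI) auto
  finally have d: "ddx \<phi> = \<psi>" using prim_smooth[OF \<psi>] by simp
  have "sqn (\<lambda>x. F x - \<phi> x) \<le> (sqrt (sqn (\<lambda>x. h x - \<psi> x)))\<^sup>2"
  proof (rule sqn_bound)
    show "AE x in S1. cmod (F x - \<phi> x) \<le> sqrt (sqn (\<lambda>x. h x - \<psi> x))"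
      using K
    proof eventually_elim
      case (elim x)
      then show ?case using prim_diff_bound[OF weak_deriv_L2(2)[OF F] Cinf_L2[OF \<psi>(1)], of x] by (simp add: \<phi>_def)
    qed
  qed (auto intro: L2_diff weak_deriv_L2(1)[OF F] Cinf_L2 \<phi>)
  then show ?thesis using \<phi> d by auto
qed

text \<open>For smooth \<open>G\<close> this is the definition. Both sides are continuous under the
  simultaneous approximation of \<open>G\<close> and \<open>r\<close> provided by
  \<open>weak_deriv_approx\<close>.\<close>

lemma weak_deriv_parts:
  assumes F: "weak_deriv F h" and G: "weak_deriv G r"
  shows "(LINT x|S1. F x * r x) = - (LINT x|S1. h x * G x)"
proof -
  note L = weak_deriv_L2[OF F] weak_deriv_L2[OF G]
  obtain \<psi> where \<psi>: "\<And>n. \<psi> n \<in> Cinf_S1" "\<And>n. (LINT x|S1. \<psi> n x) = 0"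
    "(\<lambda>n. sqn (\<lambda>x. \<psi> n x - r x)) \<longlonglongrightarrow> 0"
    using Cinf_mean_zero_seq[OF L(4) weak_deriv_mean[OF G]] by auto
  have "\<forall>n. \<exists>\<phi>. \<phi> \<in> Cinf_S1 \<and> ddx \<phi> = \<psi> n \<and> sqn (\<lambda>x. G x - \<phi> x) \<le> sqn (\<lambda>x. r x - \<psi> n x)"
    using weak_deriv_approx[OF G \<psi>(1,2)] by (simp add: Bex_def)
  from choice[OF this] obtain \<phi> where \<phi>: "\<And>n. \<phi> n \<in> Cinf_S1" "\<And>n. ddx (\<phi> n) = \<psi> n"
    "\<And>n. sqn (\<lambda>x. \<phi> n x - G x) \<le> sqn (\<lambda>x. \<psi> n x - r x)" by (auto simp: sqn_commute)
  have \<phi>l: "(\<lambda>n. sqn (\<lambda>x. \<phi> n x - G x)) \<longlonglongrightarrow> 0"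
    by (intro tendsto_sandwich[OF _ _ tendsto_const \<psi>(3)] always_eventually) (auto simp: \<phi>(3))
  have "(\<lambda>n. LINT x|S1. \<psi> n x * F x) \<longlonglongrightarrow> (LINT x|S1. r x * F x)"
    by (rule L2_pairing_tendsto[OF Cinf_L2[OF \<psi>(1)] L(4) L(1) \<psi>(3)])
  moreover have "(\<lambda>n. - (LINT x|S1. \<phi> n x * h x)) \<longlonglongrightarrow> - (LINT x|S1. G x * h x)"
    by (intro tendsto_minus L2_pairing_tendsto[OF Cinf_L2[OF \<phi>(1)] L(3) L(2) \<phi>l])
  moreover have "(LINT x|S1. \<psi> n x * F x) = - (LINT x|S1. \<phi> n x * h x)" for n
    using F \<phi>(1)[of n] unfolding weak_deriv_def \<phi>(2)[of n, symmetric] by (simp add: mult.commute)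
  ultimately have "(LINT x|S1. r x * F x) = - (LINT x|S1. G x * h x)"
    using LIMSEQ_unique by simp
  then show ?thesis by (simp add: mult.commute)
qed

section \<open>The operator and its formal adjoint\<close>

text \<open>The transpose of \<open>P\<close> for the bilinear pairing, i.e. the operator with complex conjugate coefficients.\<close>

definition opQ :: "(real \<Rightarrow> real) \<Rightarrow> (real \<Rightarrow> real) \<Rightarrow> (real \<Rightarrow> real) \<Rightarrow> (real \<Rightarrow> complex) \<Rightarrow> real \<Rightarrow> complex" where
  "opQ a b c \<phi> x = of_real (a x) * ddx (ddx \<phi>) x + of_real (ddx a x) * ddx \<phi> x
     + \<i> * of_real (b x) * ddx \<phi> x + \<i> / 2 * of_real (ddx b x) * \<phi> x + of_real (c x) * \<phi> x"

locale circle_operator =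
  fixes a b c :: "real \<Rightarrow> real"
  assumes a: "a \<in> Cinf_S1" and b: "b \<in> Cinf_S1" and c: "c \<in> Cinf_S1"
begin

lemma smooth_coeffs: "smooth a" "smooth b" "smooth c" "smooth (ddx a)" "smooth (ddx b)"
  using a b c by (auto simp: Cinf_S1_iff smooth_ddx)

lemma op_P_eq:
  assumes "\<phi> \<in> Cinf_S1"
  shows "op_P a b c \<phi> x = of_real (a x) * ddx (ddx \<phi>) x + of_real (ddx a x) * ddx \<phi> x
     - \<i> * of_real (b x) * ddx \<phi> x - \<i> / 2 * of_real (ddx b x) * \<phi> x + of_real (c x) * \<phi> x"
proof -
  have "ddx (\<lambda>y. of_real (a y) * ddx \<phi> y) = (\<lambda>x. of_real (a x) * ddx (ddx \<phi>) x + of_real (ddx a x) * ddx \<phi> x)"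
    using assms smooth_coeffs by (subst ddx_mult) (auto simp: Cinf_S1_iff smooth_of_real smooth_ddx ddx_of_real)
  then show ?thesis by (simp add: op_P_def)
qed

lemma op_P_Cinf: assumes "\<phi> \<in> Cinf_S1" shows "op_P a b c \<phi> \<in> Cinf_S1"
proof -
  have "op_P a b c \<phi> = (\<lambda>x. of_real (a x) * ddx (ddx \<phi>) x + of_real (ddx a x) * ddx \<phi> x
     - \<i> * of_real (b x) * ddx \<phi> x - \<i> / 2 * of_real (ddx b x) * \<phi> x + of_real (c x) * \<phi> x)"
    using op_P_eq[OF assms] by blast
  also have "\<dots> \<in> Cinf_S1" by (intro Cinf_intros a b c assms)
  finally show ?thesis .
qed

lemma opQ_Cinf: assumes "\<phi> \<in> Cinf_S1" shows "opQ a b c \<phi> \<in> Cinf_S1"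
proof -
  have "opQ a b c \<phi> = (\<lambda>x. of_real (a x) * ddx (ddx \<phi>) x + of_real (ddx a x) * ddx \<phi> x
     + \<i> * of_real (b x) * ddx \<phi> x + \<i> / 2 * of_real (ddx b x) * \<phi> x + of_real (c x) * \<phi> x)"
    unfolding opQ_def[abs_def] ..
  also have "\<dots> \<in> Cinf_S1" by (intro Cinf_intros a b c assms)
  finally show ?thesis .
qed

lemma opQ_cnj: assumes "\<phi> \<in> Cinf_S1" shows "opQ a b c (\<lambda>x. cnj (\<phi> x)) x = cnj (op_P a b c \<phi> x)"
proof -
  have "smooth \<phi>" using assms by (simp add: Cinf_S1_iff)
  then have "ddx (\<lambda>x. cnj (\<phi> x)) = (\<lambda>x. cnj (ddx \<phi> x))" "ddx (\<lambda>x. cnj (ddx \<phi> x)) = (\<lambda>x. cnj (ddx (ddx \<phi>) x))"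
    by (auto intro!: ddx_cnj smooth_ddx)
  then show ?thesis by (simp add: opQ_def op_P_eq[OF assms])
qed

lemma symmetric_smooth:
  assumes f: "f \<in> Cinf_S1" and \<phi>: "\<phi> \<in> Cinf_S1"
  shows "(LINT x|S1. op_P a b c f x * \<phi> x) = (LINT x|S1. f x * opQ a b c \<phi> x)"
proof -
  \<comment> \<open>The boundary form of \<open>P\<close>: its derivative is the difference of the
    two integrands, and it is periodic, so nothing is left after integration.\<close>
  define W where "W x = of_real (a x) * (ddx f x * \<phi> x - f x * ddx \<phi> x) - \<i> * of_real (b x) * (f x * \<phi> x)" for x
  have W: "W \<in> Cinf_S1" unfolding W_def by (intro Cinf_intros a b c f \<phi>)
  have s: "smooth f" "smooth \<phi>" using f \<phi> by (auto simp: Cinf_S1_iff)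
  have "ddx W x = op_P a b c f x * \<phi> x - f x * opQ a b c \<phi> x" for x
  proof (rule ddx_eq)
    have d: "(f has_vector_derivative ddx f x) (at x)" "(ddx f has_vector_derivative ddx (ddx f) x) (at x)"
      "(\<phi> has_vector_derivative ddx \<phi> x) (at x)" "(ddx \<phi> has_vector_derivative ddx (ddx \<phi>) x) (at x)"
      "((\<lambda>x. complex_of_real (a x)) has_vector_derivative of_real (ddx a x)) (at x)"
      "((\<lambda>x. complex_of_real (b x)) has_vector_derivative of_real (ddx b x)) (at x)"
      by (intro smooth_vd smooth_ddx s has_vector_derivative_of_real smooth_DERIV smooth_coeffs)+
    have "(W has_vector_derivative
        of_real (a x) * ((ddx f x * ddx \<phi> x + ddx (ddx f) x * \<phi> x) - (f x * ddx (ddx \<phi>) x + ddx f x * ddx \<phi> x))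
        + of_real (ddx a x) * (ddx f x * \<phi> x - f x * ddx \<phi> x)
        - (\<i> * of_real (b x) * (f x * ddx \<phi> x + ddx f x * \<phi> x) + (\<i> * of_real (ddx b x)) * (f x * \<phi> x))) (at x)"
      unfolding W_def by (intro has_vector_derivative_diff has_vector_derivative_mult has_vector_derivative_mult_right d)
    then show "(W has_vector_derivative op_P a b c f x * \<phi> x - f x * opQ a b c \<phi> x) (at x)"
      by (rule has_vector_derivative_eq_rhs) (simp add: op_P_eq[OF f] opQ_def algebra_simps)
  qed
  then have "(LINT x|S1. op_P a b c f x * \<phi> x - f x * opQ a b c \<phi> x) = 0"
    using integral_ddx[OF W] by simp
  moreover have "integrable S1 (\<lambda>x. op_P a b c f x * \<phi> x)" "integrable S1 (\<lambda>x. f x * opQ a b c \<phi> x)"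
    by (intro L2_prod_integrable Cinf_L2 op_P_Cinf opQ_Cinf f \<phi>)+
  ultimately show ?thesis by simp
qed

lemma distr_P_eq:
  assumes u: "u \<in> L2_S1" and \<phi>: "\<phi> \<in> Cinf_S1"
  shows "distr_P a b c (distr_of u) \<phi> = (LINT x|S1. u x * opQ a b c \<phi> x)"
proof -
  have s: "smooth \<phi>" using \<phi> by (auto simp: Cinf_S1_iff)
  define g1 where "g1 x = of_real (a x) * ddx (ddx \<phi>) x + of_real (ddx a x) * ddx \<phi> x" for x
  define g2 where "g2 x = of_real (b x) * ddx \<phi> x + of_real (ddx b x) * \<phi> x" for x
  have e1: "ddx (\<lambda>y. of_real (a y) * ddx \<phi> y) = g1"
    unfolding g1_def using s smooth_coeffs by (subst ddx_mult) (auto simp: smooth_of_real smooth_ddx ddx_of_real)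
  have e2: "ddx (\<lambda>y. of_real (b y) * \<phi> y) = g2"
    unfolding g2_def using s smooth_coeffs by (subst ddx_mult) (auto simp: smooth_of_real smooth_ddx ddx_of_real)
  have C: "g1 \<in> Cinf_S1" "g2 \<in> Cinf_S1" "(\<lambda>x. of_real (ddx b x) * \<phi> x) \<in> Cinf_S1" "(\<lambda>x. of_real (c x) * \<phi> x) \<in> Cinf_S1"
    unfolding g1_def g2_def by (intro Cinf_intros a b c \<phi>)+
  note I = L2_prod_integrable[OF u Cinf_L2]
  have "distr_P a b c (distr_of u) \<phi> = (LINT x|S1. u x * g1 x) + \<i> * (LINT x|S1. u x * g2 x)
     - \<i> / 2 * (LINT x|S1. u x * (of_real (ddx b x) * \<phi> x)) + (LINT x|S1. u x * (of_real (c x) * \<phi> x))"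
    by (simp add: distr_P_def distr_ddx_def distr_mult_def distr_of_def set_integral_S1 e1 e2)
  also have "\<dots> = (LINT x|S1. u x * g1 x + \<i> * (u x * g2 x) - \<i> / 2 * (u x * (of_real (ddx b x) * \<phi> x)) + u x * (of_real (c x) * \<phi> x))"
    using I[OF C(1)] I[OF C(2)] I[OF C(3)] I[OF C(4)] by simp
  also have "\<dots> = (LINT x|S1. u x * opQ a b c \<phi> x)"
    by (rule Bochner_Integration.integral_cong) (auto simp: opQ_def g1_def g2_def algebra_simps)
  finally show ?thesis .
qed

lemma adj_iff:
  "(u, v) \<in> graph_P_adj a b c \<longleftrightarrow> u \<in> L2_S1 \<and> v \<in> L2_S1 \<and>
     (\<forall>\<phi>\<in>Cinf_S1. (LINT x|S1. u x * opQ a b c \<phi> x) = (LINT x|S1. v x * \<phi> x))"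
  using distr_P_eq by (auto simp: graph_P_adj_def distr_of_def set_integral_S1)

section \<open>Closure of the graph and domain of the adjoint\<close>

lemma closure_seq:
  assumes "(u, v) \<in> L2_graph_closure (graph_P a b c)"
  obtains g where "\<And>n. g n \<in> Cinf_S1" "(\<lambda>n. sqn (\<lambda>x. g n x - u x)) \<longlonglongrightarrow> 0"
    "(\<lambda>n. sqn (\<lambda>x. op_P a b c (g n) x - v x)) \<longlonglongrightarrow> 0"
proof -
  obtain g h where gh: "\<And>n. (g n, h n) \<in> graph_P a b c" "(\<lambda>n. L2_dist (g n) u) \<longlonglongrightarrow> 0" "(\<lambda>n. L2_dist (h n) v) \<longlonglongrightarrow> 0"
    using assms by (auto simp: L2_graph_closure_def)
  have g: "g n \<in> Cinf_S1" "h n = op_P a b c (g n)" for n using gh(1)[of n] by (auto simp: graph_P_def)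
  have "(\<lambda>n. (L2_dist (g n) u)\<^sup>2) \<longlonglongrightarrow> 0\<^sup>2" "(\<lambda>n. (L2_dist (h n) v)\<^sup>2) \<longlonglongrightarrow> 0\<^sup>2"
    by (intro tendsto_power gh)+
  then show ?thesis using that[of g] g by (simp add: L2_dist_sqn)
qed

lemma closure_L2:
  assumes "(u, v) \<in> L2_graph_closure (graph_P a b c)" shows "u \<in> L2_S1" "v \<in> L2_S1"
  using assms by (auto simp: L2_graph_closure_def)

lemma closureI:
  assumes u: "u \<in> L2_S1" and v: "v \<in> L2_S1"
    and ex: "\<And>e. e > 0 \<Longrightarrow> \<exists>\<phi>\<in>Cinf_S1. sqn (\<lambda>x. \<phi> x - u x) < e \<and> sqn (\<lambda>x. op_P a b c \<phi> x - v x) < e"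
  shows "(u, v) \<in> L2_graph_closure (graph_P a b c)"
proof -
  have "\<forall>n. \<exists>\<phi>. \<phi> \<in> Cinf_S1 \<and> sqn (\<lambda>x. \<phi> x - u x) < inverse (real (Suc n)) \<and> sqn (\<lambda>x. op_P a b c \<phi> x - v x) < inverse (real (Suc n))"
    using ex by (simp add: Bex_def)
  from choice[OF this] obtain g where g: "\<And>n. g n \<in> Cinf_S1" "\<And>n. sqn (\<lambda>x. g n x - u x) < inverse (real (Suc n))"
    "\<And>n. sqn (\<lambda>x. op_P a b c (g n) x - v x) < inverse (real (Suc n))" by auto
  have l: "(\<lambda>n. sqn (\<lambda>x. g n x - u x)) \<longlonglongrightarrow> 0" "(\<lambda>n. sqn (\<lambda>x. op_P a b c (g n) x - v x)) \<longlonglongrightarrow> 0"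
    by (rule tendsto_sandwich[OF _ _ tendsto_const LIMSEQ_inverse_real_of_nat];
        use g in \<open>auto intro!: always_eventually less_imp_le\<close>)+
  show ?thesis unfolding L2_graph_closure_def mem_Collect_eq case_prod_conv
  proof (rule conjI[OF u conjI[OF v]], rule exI[of _ g], rule exI[of _ "\<lambda>n. op_P a b c (g n)"], intro conjI allI)
    show "(g n, op_P a b c (g n)) \<in> graph_P a b c" for n using g(1) by (auto simp: graph_P_def)
    show "(\<lambda>n. L2_dist (g n) u) \<longlonglongrightarrow> 0" using tendsto_real_sqrt[OF l(1)] by (simp add: L2_dist_sqn)
    show "(\<lambda>n. L2_dist (op_P a b c (g n)) v) \<longlonglongrightarrow> 0" using tendsto_real_sqrt[OF l(2)] by (simp add: L2_dist_sqn)
  qed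
qed

lemma closure_subset_adj: "L2_graph_closure (graph_P a b c) \<subseteq> graph_P_adj a b c"
proof (rule subrelI)
  fix u v assume uv: "(u, v) \<in> L2_graph_closure (graph_P a b c)"
  obtain g where g: "\<And>n. g n \<in> Cinf_S1" "(\<lambda>n. sqn (\<lambda>x. g n x - u x)) \<longlonglongrightarrow> 0"
    "(\<lambda>n. sqn (\<lambda>x. op_P a b c (g n) x - v x)) \<longlonglongrightarrow> 0"
    using closure_seq[OF uv] by blast
  note L = closure_L2[OF uv]
  show "(u, v) \<in> graph_P_adj a b c"
    unfolding adj_iff
  proof (intro conjI ballI L)
    fix \<phi> :: "real \<Rightarrow> complex" assume \<phi>: "\<phi> \<in> Cinf_S1"
    have "(\<lambda>n. LINT x|S1. op_P a b c (g n) x * \<phi> x) \<longlonglongrightarrow> (LINT x|S1. v x * \<phi> x)"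
      by (rule L2_pairing_tendsto[OF Cinf_L2[OF op_P_Cinf[OF g(1)]] L(2) Cinf_L2[OF \<phi>] g(3)])
    moreover have "(\<lambda>n. LINT x|S1. g n x * opQ a b c \<phi> x) \<longlonglongrightarrow> (LINT x|S1. u x * opQ a b c \<phi> x)"
      by (rule L2_pairing_tendsto[OF Cinf_L2[OF g(1)] L(1) Cinf_L2[OF opQ_Cinf[OF \<phi>]] g(2)])
    ultimately show "(LINT x|S1. u x * opQ a b c \<phi> x) = (LINT x|S1. v x * \<phi> x)"
      using LIMSEQ_unique unfolding symmetric_smooth[OF g(1) \<phi>] by blast
  qed
qed

text \<open>For smooth \<open>u\<close> this is the definition of the adjoint, and it survives
  limits in the graph norm. If adjoint and closure coincide, it says that the boundary form vanishes
  on the whole adjoint domain, which is what the counterexamples violate.\<close>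

lemma closure_adj_pairing:
  assumes uv: "(u, v) \<in> L2_graph_closure (graph_P a b c)" and fg: "(f, g) \<in> graph_P_adj a b c"
  shows "(LINT x|S1. v x * cnj (f x)) = (LINT x|S1. u x * cnj (g x))"
proof -
  obtain \<phi> where \<phi>: "\<And>n. \<phi> n \<in> Cinf_S1" "(\<lambda>n. sqn (\<lambda>x. \<phi> n x - u x)) \<longlonglongrightarrow> 0"
    "(\<lambda>n. sqn (\<lambda>x. op_P a b c (\<phi> n) x - v x)) \<longlonglongrightarrow> 0"
    using closure_seq[OF uv] by blast
  note L = closure_L2[OF uv]
  have fgL: "f \<in> L2_S1" "g \<in> L2_S1" using fg by (auto simp: adj_iff)
  have "(\<lambda>n. LINT x|S1. op_P a b c (\<phi> n) x * cnj (f x)) \<longlonglongrightarrow> (LINT x|S1. v x * cnj (f x))"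
    by (rule L2_pairing_tendsto[OF Cinf_L2[OF op_P_Cinf[OF \<phi>(1)]] L(2) L2_cnj[OF fgL(1)] \<phi>(3)])
  moreover have "(\<lambda>n. LINT x|S1. \<phi> n x * cnj (g x)) \<longlonglongrightarrow> (LINT x|S1. u x * cnj (g x))"
    by (rule L2_pairing_tendsto[OF Cinf_L2[OF \<phi>(1)] L(1) L2_cnj[OF fgL(2)] \<phi>(2)])
  moreover have "(LINT x|S1. op_P a b c (\<phi> n) x * cnj (f x)) = (LINT x|S1. \<phi> n x * cnj (g x))" for n
  proof -
    have "(LINT x|S1. f x * cnj (op_P a b c (\<phi> n) x)) = (LINT x|S1. g x * cnj (\<phi> n x))"
      using fg Cinf_cnj[OF \<phi>(1)[of n]] unfolding adj_iff opQ_cnj[OF \<phi>(1)[of n], symmetric] by blast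
    then have "cnj (LINT x|S1. f x * cnj (op_P a b c (\<phi> n) x)) = cnj (LINT x|S1. g x * cnj (\<phi> n x))" by simp
    then have "(LINT x|S1. cnj (f x * cnj (op_P a b c (\<phi> n) x))) = (LINT x|S1. cnj (g x * cnj (\<phi> n x)))"
      by (simp only: Bochner_Integration.integral_cnj)
    then show ?thesis by (simp add: mult.commute)
  qed
  ultimately show ?thesis using LIMSEQ_unique by simp
qed

text \<open>Functions of class H^2 lie in the domain of the closure; \<open>g1\<close> and
  \<open>w\<close> are g' and g''. A smooth mean-zero approximant of g'' is integrated twice. On the
  circle an integrand must have mean zero, so the mean \<open>m\<close> of the first primitive is
  removed before the second integration.\<close>

lemma second_order_approx:
  assumes g: "weak_deriv g g1" and g1: "weak_deriv g1 w" and e: "e > 0"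
    and v: "v \<in> L2_S1" "\<And>x. v x = of_real (a x) * w x + of_real (ddx a x) * g1 x
     - \<i> * of_real (b x) * g1 x - \<i> / 2 * of_real (ddx b x) * g x + of_real (c x) * g x"
  shows "\<exists>\<phi>\<in>Cinf_S1. sqn (\<lambda>x. \<phi> x - g x) < e \<and> sqn (\<lambda>x. op_P a b c \<phi> x - v x) < e"
proof -
  have L: "g \<in> L2_S1" "g1 \<in> L2_S1" "w \<in> L2_S1" using weak_deriv_L2[OF g] weak_deriv_L2[OF g1] by auto
  obtain B0 where B0: "\<And>x. cmod (of_real (a x)) \<le> B0" using Cinf_bounded[OF Cinf_of_real[OF a]] by blast
  have "(\<lambda>x. of_real (ddx a x) - \<i> * of_real (b x) :: complex) \<in> Cinf_S1" by (intro Cinf_intros a b)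
  from Cinf_bounded[OF this] obtain B1 where B1: "\<And>x. cmod (of_real (ddx a x) - \<i> * of_real (b x)) \<le> B1" by blast
  have "(\<lambda>x. of_real (c x) - \<i> / 2 * of_real (ddx b x) :: complex) \<in> Cinf_S1" by (intro Cinf_intros c b)
  from Cinf_bounded[OF this] obtain B2 where B2: "\<And>x. cmod (of_real (c x) - \<i> / 2 * of_real (ddx b x)) \<le> B2" by blast
  \<comment> \<open>Collects the sup bounds of the coefficients in the final estimate. The squared
    errors of g' and g are at most \<open>4 * d\<close>, and the whole sum is at most
    \<open>4 * M * d = e / 2\<close>.\<close>
  define M where "M = 1 + 4 * B0\<^sup>2 + 16 * B1\<^sup>2 + 16 * B2\<^sup>2"
  have M: "M \<ge> 1" by (simp add: M_def)
  define d where "d = e / (8 * M)"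
  have d: "d > 0" using e M by (simp add: d_def)
  obtain \<psi> where \<psi>: "\<psi> \<in> Cinf_S1" "(LINT x|S1. \<psi> x) = 0" "sqn (\<lambda>x. w x - \<psi> x) < d"
    using Cinf_mean_zero_dense[OF L(3) weak_deriv_mean[OF g1] d] by auto
  obtain \<theta> where \<theta>: "\<theta> \<in> Cinf_S1" "ddx \<theta> = \<psi>" "sqn (\<lambda>x. g1 x - \<theta> x) \<le> sqn (\<lambda>x. w x - \<psi> x)"
    using weak_deriv_approx[OF g1 \<psi>(1,2)] by auto
  define m where "m = (LINT x|S1. \<theta> x)"
  have \<theta>L: "\<theta> \<in> L2_S1" by (rule Cinf_L2[OF \<theta>(1)])
  have "m = - (LINT x|S1. (g1 x - \<theta> x) * 1)"
    using weak_deriv_mean[OF g] L2_integrable[OF L(2)] L2_integrable[OF \<theta>L] by (simp add: m_def)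
  then have "cmod m = cmod (LINT x|S1. (g1 x - \<theta> x) * 1)" by simp
  then have "cmod m \<le> sqrt (sqn (\<lambda>x. g1 x - \<theta> x))"
    using Cauchy_Schwarz[OF L2_diff[OF L(2) \<theta>L] L2_const[of 1]] by simp
  then have "(cmod m)\<^sup>2 \<le> (sqrt (sqn (\<lambda>x. g1 x - \<theta> x)))\<^sup>2" by (intro power_mono) auto
  then have m: "(cmod m)\<^sup>2 \<le> sqn (\<lambda>x. g1 x - \<theta> x)" by simp
  define \<eta> where "\<eta> x = \<theta> x - m" for x
  have \<eta>: "\<eta> \<in> Cinf_S1" unfolding \<eta>_def by (intro Cinf_intros \<theta>)
  have d\<eta>: "ddx \<eta> = \<psi>"
  proof (rule ddx_eqI)
    show "(\<eta> has_vector_derivative \<psi> x) (at x)" for x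
      using has_vector_derivative_diff[OF Cinf_vd[OF \<theta>(1), of x] has_vector_derivative_const[of m]]
      by (simp add: \<eta>_def[abs_def] \<theta>(2))
  qed
  have "sqn (\<lambda>x. g1 x - \<eta> x) = sqn (\<lambda>x. (g1 x - \<theta> x) + m)" by (simp add: \<eta>_def algebra_simps)
  also have "\<dots> \<le> 2 * sqn (\<lambda>x. g1 x - \<theta> x) + 2 * (cmod m)\<^sup>2"
    using sqn_add[OF L2_diff[OF L(2) \<theta>L] L2_const[of m]] by simp
  finally have \<eta>2: "sqn (\<lambda>x. g1 x - \<eta> x) \<le> 4 * d" using m \<theta>(3) \<psi>(3) by linarith
  have \<eta>0: "(LINT x|S1. \<eta> x) = 0"
    unfolding \<eta>_def using L2_integrable[OF \<theta>L] L2_integrable[OF L2_const[of m]] by (simp add: m_def)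
  obtain \<phi> where \<phi>: "\<phi> \<in> Cinf_S1" "ddx \<phi> = \<eta>" "sqn (\<lambda>x. g x - \<phi> x) \<le> sqn (\<lambda>x. g1 x - \<eta> x)"
    using weak_deriv_approx[OF g \<eta> \<eta>0] by auto
  have D: "(\<lambda>x. \<psi> x - w x) \<in> L2_S1" "(\<lambda>x. \<eta> x - g1 x) \<in> L2_S1" "(\<lambda>x. \<phi> x - g x) \<in> L2_S1"
    by (intro L2_diff L Cinf_L2 \<psi> \<eta> \<phi>)+
  have M1: "(\<lambda>x. of_real (a x) * (\<psi> x - w x)) \<in> L2_S1"
    "(\<lambda>x. (of_real (ddx a x) - \<i> * of_real (b x)) * (\<eta> x - g1 x)) \<in> L2_S1"
    "(\<lambda>x. (of_real (c x) - \<i> / 2 * of_real (ddx b x)) * (\<phi> x - g x)) \<in> L2_S1"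
    by (intro L2_Cmult D Cinf_intros a b c)+
  have "sqn (\<lambda>x. op_P a b c \<phi> x - v x) = sqn (\<lambda>x. of_real (a x) * (\<psi> x - w x)
      + ((of_real (ddx a x) - \<i> * of_real (b x)) * (\<eta> x - g1 x) + (of_real (c x) - \<i> / 2 * of_real (ddx b x)) * (\<phi> x - g x)))"
    by (rule arg_cong[where f=sqn], rule ext)
      (simp add: op_P_eq[OF \<phi>(1)] v(2) \<phi>(2) d\<eta> algebra_simps diff_divide_distrib)
  also have "\<dots> \<le> 2 * sqn (\<lambda>x. of_real (a x) * (\<psi> x - w x)) + 2 * (2 * sqn (\<lambda>x. (of_real (ddx a x) - \<i> * of_real (b x)) * (\<eta> x - g1 x))
     + 2 * sqn (\<lambda>x. (of_real (c x) - \<i> / 2 * of_real (ddx b x)) * (\<phi> x - g x)))"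
    by (rule order_trans[OF sqn_add[OF M1(1) L2_add[OF M1(2,3)]] add_mono[OF order_refl mult_left_mono[OF sqn_add[OF M1(2,3)]]]]) simp
  also have "\<dots> \<le> 2 * (B0\<^sup>2 * d) + 2 * (2 * (B1\<^sup>2 * (4 * d)) + 2 * (B2\<^sup>2 * (4 * d)))"
  proof (intro add_mono mult_left_mono)
    show "sqn (\<lambda>x. of_real (a x) * (\<psi> x - w x)) \<le> B0\<^sup>2 * d"
      by (rule order_trans[OF sqn_mono[OF M1(1) D(1), of B0]])
        (use B0 \<psi>(3) in \<open>auto simp: norm_mult sqn_commute[of \<psi>] intro!: mult_right_mono mult_left_mono\<close>)
    show "sqn (\<lambda>x. (of_real (ddx a x) - \<i> * of_real (b x)) * (\<eta> x - g1 x)) \<le> B1\<^sup>2 * (4 * d)"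
      by (rule order_trans[OF sqn_mono[OF M1(2) D(2), of B1]])
        (use B1 \<eta>2 in \<open>auto simp: norm_mult sqn_commute[of \<eta>] intro!: mult_right_mono mult_left_mono\<close>)
    show "sqn (\<lambda>x. (of_real (c x) - \<i> / 2 * of_real (ddx b x)) * (\<phi> x - g x)) \<le> B2\<^sup>2 * (4 * d)"
      by (rule order_trans[OF sqn_mono[OF M1(3) D(3), of B2]])
        (use B2 \<phi>(3) \<eta>2 in \<open>auto simp: norm_mult sqn_commute[of \<phi>] intro!: mult_right_mono mult_left_mono\<close>)
  qed auto
  also have "\<dots> \<le> M * d * 4" using d by (simp add: M_def algebra_simps)
  also have "\<dots> < e" using e M by (simp add: d_def)
  finally have "sqn (\<lambda>x. op_P a b c \<phi> x - v x) < e" .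
  moreover have "4 * d < e" using e M by (simp add: d_def field_simps)
  then have "sqn (\<lambda>x. \<phi> x - g x) < e" using \<phi>(3) \<eta>2 sqn_commute[of \<phi> g] by linarith
  ultimately show ?thesis using \<phi>(1) by blast
qed

end

section \<open>Degenerate zeros imply essential self-adjointness\<close>

text \<open>
  Here \<open>a1\<close>, \<open>a2\<close> stand for \<open>a'\<close>, \<open>a''\<close>, and \<open>chi1\<close> is the derivative of the cutoff \<open>chi = a\<^sup>2 / (a\<^sup>2 + e\<^sup>2)\<close>;
  the long expression is the derivative of \<open>a * chi1\<close>.
\<close>

lemma cutoff_bounds:
  fixes a a1 a2 b K e M :: real
  assumes K: "K > 0" "a1\<^sup>2 \<le> K * \<bar>a\<bar>" "\<bar>a1 * b\<bar> \<le> K * \<bar>a\<bar>" and M: "\<bar>a2\<bar> \<le> M" and e: "e > 0"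
  defines "D \<equiv> a\<^sup>2 + e\<^sup>2" and "k \<equiv> a\<^sup>2 * e\<^sup>2 / (a\<^sup>2 + e\<^sup>2)\<^sup>2" and "chi1 \<equiv> 2 * a * a1 * e\<^sup>2 / (a\<^sup>2 + e\<^sup>2)\<^sup>2"
  shows "\<bar>chi1 * b\<bar> \<le> 2 * K * k" "\<bar>chi1 * a1\<bar> \<le> 2 * K * k" "\<bar>a * chi1 * chi1\<bar> \<le> K * k"
    "\<bar>(4 * a * a1\<^sup>2 + 2 * a\<^sup>2 * a2) * e\<^sup>2 / D\<^sup>2 - 8 * a ^ 3 * a1\<^sup>2 * e\<^sup>2 / D ^ 3\<bar> \<le> (12 * K + 2 * M) * k"
    "0 \<le> k" "k \<le> 1 / 4"
proof -
  have D: "D > 0" using e by (simp add: D_def add_nonneg_pos)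
  have aa: "\<bar>a\<bar> * \<bar>a\<bar> = a\<^sup>2" by (simp add: power2_eq_square)
  have kD: "k = a\<^sup>2 * e\<^sup>2 / D\<^sup>2" "chi1 = 2 * a * a1 * e\<^sup>2 / D\<^sup>2" by (simp_all add: k_def chi1_def D_def)
  show k0: "0 \<le> k" by (simp add: kD)
  have "4 * (a\<^sup>2 * e\<^sup>2) \<le> D\<^sup>2"
    using sum_squares_bound[of "a\<^sup>2" "e\<^sup>2"] by (simp add: D_def power2_sum algebra_simps)
  then show k4: "k \<le> 1 / 4" using D by (simp add: kD divide_le_eq)
  have E: "0 \<le> e\<^sup>2 / D\<^sup>2" by simp
  have "\<bar>chi1 * b\<bar> = 2 * \<bar>a\<bar> * \<bar>a1 * b\<bar> * (e\<^sup>2 / D\<^sup>2)" by (simp add: kD abs_mult)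
  also have "\<dots> \<le> 2 * \<bar>a\<bar> * (K * \<bar>a\<bar>) * (e\<^sup>2 / D\<^sup>2)" using K by (intro mult_right_mono[OF _ E] mult_left_mono) auto
  also have "\<dots> = 2 * K * k" by (simp add: kD flip: aa)
  finally show "\<bar>chi1 * b\<bar> \<le> 2 * K * k" .
  have "\<bar>chi1 * a1\<bar> = 2 * \<bar>a\<bar> * a1\<^sup>2 * (e\<^sup>2 / D\<^sup>2)" by (simp add: kD abs_mult power2_eq_square)
  also have "\<dots> \<le> 2 * \<bar>a\<bar> * (K * \<bar>a\<bar>) * (e\<^sup>2 / D\<^sup>2)" using K by (intro mult_right_mono[OF _ E] mult_left_mono) auto
  also have "\<dots> = 2 * K * k" by (simp add: kD flip: aa)
  finally show c2: "\<bar>chi1 * a1\<bar> \<le> 2 * K * k" .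
  \<comment> \<open>Because \<open>a * chi1 = 2 * k * a1\<close>; as \<open>2 * k\<close> is at most
    1/2, the bound for \<open>chi1 * a1\<close> is halved.\<close>
  have "a * chi1 * chi1 = (chi1 * a1) * (2 * k)"
    by (simp add: kD power2_eq_square)
  then have "\<bar>a * chi1 * chi1\<bar> = \<bar>chi1 * a1\<bar> * \<bar>2 * k\<bar>" by (simp only: abs_mult)
  also have "\<bar>2 * k\<bar> = 2 * k" using k0 by simp
  finally have "\<bar>a * chi1 * chi1\<bar> = \<bar>chi1 * a1\<bar> * (2 * k)" .
  also have "\<dots> \<le> (2 * K * k) * (2 * (1 / 4))" using c2 k0 k4 K by (intro mult_mono) auto
  finally show "\<bar>a * chi1 * chi1\<bar> \<le> K * k" by simp
  have 1: "\<bar>4 * a * a1\<^sup>2 * e\<^sup>2 / D\<^sup>2\<bar> \<le> 4 * K * k"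
  proof -
    have "4 * a * a1\<^sup>2 * e\<^sup>2 / D\<^sup>2 = 2 * (chi1 * a1)" by (simp add: kD power2_eq_square)
    then have "\<bar>4 * a * a1\<^sup>2 * e\<^sup>2 / D\<^sup>2\<bar> = 2 * \<bar>chi1 * a1\<bar>" by (simp only: abs_mult abs_numeral)
    then show ?thesis using c2 by linarith
  qed
  have 2: "\<bar>2 * a\<^sup>2 * a2 * e\<^sup>2 / D\<^sup>2\<bar> \<le> 2 * M * k"
  proof -
    have "\<bar>2 * a\<^sup>2 * a2 * e\<^sup>2 / D\<^sup>2\<bar> = \<bar>a2\<bar> * (2 * k)" by (simp add: kD abs_mult)
    also have "\<dots> \<le> M * (2 * k)" using M k0 by (intro mult_right_mono) auto
    finally show ?thesis by simp
  qed
  have 3: "\<bar>8 * a ^ 3 * a1\<^sup>2 * e\<^sup>2 / D ^ 3\<bar> \<le> 8 * K * k"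
  proof -
    have "\<bar>8 * a ^ 3 * a1\<^sup>2 * e\<^sup>2 / D ^ 3\<bar> = (4 * \<bar>chi1 * a1\<bar>) * (a\<^sup>2 / D)"
      using D by (simp add: kD abs_mult power2_eq_square power3_eq_cube)
    also have "\<dots> \<le> (4 * (2 * K * k)) * 1"
      using c2 D K k0 by (intro mult_mono) (auto simp: D_def)
    finally show ?thesis by simp
  qed
  have "(4 * a * a1\<^sup>2 + 2 * a\<^sup>2 * a2) * e\<^sup>2 / D\<^sup>2 - 8 * a ^ 3 * a1\<^sup>2 * e\<^sup>2 / D ^ 3
    = 4 * a * a1\<^sup>2 * e\<^sup>2 / D\<^sup>2 + 2 * a\<^sup>2 * a2 * e\<^sup>2 / D\<^sup>2 - 8 * a ^ 3 * a1\<^sup>2 * e\<^sup>2 / D ^ 3"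
    by (simp add: algebra_simps add_divide_distrib)
  also have "\<bar>\<dots>\<bar> \<le> 4 * K * k + 2 * M * k + 8 * K * k"
  proof -
    have "\<bar>x + y - z\<bar> \<le> p + q + r" if "\<bar>x\<bar> \<le> p" "\<bar>y\<bar> \<le> q" "\<bar>z\<bar> \<le> r" for x y z p q r :: real
      using that by linarith
    from this[OF 1 2 3] show ?thesis .
  qed
  finally show "\<bar>(4 * a * a1\<^sup>2 + 2 * a\<^sup>2 * a2) * e\<^sup>2 / D\<^sup>2 - 8 * a ^ 3 * a1\<^sup>2 * e\<^sup>2 / D ^ 3\<bar> \<le> (12 * K + 2 * M) * k"
    by (simp add: algebra_simps)
qed

context circle_operator
begin

text \<open>In the sense of distributions the adjoint equation reads
  \<open>(a u)'' - ((a' + i b) u)' = h\<close>, and it is integrated once. The function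
  \<open>F\<close> is the flux \<open>a u' - i b u\<close>, which thus lies in H^1 although
  \<open>u'\<close> itself may fail to be square integrable.\<close>

lemma adj_first_order:
  assumes uv: "(u, v) \<in> graph_P_adj a b c"
  defines "h \<equiv> \<lambda>x. v x - (\<i> / 2 * of_real (ddx b x) + of_real (c x)) * u x"
  obtains F where "weak_deriv F h"
    "weak_deriv (\<lambda>x. of_real (a x) * u x) (\<lambda>x. (of_real (ddx a x) + \<i> * of_real (b x)) * u x + F x)"
proof -
  have uL: "u \<in> L2_S1" and vL: "v \<in> L2_S1" using uv by (auto simp: adj_iff)
  have BC: "(\<lambda>x. \<i> / 2 * of_real (ddx b x) + of_real (c x)) \<in> Cinf_S1" by (intro Cinf_intros b c)
  have hL: "h \<in> L2_S1" unfolding h_def by (intro L2_diff L2_Cmult vL uL BC)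
  define A where "A x = complex_of_real (a x)" for x
  define E where "E x = complex_of_real (ddx a x) + \<i> * of_real (b x)" for x
  have AC: "A \<in> Cinf_S1" and EC: "E \<in> Cinf_S1" unfolding A_def E_def by (intro Cinf_intros a b)+
  have AL: "(\<lambda>x. A x * u x) \<in> L2_S1" and EL: "(\<lambda>x. E x * u x) \<in> L2_S1"
    by (intro L2_Cmult uL AC EC)+
  have main: "(LINT x|S1. A x * u x * ddx (ddx \<phi>) x) + (LINT x|S1. E x * u x * ddx \<phi> x) = (LINT x|S1. h x * \<phi> x)"
    if \<phi>: "\<phi> \<in> Cinf_S1" for \<phi>
  proof -
    have \<phi>L: "\<phi> \<in> L2_S1" "ddx \<phi> \<in> L2_S1" "ddx (ddx \<phi>) \<in> L2_S1" by (intro Cinf_L2 Cinf_ddx \<phi>)+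
    have I: "integrable S1 (\<lambda>x. A x * u x * ddx (ddx \<phi>) x)" "integrable S1 (\<lambda>x. E x * u x * ddx \<phi> x)"
      "integrable S1 (\<lambda>x. (\<i> / 2 * of_real (ddx b x) + of_real (c x)) * u x * \<phi> x)"
      "integrable S1 (\<lambda>x. v x * \<phi> x)"
      by (intro L2_prod_integrable L2_Cmult AL EL uL vL BC \<phi>L)+
    have "(LINT x|S1. u x * opQ a b c \<phi> x) = (LINT x|S1. v x * \<phi> x)"
      using uv \<phi> by (simp add: adj_iff)
    also have "(LINT x|S1. u x * opQ a b c \<phi> x) = (LINT x|S1. (A x * u x * ddx (ddx \<phi>) x + E x * u x * ddx \<phi> x)
        + (\<i> / 2 * of_real (ddx b x) + of_real (c x)) * u x * \<phi> x)"
      by (rule Bochner_Integration.integral_cong) (auto simp: opQ_def A_def E_def algebra_simps)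
    also have "\<dots> = (LINT x|S1. A x * u x * ddx (ddx \<phi>) x) + (LINT x|S1. E x * u x * ddx \<phi> x)
        + (LINT x|S1. (\<i> / 2 * of_real (ddx b x) + of_real (c x)) * u x * \<phi> x)"
      by (simp only: Bochner_Integration.integral_add[OF Bochner_Integration.integrable_add[OF I(1,2)] I(3)]
        Bochner_Integration.integral_add[OF I(1,2)])
    finally have "(LINT x|S1. A x * u x * ddx (ddx \<phi>) x) + (LINT x|S1. E x * u x * ddx \<phi> x)
      = (LINT x|S1. v x * \<phi> x) - (LINT x|S1. (\<i> / 2 * of_real (ddx b x) + of_real (c x)) * u x * \<phi> x)"
      by (simp add: algebra_simps)
    also have "\<dots> = (LINT x|S1. v x * \<phi> x - (\<i> / 2 * of_real (ddx b x) + of_real (c x)) * u x * \<phi> x)"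
      by (rule Bochner_Integration.integral_diff[OF I(4,3), symmetric])
    also have "\<dots> = (LINT x|S1. h x * \<phi> x)"
      by (rule Bochner_Integration.integral_cong) (auto simp: h_def left_diff_distrib)
    finally show ?thesis .
  qed
  have d0: "ddx (\<lambda>x. k :: complex) = (\<lambda>x. 0)" for k by (rule ddx_eqI) auto
  have h0: "(LINT x|S1. h x) = 0" using main[of "\<lambda>x. 1"] by (simp add: d0)
  define V where "V = prim h"
  have V: "weak_deriv V h" unfolding V_def by (rule prim_weak_deriv[OF hL h0])
  have VL: "V \<in> L2_S1" by (rule weak_deriv_L2(1)[OF V])
  define J where "J \<psi> = (LINT x|S1. A x * u x * ddx \<psi> x) + (LINT x|S1. (E x * u x + V x) * \<psi> x)" for \<psi>
  have EVL: "(\<lambda>x. E x * u x + V x) \<in> L2_S1" by (intro L2_add EL VL)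
  have J0: "J \<psi> = 0" if \<psi>: "\<psi> \<in> Cinf_S1" "(LINT x|S1. \<psi> x) = 0" for \<psi>
  proof -
    have p: "prim \<psi> \<in> Cinf_S1" "ddx (prim \<psi>) = \<psi>" using prim_smooth[OF \<psi>] by auto
    have 1: "(LINT x|S1. V x * \<psi> x) = - (LINT x|S1. h x * prim \<psi> x)"
      using V p unfolding weak_deriv_def by metis
    have 2: "(LINT x|S1. A x * u x * ddx \<psi> x) + (LINT x|S1. E x * u x * \<psi> x) = (LINT x|S1. h x * prim \<psi> x)"
      using main[OF p(1)] unfolding p(2) .
    have 3: "(LINT x|S1. (E x * u x + V x) * \<psi> x) = (LINT x|S1. E x * u x * \<psi> x) + (LINT x|S1. V x * \<psi> x)"
      using L2_prod_integrable[OF EL Cinf_L2[OF \<psi>(1)]] L2_prod_integrable[OF VL Cinf_L2[OF \<psi>(1)]]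
      by (simp add: distrib_right)
    show ?thesis unfolding J_def 3 1 add.assoc[symmetric] 2 by (rule add.right_inverse)
  qed
  \<comment> \<open>\<open>J\<close> vanishes on mean-zero functions, so it is a multiple of the
    mean; testing with 1 gives the factor \<open>k0\<close>. Subtracting \<open>k0\<close> from the
    primitive \<open>V\<close> absorbs it.\<close>
  define k0 where "k0 = (LINT x|S1. E x * u x + V x)"
  define F where "F x = V x + (- k0)" for x
  have kW: "weak_deriv (\<lambda>x. - k0) (\<lambda>x. 0)" using weak_deriv_smooth[OF Cinf_const[of "- k0"]] unfolding d0 .
  have F: "weak_deriv F h" using weak_deriv_add[OF V kW] unfolding F_def by simp
  have FL: "F \<in> L2_S1" by (rule weak_deriv_L2(1)[OF F])
  have "weak_deriv (\<lambda>x. A x * u x) (\<lambda>x. E x * u x + F x)"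
    unfolding weak_deriv_def
  proof (intro conjI ballI AL L2_add EL FL)
    fix \<psi> :: "real \<Rightarrow> complex" assume \<psi>: "\<psi> \<in> Cinf_S1"
    define m where "m = (LINT x|S1. \<psi> x)"
    have \<psi>L: "\<psi> \<in> L2_S1" by (rule Cinf_L2[OF \<psi>])
    have \<psi>': "(\<lambda>x. \<psi> x - m) \<in> Cinf_S1" by (intro Cinf_intros \<psi>)
    have m0: "(LINT x|S1. \<psi> x - m) = 0"
      using L2_integrable[OF \<psi>L] L2_integrable[OF L2_const[of m]] by (simp add: m_def)
    have d\<psi>: "ddx (\<lambda>x. \<psi> x - m) = ddx \<psi>"
    proof (rule ddx_eqI)
      show "((\<lambda>x. \<psi> x - m) has_vector_derivative ddx \<psi> x) (at x)" for x
        using has_vector_derivative_diff[OF Cinf_vd[OF \<psi>, of x] has_vector_derivative_const[of m]] by simp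
    qed
    have i: "integrable S1 (\<lambda>x. (E x * u x + V x) * \<psi> x)" "integrable S1 (\<lambda>x. E x * u x + V x)"
      by (rule L2_prod_integrable[OF EVL \<psi>L]) (rule L2_integrable[OF EVL])
    have "(LINT x|S1. (E x * u x + V x) * (\<psi> x - m)) = (LINT x|S1. (E x * u x + V x) * \<psi> x - (E x * u x + V x) * m)"
      by (simp add: right_diff_distrib)
    also have "\<dots> = (LINT x|S1. (E x * u x + V x) * \<psi> x) - k0 * m"
      using i by (subst Bochner_Integration.integral_diff) (auto simp: k0_def simp del: Bochner_Integration.integral_add)
    finally have e1: "(LINT x|S1. A x * u x * ddx \<psi> x) + ((LINT x|S1. (E x * u x + V x) * \<psi> x) - k0 * m) = 0"
      using J0[OF \<psi>' m0] unfolding J_def d\<psi> by simp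
    have "(LINT x|S1. (E x * u x + F x) * \<psi> x) = (LINT x|S1. (E x * u x + V x) * \<psi> x - k0 * \<psi> x)"
      by (rule Bochner_Integration.integral_cong) (auto simp: F_def algebra_simps)
    also have "\<dots> = (LINT x|S1. (E x * u x + V x) * \<psi> x) - k0 * m"
      using i L2_integrable[OF \<psi>L] by (subst Bochner_Integration.integral_diff) (auto simp: m_def)
    finally have e2: "(LINT x|S1. (E x * u x + F x) * \<psi> x) = (LINT x|S1. (E x * u x + V x) * \<psi> x) - k0 * m" .
    show "(LINT x|S1. A x * u x * ddx \<psi> x) = - (LINT x|S1. (E x * u x + F x) * \<psi> x)"
      using e1 unfolding e2 by (rule eq_neg_iff_add_eq_0[THEN iffD2])
  qed
  then show ?thesis using that[OF F] by (simp add: A_def E_def)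
qed


text \<open>With \<open>q = a chi'\<close>, the Leibniz rule gives
  \<open>P (chi u) = chi v + 2 q u' + (q' - i b chi') u\<close>. The coefficient of \<open>u\<close>
  is bounded by the weight \<open>k\<close>, which disappears in the limit. The term
  \<open>q u'\<close> is the real difficulty, since \<open>u'\<close> is not known to be square
  integrable; the energy estimate shows that it tends to 0 in L2. The factor \<open>a^2\<close> in
  \<open>chi\<close> puts \<open>chi u\<close> in H^2, where smooth approximation is
  available.\<close>

lemma degenerate_closure:
  assumes K: "K > 0" "\<And>x. (ddx a x)\<^sup>2 \<le> K * \<bar>a x\<bar>" "\<And>x. \<bar>ddx a x * b x\<bar> \<le> K * \<bar>a x\<bar>"
    and b0: "\<And>x. a x = 0 \<Longrightarrow> b x = 0" and nz: "AE x in S1. a x \<noteq> 0"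
    and uv: "(u, v) \<in> graph_P_adj a b c"
  shows "(u, v) \<in> L2_graph_closure (graph_P a b c)"
proof -
  have uL: "u \<in> L2_S1" and vL: "v \<in> L2_S1" using uv by (auto simp: adj_iff)
  define h where "h = (\<lambda>x. v x - (\<i> / 2 * of_real (ddx b x) + of_real (c x)) * u x)"
  obtain F where F: "weak_deriv F h"
    and Au: "weak_deriv (\<lambda>x. of_real (a x) * u x) (\<lambda>x. (of_real (ddx a x) + \<i> * of_real (b x)) * u x + F x)"
    using adj_first_order[OF uv] unfolding h_def by blast
  have hL: "h \<in> L2_S1" by (rule weak_deriv_L2(2)[OF F])
  have a0: "ddx a x = 0" if "a x = 0" for x using K(2)[of x] that by simp
  define A where "A x = complex_of_real (a x)" for x
  define A1 where "A1 x = complex_of_real (ddx a x)" for x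
  define B where "B x = complex_of_real (b x)" for x
  define B1 where "B1 x = complex_of_real (ddx b x)" for x
  have AC: "A \<in> Cinf_S1" "A1 \<in> Cinf_S1" "B \<in> Cinf_S1" "B1 \<in> Cinf_S1"
    unfolding A_def A1_def B_def B1_def by (intro Cinf_intros a b)+
  have smA: "smooth A" "smooth B" using AC by (auto simp: Cinf_S1_iff)
  have dA: "ddx A = A1" "ddx B = B1" unfolding A_def A1_def B_def B1_def using smooth_coeffs by (auto simp: ddx_of_real)
  have A_0: "A x = 0 \<longleftrightarrow> a x = 0" for x by (simp add: A_def)
  text \<open>\<open>u1\<close> and \<open>u2\<close> are \<open>u'\<close> and \<open>u''\<close> where \<open>a\<close> does not vanish, and 0 at the zeros of \<open>a\<close> (division by 0).\<close>
  define u1 where "u1 x = (\<i> * B x * u x + F x) / A x" for x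
  define u2 where "u2 x = (\<i> * B1 x * u x + \<i> * B x * u1 x + h x - A1 x * u1 x) / A x" for x
  have Au1: "A x * u1 x = \<i> * B x * u x + F x" if "A x \<noteq> 0" for x using that by (simp add: u1_def)
  have Au2: "A x * u2 x = \<i> * B1 x * u x + \<i> * B x * u1 x + h x - A1 x * u1 x" if "A x \<noteq> 0" for x
    using that by (simp add: u2_def)
  have Au': "weak_deriv (\<lambda>x. A x * u x) (\<lambda>x. (A1 x + \<i> * B x) * u x + F x)"
    using Au by (simp add: A_def A1_def B_def)
  \<comment> \<open>A factor \<open>a\<close> in the multiplier buys one derivative of
    \<open>u\<close>, since \<open>a u\<close> is in H^1; in \<open>W2\<close> a factor
    \<open>a^2\<close> buys the next one. The identities hold at every point: at a zero of
    \<open>a\<close> both sides are 0, in \<open>W2\<close> because a' and b vanish there.\<close>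
  have W1: "weak_deriv (\<lambda>x. \<sigma> x * u x) (\<lambda>x. ddx \<sigma> x * u x + \<sigma> x * u1 x)"
    if \<sigma>: "\<And>x. \<sigma> x = \<tau> x * A x" and \<tau>: "\<tau> \<in> Cinf_S1" and \<tau>0: "\<And>x. a x = 0 \<Longrightarrow> \<tau> x = 0" for \<sigma> \<tau>
  proof -
    have s: "smooth \<tau>" using \<tau> by (simp add: Cinf_S1_iff)
    have \<sigma>e: "\<sigma> = (\<lambda>x. \<tau> x * A x)" using \<sigma> by blast
    have d: "ddx \<sigma> = (\<lambda>x. \<tau> x * A1 x + ddx \<tau> x * A x)"
      unfolding \<sigma>e by (simp add: ddx_mult[OF s smA(1)] dA)
    have "(\<lambda>x. \<tau> x * (A x * u x)) = (\<lambda>x. \<sigma> x * u x)" by (simp add: \<sigma> mult.assoc)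
    moreover have "(\<lambda>x. ddx \<tau> x * (A x * u x) + \<tau> x * ((A1 x + \<i> * B x) * u x + F x)) = (\<lambda>x. ddx \<sigma> x * u x + \<sigma> x * u1 x)"
    proof
      fix x
      show "ddx \<tau> x * (A x * u x) + \<tau> x * ((A1 x + \<i> * B x) * u x + F x) = ddx \<sigma> x * u x + \<sigma> x * u1 x"
      proof (cases "A x = 0")
        case True
        then show ?thesis using \<tau>0 by (simp add: A_0 \<sigma> d)
      next
        case False
        have "\<sigma> x * u1 x = \<tau> x * (\<i> * B x * u x + F x)" by (simp add: \<sigma> mult.assoc Au1[OF False])
        then show ?thesis by (simp add: d algebra_simps)
      qed
    qed
    ultimately show ?thesis using weak_deriv_mult[OF Au' \<tau>] by simp
  qed
  have W2: "weak_deriv (\<lambda>x. \<sigma> x * u1 x) (\<lambda>x. ddx \<sigma> x * u1 x + \<sigma> x * u2 x)"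
    if \<sigma>: "\<And>x. \<sigma> x = \<tau> x * (A x * A x)" and \<tau>: "\<tau> \<in> Cinf_S1" for \<sigma> \<tau>
  proof -
    have s: "smooth \<tau>" using \<tau> by (simp add: Cinf_S1_iff)
    have \<sigma>e: "\<sigma> = (\<lambda>x. \<tau> x * (A x * A x))" using \<sigma> by blast
    have d: "ddx \<sigma> = (\<lambda>x. \<tau> x * (A x * A1 x + A1 x * A x) + ddx \<tau> x * (A x * A x))"
      unfolding \<sigma>e by (simp add: ddx_mult[OF s smooth_mult[OF smA(1,1)]] ddx_mult[OF smA(1,1)] dA)
    have d1: "ddx (\<lambda>x. \<tau> x * (\<i> * B x)) = (\<lambda>x. \<tau> x * (\<i> * B1 x) + ddx \<tau> x * (\<i> * B x))"
    proof -
      have "ddx (\<lambda>x. \<i> * B x) = (\<lambda>x. \<i> * B1 x)"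
        by (rule ddx_eqI) (use smooth_vd[OF smA(2)] dA in \<open>auto intro: has_vector_derivative_mult_right\<close>)
      then show ?thesis using ddx_mult[OF s smooth_mult[OF smooth_const smA(2)]] by simp
    qed
    have d2: "ddx (\<lambda>x. \<tau> x * A x) = (\<lambda>x. \<tau> x * A1 x + ddx \<tau> x * A x)"
      by (simp add: ddx_mult[OF s smA(1)] dA)
    have C: "(\<lambda>x. \<tau> x * (\<i> * B x)) \<in> Cinf_S1" "(\<lambda>x. \<tau> x * A x) \<in> Cinf_S1"
      by (intro Cinf_intros \<tau> AC)+
    have W: "weak_deriv (\<lambda>x. \<tau> x * (\<i> * B x) * (A x * u x) + \<tau> x * A x * F x)
      (\<lambda>x. ((\<tau> x * (\<i> * B1 x) + ddx \<tau> x * (\<i> * B x)) * (A x * u x) + \<tau> x * (\<i> * B x) * ((A1 x + \<i> * B x) * u x + F x))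
         + ((\<tau> x * A1 x + ddx \<tau> x * A x) * F x + \<tau> x * A x * h x))"
      using weak_deriv_add[OF weak_deriv_mult[OF Au' C(1)] weak_deriv_mult[OF F C(2)]] unfolding d1 d2 .
    have e1: "\<tau> x * (\<i> * B x) * (A x * u x) + \<tau> x * A x * F x = \<sigma> x * u1 x" for x
    proof (cases "A x = 0")
      case False
      have "\<sigma> x * u1 x = \<tau> x * A x * (\<i> * B x * u x + F x)" by (simp add: \<sigma> mult.assoc Au1[OF False])
      then show ?thesis by (simp add: algebra_simps)
    qed (simp add: \<sigma>)
    have e2: "((\<tau> x * (\<i> * B1 x) + ddx \<tau> x * (\<i> * B x)) * (A x * u x) + \<tau> x * (\<i> * B x) * ((A1 x + \<i> * B x) * u x + F x))
         + ((\<tau> x * A1 x + ddx \<tau> x * A x) * F x + \<tau> x * A x * h x) = ddx \<sigma> x * u1 x + \<sigma> x * u2 x" for x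
    proof (cases "A x = 0")
      case False
      have "\<sigma> x * u2 x = \<tau> x * A x * (\<i> * B1 x * u x + \<i> * B x * u1 x + h x - A1 x * u1 x)"
        by (simp add: \<sigma> mult.assoc Au2[OF False])
      moreover have "F x = A x * u1 x - \<i> * B x * u x" using Au1[OF False] by simp
      ultimately show ?thesis unfolding d by (simp only:) (simp add: algebra_simps)
    next
      case True
      then have "a x = 0" by (simp add: A_0)
      with True show ?thesis using a0 b0 by (simp add: \<sigma> d A1_def B_def)
    qed
    show ?thesis using W unfolding e1 e2 .
  qed
  define D where "D e x = (a x)\<^sup>2 + e\<^sup>2" for e x
  have Dp: "D e x > 0" if "e > 0" for e x using that by (simp add: D_def add_nonneg_pos)
  \<comment> \<open>This is \<open>chi * (1 - chi)\<close>, the common weight of all error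
    terms.\<close>
  define k where "k e x = (a x)\<^sup>2 * e\<^sup>2 / (D e x)\<^sup>2" for e x
  define chi where "chi e x = complex_of_real ((a x)\<^sup>2 / D e x)" for e x
  define chi1 where "chi1 e x = complex_of_real (2 * a x * ddx a x * e\<^sup>2 / (D e x)\<^sup>2)" for e x
  define q where "q e x = A x * chi1 e x" for e x
  define q1 where "q1 e = ddx (q e)" for e
  define Q where "Q e x = q e x * u1 x" for e x
  obtain M where M: "M > 0" "\<And>x. \<bar>ddx (ddx a) x\<bar> \<le> M" using Cinf_bounded[OF Cinf_ddx[OF Cinf_ddx[OF a]]] by auto
  obtain N where N: "N > 0" "\<And>x. cmod (B1 x) \<le> N" using Cinf_bounded[OF AC(4)] by blast
  have DC: "D e \<in> Cinf_S1" for e unfolding D_def[abs_def] by (intro Cinf_intros a)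
  have DC2: "(\<lambda>x. (D e x)\<^sup>2) \<in> Cinf_S1" for e by (intro Cinf_intros DC)
  have \<tau>C: "(\<lambda>x. complex_of_real (a x / D e x)) \<in> Cinf_S1" "(\<lambda>x. complex_of_real (1 / D e x)) \<in> Cinf_S1"
     "(\<lambda>x. complex_of_real (2 * ddx a x * e\<^sup>2 / (D e x)\<^sup>2)) \<in> Cinf_S1" "chi1 e \<in> Cinf_S1" if e: "e > 0" for e
    unfolding chi1_def[abs_def] using Dp[OF e]
    by (intro Cinf_of_real Cinf_divide Cinf_mult Cinf_const Cinf_ddx a DC DC2; simp add: less_imp_neq[symmetric] order_less_imp_not_eq2)+
  have chiC: "chi e \<in> Cinf_S1" if e: "e > 0" for e
    unfolding chi_def[abs_def] using Dp[OF e]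
    by (intro Cinf_of_real Cinf_divide Cinf_power a DC; simp add: order_less_imp_not_eq2)
  have qC: "q e \<in> Cinf_S1" if e: "e > 0" for e
    unfolding q_def[abs_def] by (intro Cinf_intros AC \<tau>C e)
  have Dd: "((\<lambda>x. D e x) has_real_derivative 2 * a x * ddx a x) (at x)" for e x
    unfolding D_def by (rule derivative_eq_intros smooth_DERIV[OF smooth_coeffs(1)] refl | simp)+
  have dchi: "ddx (chi e) = chi1 e" if e: "e > 0" for e
  proof (rule ddx_eqI)
    fix x
    have "((\<lambda>x. (a x)\<^sup>2 / D e x) has_real_derivative ((2 * a x * ddx a x) * D e x - (a x)\<^sup>2 * (2 * a x * ddx a x)) / (D e x * D e x)) (at x)"
      by (rule DERIV_divide) (use Dp[OF e, of x] in \<open>auto intro!: derivative_eq_intros smooth_DERIV[OF smooth_coeffs(1)] Dd\<close>)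
    also have "((2 * a x * ddx a x) * D e x - (a x)\<^sup>2 * (2 * a x * ddx a x)) / (D e x * D e x) = 2 * a x * ddx a x * e\<^sup>2 / (D e x)\<^sup>2"
      by (simp add: power2_eq_square) (simp add: D_def power2_eq_square algebra_simps)
    finally show "(chi e has_vector_derivative chi1 e x) (at x)"
      unfolding chi_def[abs_def] chi1_def by (rule has_vector_derivative_of_real)
  qed
  have q1_eq: "q1 e x = of_real ((4 * a x * (ddx a x)\<^sup>2 + 2 * (a x)\<^sup>2 * ddx (ddx a) x) * e\<^sup>2 / (D e x)\<^sup>2
      - 8 * a x ^ 3 * (ddx a x)\<^sup>2 * e\<^sup>2 / D e x ^ 3)" if e: "e > 0" for e x
    unfolding q1_def
  proof (rule ddx_eq)
    have D0: "D e x \<noteq> 0" using Dp[OF e, of x] by simp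
    have n: "((\<lambda>x. 2 * (a x)\<^sup>2 * ddx a x * e\<^sup>2) has_real_derivative (4 * a x * (ddx a x)\<^sup>2 + 2 * (a x)\<^sup>2 * ddx (ddx a) x) * e\<^sup>2) (at x)"
      by (rule derivative_eq_intros smooth_DERIV[OF smooth_coeffs(1)] smooth_DERIV[OF smooth_coeffs(4)] refl)+
        (simp add: power2_eq_square algebra_simps)
    have dd: "((\<lambda>x. (D e x)\<^sup>2) has_real_derivative 2 * D e x * (2 * a x * ddx a x)) (at x)"
      by (rule derivative_eq_intros Dd refl | simp)+
    have "((\<lambda>x. (2 * (a x)\<^sup>2 * ddx a x * e\<^sup>2) / (D e x)\<^sup>2) has_real_derivative
       ((4 * a x * (ddx a x)\<^sup>2 + 2 * (a x)\<^sup>2 * ddx (ddx a) x) * e\<^sup>2 * (D e x)\<^sup>2 - (2 * (a x)\<^sup>2 * ddx a x * e\<^sup>2) * (2 * D e x * (2 * a x * ddx a x)))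
        / ((D e x)\<^sup>2 * (D e x)\<^sup>2)) (at x)"
      by (rule DERIV_divide[OF n dd]) (use D0 in simp)
    also have "((4 * a x * (ddx a x)\<^sup>2 + 2 * (a x)\<^sup>2 * ddx (ddx a) x) * e\<^sup>2 * (D e x)\<^sup>2 - (2 * (a x)\<^sup>2 * ddx a x * e\<^sup>2) * (2 * D e x * (2 * a x * ddx a x)))
        / ((D e x)\<^sup>2 * (D e x)\<^sup>2) = (4 * a x * (ddx a x)\<^sup>2 + 2 * (a x)\<^sup>2 * ddx (ddx a) x) * e\<^sup>2 / (D e x)\<^sup>2
      - 8 * a x ^ 3 * (ddx a x)\<^sup>2 * e\<^sup>2 / D e x ^ 3"
      using D0 by (simp add: field_simps power2_eq_square power3_eq_cube)
    finally have "((\<lambda>x. complex_of_real ((2 * (a x)\<^sup>2 * ddx a x * e\<^sup>2) / (D e x)\<^sup>2)) has_vector_derivative of_real ((4 * a x * (ddx a x)\<^sup>2 + 2 * (a x)\<^sup>2 * ddx (ddx a) x) * e\<^sup>2 / (D e x)\<^sup>2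
      - 8 * a x ^ 3 * (ddx a x)\<^sup>2 * e\<^sup>2 / D e x ^ 3)) (at x)"
      by (rule has_vector_derivative_of_real)
    moreover have "(\<lambda>x. complex_of_real ((2 * (a x)\<^sup>2 * ddx a x * e\<^sup>2) / (D e x)\<^sup>2)) = q e"
      by (rule ext) (simp add: q_def A_def chi1_def power2_eq_square)
    ultimately show "(q e has_vector_derivative of_real ((4 * a x * (ddx a x)\<^sup>2 + 2 * (a x)\<^sup>2 * ddx (ddx a) x) * e\<^sup>2 / (D e x)\<^sup>2
      - 8 * a x ^ 3 * (ddx a x)\<^sup>2 * e\<^sup>2 / D e x ^ 3)) (at x)" by simp
  qed
  have q1_sum: "q1 e x = A x * ddx (chi1 e) x + A1 x * chi1 e x" if e: "e > 0" for e x
  proof -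
    have "smooth (chi1 e)" using \<tau>C(4)[OF e] by (simp add: Cinf_S1_iff)
    from ddx_mult[OF smA(1) this] show ?thesis by (simp add: q1_def q_def[abs_def] dA)
  qed
  \<comment> \<open>Twice the bound of \<open>q1\<close>, plus \<open>2 * K\<close> each for
    \<open>chi1 * B\<close> and \<open>chi1 * A1\<close>; the last \<open>K\<close> is
    slack.\<close>
  define C where "C = 2 * (12 * K + 2 * M) + 5 * K"
  have C: "C > 0" using K(1) M(1) by (simp add: C_def)
  have bnds: "cmod (chi1 e x * B x) \<le> 2 * K * k e x" "cmod (chi1 e x * A1 x) \<le> 2 * K * k e x"
    "cmod (q e x * chi1 e x) \<le> K * k e x" "cmod (q1 e x) \<le> (12 * K + 2 * M) * k e x"
    "0 \<le> k e x" "k e x \<le> 1 / 4" if e: "e > 0" for e x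
    unfolding q1_eq[OF e] q_def A_def chi1_def B_def A1_def k_def D_def
    using cutoff_bounds[OF K(1) K(2)[of x] K(3)[of x] M(2)[of x] e]
    by (simp_all only: of_real_mult[symmetric] norm_of_real)
  have Wq1: "weak_deriv (\<lambda>x. q e x * u x) (\<lambda>x. q1 e x * u x + q e x * u1 x)" if e: "e > 0" for e
    unfolding q1_def
    by (rule W1[where \<tau>="chi1 e"]) (use \<tau>C(4)[OF e] in \<open>auto simp: q_def chi1_def\<close>)
  have Wq2: "weak_deriv (Q e) (\<lambda>x. q1 e x * u1 x + q e x * u2 x)" if e: "e > 0" for e
    unfolding q1_def Q_def[abs_def]
    by (rule W2[OF _ \<tau>C(3)[OF e]]) (simp add: q_def A_def chi1_def)
  have QL: "Q e \<in> L2_S1" if "e > 0" for e by (rule weak_deriv_L2(1)[OF Wq2[OF that]])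
  have Wchi: "weak_deriv (\<lambda>x. chi e x * u x) (\<lambda>x. chi1 e x * u x + chi e x * u1 x)" if e: "e > 0" for e
    using W1[OF _ \<tau>C(1)[OF e], of "chi e"] dchi[OF e] by (simp add: chi_def A_def power2_eq_square)
  have Wchi2: "weak_deriv (\<lambda>x. chi e x * u1 x) (\<lambda>x. chi1 e x * u1 x + chi e x * u2 x)" if e: "e > 0" for e
    using W2[OF _ \<tau>C(2)[OF e], of "chi e"] dchi[OF e] by (simp add: chi_def A_def power2_eq_square)
  have Wchi1: "weak_deriv (\<lambda>x. chi1 e x * u x) (\<lambda>x. ddx (chi1 e) x * u x + chi1 e x * u1 x)" if e: "e > 0" for e
    by (rule W1[OF _ \<tau>C(3)[OF e]]) (simp_all add: chi1_def A_def a0)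
  have kint: "integrable S1 (\<lambda>x. k e x * ((cmod (u x))\<^sup>2 + (cmod (h x))\<^sup>2))" if e: "e > 0" for e
  proof (rule Bochner_Integration.integrable_bound)
    show "integrable S1 (\<lambda>x. (cmod (u x))\<^sup>2 + (cmod (h x))\<^sup>2)"
      by (intro Bochner_Integration.integrable_add L2_sq_integrable uL hL)
    have "k e \<in> Cinf_S1"
      unfolding k_def[abs_def] using Dp[OF e]
      by (intro Cinf_divide Cinf_mult Cinf_power Cinf_const a DC; simp add: order_less_imp_not_eq2)
    then have "k e \<in> borel_measurable S1" by (intro measurable_S1 Cinf_measurable)
    moreover have "u \<in> borel_measurable S1" "h \<in> borel_measurable S1" by (intro L2_measurable uL hL)+
    ultimately show "(\<lambda>x. k e x * ((cmod (u x))\<^sup>2 + (cmod (h x))\<^sup>2)) \<in> borel_measurable S1" by measurable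
    show "AE x in S1. norm (k e x * ((cmod (u x))\<^sup>2 + (cmod (h x))\<^sup>2)) \<le> norm ((cmod (u x))\<^sup>2 + (cmod (h x))\<^sup>2)"
    proof (rule AE_I2)
      fix x
      have "k e x * ((cmod (u x))\<^sup>2 + (cmod (h x))\<^sup>2) \<le> 1 * ((cmod (u x))\<^sup>2 + (cmod (h x))\<^sup>2)"
        using bnds(6)[OF e, of x] by (intro mult_right_mono) auto
      then show "norm (k e x * ((cmod (u x))\<^sup>2 + (cmod (h x))\<^sup>2)) \<le> norm ((cmod (u x))\<^sup>2 + (cmod (h x))\<^sup>2)"
        using bnds(5)[OF e, of x] by simp
    qed
  qed
  \<comment> \<open>\<open>C^2\<close> comes from splitting off the term linear in \<open>Q\<close>
    by Young's inequality, \<open>C * (N + 1)\<close> from the terms with \<open>B1 * u\<close> and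
    \<open>h\<close>.\<close>
  define C' where "C' = C\<^sup>2 + C * (N + 1)"
  text \<open>Caccioppoli estimate: integrate \<open>(q u1)'\<close> by parts against the conjugate of \<open>q u\<close>.\<close>
  have energy: "sqn (Q e) \<le> 2 * C' * (LINT x|S1. k e x * ((cmod (u x))\<^sup>2 + (cmod (h x))\<^sup>2))" if e: "e > 0" for e
  proof -
    have q1C: "q1 e \<in> Cinf_S1" unfolding q1_def by (rule Cinf_ddx[OF qC[OF e]])
    have re: "cnj (q e x) = q e x" "cnj (q1 e x) = q1 e x" for x
      by (simp_all add: q_def A_def chi1_def q1_eq[OF e])
    define T1 where "T1 x = cnj (q e x * u x) * (q1 e x * u1 x + q e x * u2 x)" for x
    define T2 where "T2 x = cnj (q1 e x * u x) * Q e x" for x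
    have L: "(\<lambda>x. cnj (q e x * u x)) \<in> L2_S1" "(\<lambda>x. q1 e x * u1 x + q e x * u2 x) \<in> L2_S1"
      "(\<lambda>x. cnj (q1 e x * u x)) \<in> L2_S1" "(\<lambda>x. cnj (Q e x)) \<in> L2_S1"
      by (intro L2_cnj L2_Cmult uL qC q1C QL e weak_deriv_L2(2)[OF Wq2[OF e]])+
    have I: "integrable S1 T1" "integrable S1 T2" "integrable S1 (\<lambda>x. Q e x * cnj (Q e x))"
      unfolding T1_def T2_def by (intro L2_prod_integrable L QL e)+
    have "(LINT x|S1. T1 x) = - (LINT x|S1. cnj (q1 e x * u x + q e x * u1 x) * Q e x)"
      unfolding T1_def by (rule weak_deriv_parts[OF weak_deriv_cnj[OF Wq1[OF e]] Wq2[OF e]])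
    also have "(LINT x|S1. cnj (q1 e x * u x + q e x * u1 x) * Q e x) = (LINT x|S1. T2 x + Q e x * cnj (Q e x))"
      by (rule Bochner_Integration.integral_cong) (simp_all add: T2_def Q_def algebra_simps)
    also have "\<dots> = (LINT x|S1. T2 x) + of_real (sqn (Q e))"
      unfolding sqn_eq_integral by (rule Bochner_Integration.integral_add[OF I(2,3)])
    finally have "of_real (sqn (Q e)) = - ((LINT x|S1. T1 x) + (LINT x|S1. T2 x))" by (simp add: algebra_simps)
    also have "(LINT x|S1. T1 x) + (LINT x|S1. T2 x) = (LINT x|S1. T1 x + T2 x)"
      by (rule Bochner_Integration.integral_add[OF I(1,2), symmetric])
    finally have "cmod (of_real (sqn (Q e))) = cmod (- (LINT x|S1. T1 x + T2 x))" by (rule arg_cong)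
    then have "sqn (Q e) = cmod (LINT x|S1. T1 x + T2 x)" by simp
    also have "\<dots> \<le> (LINT x|S1. cmod (T1 x + T2 x))" by (rule integral_norm_bound)
    also have "\<dots> \<le> (LINT x|S1. (1/2) * (cmod (Q e x))\<^sup>2 + C' * (k e x * ((cmod (u x))\<^sup>2 + (cmod (h x))\<^sup>2)))"
    proof (rule integral_mono_AE)
      show "integrable S1 (\<lambda>x. cmod (T1 x + T2 x))"
        by (intro integrable_norm Bochner_Integration.integrable_add I)
      show "integrable S1 (\<lambda>x. (1/2) * (cmod (Q e x))\<^sup>2 + C' * (k e x * ((cmod (u x))\<^sup>2 + (cmod (h x))\<^sup>2)))"
        by (intro Bochner_Integration.integrable_add integrable_mult_right L2_sq_integrable QL e kint)
      show "AE x in S1. cmod (T1 x + T2 x) \<le> (1/2) * (cmod (Q e x))\<^sup>2 + C' * (k e x * ((cmod (u x))\<^sup>2 + (cmod (h x))\<^sup>2))"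
        using nz
      proof eventually_elim
        case (elim x)
        then have Ax: "A x \<noteq> 0" by (simp add: A_0)
        have kk: "0 \<le> k e x" "k e x \<le> 1 / 4" by (rule bnds[OF e])+
        \<comment> \<open>One factor \<open>q\<close> contains \<open>a\<close>, so the equation for
          \<open>a u''\<close> removes the second derivative. What remains is affine in
          \<open>Q\<close>, with coefficients of size \<open>k\<close>.\<close>
        have qqu2: "q e x * (q e x * u2 x) = q e x * chi1 e x * (\<i> * B1 x * u x + h x)
            + (\<i> * (chi1 e x * B x) - chi1 e x * A1 x) * Q e x"
        proof -
          have "q e x * (q e x * u2 x) = q e x * chi1 e x * (A x * u2 x)" by (simp add: q_def algebra_simps)
          also have "\<dots> = q e x * chi1 e x * (\<i> * B1 x * u x + \<i> * B x * u1 x + h x - A1 x * u1 x)"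
            by (simp only: Au2[OF Ax])
          finally show ?thesis by (simp add: Q_def algebra_simps)
        qed
        have "T1 x = cnj (u x) * (q1 e x * Q e x + q e x * (q e x * u2 x))"
          unfolding T1_def complex_cnj_mult re by (simp add: Q_def algebra_simps)
        then have "T1 x + T2 x = cnj (u x) * ((2 * q1 e x + (\<i> * (chi1 e x * B x) - chi1 e x * A1 x)) * Q e x
            + q e x * chi1 e x * (\<i> * B1 x * u x + h x))"
          unfolding T2_def complex_cnj_mult re qqu2 by (simp add: algebra_simps)
        then have "cmod (T1 x + T2 x) = cmod (u x) * cmod ((2 * q1 e x + (\<i> * (chi1 e x * B x) - chi1 e x * A1 x)) * Q e x
            + q e x * chi1 e x * (\<i> * B1 x * u x + h x))" by (simp add: norm_mult)
        also have "\<dots> \<le> cmod (u x) * ((C * k e x) * cmod (Q e x) + (C * k e x) * (N * cmod (u x) + cmod (h x)))"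
        proof (intro mult_left_mono norm_triangle_le add_mono)
          have "cmod (2 * q1 e x + (\<i> * (chi1 e x * B x) - chi1 e x * A1 x)) \<le> 2 * cmod (q1 e x) + (cmod (chi1 e x * B x) + cmod (chi1 e x * A1 x))"
          proof -
            have "cmod (\<i> * (chi1 e x * B x) - chi1 e x * A1 x) \<le> cmod (\<i> * (chi1 e x * B x)) + cmod (chi1 e x * A1 x)"
              by (rule norm_triangle_ineq4)
            also have "cmod (\<i> * (chi1 e x * B x)) = cmod (chi1 e x * B x)" by (simp add: norm_mult)
            finally show ?thesis
              using norm_triangle_ineq[of "2 * q1 e x" "\<i> * (chi1 e x * B x) - chi1 e x * A1 x"] by simp
          qed
          also have "\<dots> \<le> 2 * ((12 * K + 2 * M) * k e x) + (2 * K * k e x + 2 * K * k e x)"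
            by (intro add_mono mult_left_mono bnds e) simp
          also have "\<dots> \<le> C * k e x" using kk K(1) by (simp add: C_def algebra_simps)
          finally show "cmod ((2 * q1 e x + (\<i> * (chi1 e x * B x) - chi1 e x * A1 x)) * Q e x) \<le> C * k e x * cmod (Q e x)"
            unfolding norm_mult by (rule mult_right_mono) simp
          have "cmod (\<i> * B1 x * u x + h x) \<le> cmod (\<i> * B1 x * u x) + cmod (h x)" by (rule norm_triangle_ineq)
          also have "cmod (\<i> * B1 x * u x) = cmod (B1 x) * cmod (u x)" by (simp add: norm_mult)
          also have "\<dots> \<le> N * cmod (u x)" by (rule mult_right_mono[OF N(2)]) simp
          finally have "cmod (\<i> * B1 x * u x + h x) \<le> N * cmod (u x) + cmod (h x)" by simp
          moreover have "cmod (q e x * chi1 e x) \<le> C * k e x"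
          proof (rule order_trans[OF bnds(3)[OF e]])
            show "K * k e x \<le> C * k e x" using K(1) M(1) kk by (intro mult_right_mono) (simp_all add: C_def)
          qed
          ultimately show "cmod (q e x * chi1 e x * (\<i> * B1 x * u x + h x)) \<le> C * k e x * (N * cmod (u x) + cmod (h x))"
            unfolding norm_mult[of "q e x * chi1 e x"] using C kk by (intro mult_mono) auto
        qed simp
        also have "\<dots> \<le> (1/2) * (cmod (Q e x))\<^sup>2 + C' * (k e x * ((cmod (u x))\<^sup>2 + (cmod (h x))\<^sup>2))"
        proof -
          \<comment> \<open>Young's inequality leaves half of \<open>|Q|^2\<close>, to be absorbed
            on the left, whence the factor 2 in the energy bound; \<open>kx^2 <= kx\<close> keeps
            the weight to the first power.\<close>
          have gen: "U * ((C * kx) * R + (C * kx) * (N * U + H)) \<le> (1/2) * R\<^sup>2 + C' * (kx * (U\<^sup>2 + H\<^sup>2))"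
            if "0 \<le> kx" "kx \<le> 1 / 4" "0 \<le> U" "0 \<le> H" "0 \<le> R" for U R H kx :: real
          proof -
            have 1: "(C * kx * U) * R \<le> (1/2) * R\<^sup>2 + (1/2) * (C * kx * U)\<^sup>2"
              using sum_squares_bound[of "C * kx * U" R] by (simp add: mult.assoc)
            have "(C * kx * U)\<^sup>2 = (C\<^sup>2 * kx * U\<^sup>2) * kx" by (simp add: power2_eq_square)
            also have "\<dots> \<le> (C\<^sup>2 * kx * U\<^sup>2) * 1" using that by (intro mult_left_mono) auto
            finally have 2: "(C * kx * U)\<^sup>2 \<le> C\<^sup>2 * kx * U\<^sup>2" by simp
            have "2 * (U * H) \<le> U\<^sup>2 + H\<^sup>2" using sum_squares_bound[of U H] by (simp add: mult.assoc)
            then have "U * H \<le> U\<^sup>2 + H\<^sup>2" using mult_nonneg_nonneg[OF that(3,4)] by linarith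
            moreover have "U * (N * U + H) = N * U\<^sup>2 + U * H" by (simp add: power2_eq_square algebra_simps)
            ultimately have "U * (N * U + H) \<le> N * U\<^sup>2 + (U\<^sup>2 + H\<^sup>2)" by linarith
            also have "\<dots> \<le> (N + 1) * (U\<^sup>2 + H\<^sup>2)" using N(1) by (simp add: algebra_simps)
            finally have 3: "(C * kx) * (U * (N * U + H)) \<le> (C * kx) * ((N + 1) * (U\<^sup>2 + H\<^sup>2))"
              using C that by (intro mult_left_mono) auto
            have 4: "C\<^sup>2 * kx * U\<^sup>2 \<le> C\<^sup>2 * kx * (U\<^sup>2 + H\<^sup>2)" using that by (intro mult_left_mono) auto
            have "U * ((C * kx) * R + (C * kx) * (N * U + H)) = (C * kx * U) * R + (C * kx) * (U * (N * U + H))"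
              by (simp add: algebra_simps)
            also have "\<dots> \<le> (1/2) * R\<^sup>2 + (C\<^sup>2 * kx * (U\<^sup>2 + H\<^sup>2) + (C * kx) * ((N + 1) * (U\<^sup>2 + H\<^sup>2)))"
              using 1 2 3 4 zero_le_power2[of "C * kx * U"] by linarith
            also have "\<dots> = (1/2) * R\<^sup>2 + C' * (kx * (U\<^sup>2 + H\<^sup>2))" by (simp add: C'_def algebra_simps)
            finally show ?thesis .
          qed
          show ?thesis by (rule gen[OF kk]) simp_all
        qed
        finally show ?case .
      qed
    qed
    also have "\<dots> = (1/2) * sqn (Q e) + C' * (LINT x|S1. k e x * ((cmod (u x))\<^sup>2 + (cmod (h x))\<^sup>2))"
      using L2_sq_integrable[OF QL[OF e]] kint[OF e] unfolding sqn_def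
      by (subst Bochner_Integration.integral_add) auto
    finally show ?thesis by simp
  qed
  define \<epsilon> where "\<epsilon> n = inverse (real (Suc n))" for n
  have \<epsilon>: "\<epsilon> n > 0" for n by (simp add: \<epsilon>_def)
  have \<epsilon>l: "(\<lambda>n. (\<epsilon> n)\<^sup>2 / (a x)\<^sup>2) \<longlonglongrightarrow> 0" for x
  proof (rule tendsto_divide_zero)
    show "(\<lambda>n. (\<epsilon> n)\<^sup>2) \<longlonglongrightarrow> 0"
      using tendsto_power[OF LIMSEQ_inverse_real_of_nat, of 2] by (simp add: \<epsilon>_def)
  qed
  have kl: "(\<lambda>n. k (\<epsilon> n) x) \<longlonglongrightarrow> 0" if "a x \<noteq> 0" for x
  proof (rule tendsto_sandwich[OF _ _ tendsto_const \<epsilon>l]; intro always_eventually allI)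
    fix n
    show "0 \<le> k (\<epsilon> n) x" by (rule bnds[OF \<epsilon>])
    have "k (\<epsilon> n) x = (\<epsilon> n)\<^sup>2 * ((a x)\<^sup>2 / (D (\<epsilon> n) x)\<^sup>2)" by (simp add: k_def)
    also have "\<dots> \<le> (\<epsilon> n)\<^sup>2 * ((a x)\<^sup>2 / ((a x)\<^sup>2)\<^sup>2)"
      using that by (intro mult_left_mono divide_left_mono power_mono mult_pos_pos) (auto simp: D_def add_pos_nonneg)
    also have "\<dots> = (\<epsilon> n)\<^sup>2 / (a x)\<^sup>2" using that by (simp add: power2_eq_square)
    finally show "k (\<epsilon> n) x \<le> (\<epsilon> n)\<^sup>2 / (a x)\<^sup>2" .
  qed
  have chi_bound: "cmod (chi e x - 1) \<le> 1" "cmod (chi e x - 1) = e\<^sup>2 / D e x" if e: "e > 0" for e x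
  proof -
    have "(a x)\<^sup>2 / D e x = (D e x - e\<^sup>2) / D e x" by (simp add: D_def)
    also have "\<dots> = 1 - e\<^sup>2 / D e x" using Dp[OF e, of x] by (simp add: diff_divide_distrib)
    finally have "(a x)\<^sup>2 / D e x - 1 = - (e\<^sup>2 / D e x)" by simp
    then have "chi e x - 1 = of_real (- (e\<^sup>2 / D e x))" unfolding chi_def by (metis of_real_1 of_real_diff)
    then show "cmod (chi e x - 1) = e\<^sup>2 / D e x" using Dp[OF e, of x] by (simp only: norm_of_real) simp
    then show "cmod (chi e x - 1) \<le> 1" using Dp[OF e, of x] by (simp add: D_def)
  qed
  have chil: "(\<lambda>n. chi (\<epsilon> n) x - 1) \<longlonglongrightarrow> 0" if "a x \<noteq> 0" for x
  proof (rule Lim_null_comparison[OF always_eventually[OF allI] \<epsilon>l])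
    fix n
    show "cmod (chi (\<epsilon> n) x - 1) \<le> (\<epsilon> n)\<^sup>2 / (a x)\<^sup>2"
      unfolding chi_bound(2)[OF \<epsilon>] using that Dp[OF \<epsilon>, of n x]
      by (intro divide_left_mono mult_pos_pos) (auto simp: D_def)
  qed
  have nzl: "AE x in S1. (\<lambda>n. k (\<epsilon> n) x) \<longlonglongrightarrow> 0 \<and> (\<lambda>n. chi (\<epsilon> n) x - 1) \<longlonglongrightarrow> 0"
    using nz by eventually_elim (use kl chil in auto)
  \<comment> \<open>The weight is at most 1/4 and tends to 0 wherever \<open>a\<close> does not
    vanish, that is almost everywhere; the majorant does not depend on n.\<close>
  have "(\<lambda>n. LINT x|S1. k (\<epsilon> n) x * ((cmod (u x))\<^sup>2 + (cmod (h x))\<^sup>2)) \<longlonglongrightarrow> (LINT x|S1. (0::real))"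
  proof (rule integral_dominated_convergence[where w="\<lambda>x. (cmod (u x))\<^sup>2 + (cmod (h x))\<^sup>2"])
    show "integrable S1 (\<lambda>x. (cmod (u x))\<^sup>2 + (cmod (h x))\<^sup>2)"
      by (intro Bochner_Integration.integrable_add L2_sq_integrable uL hL)
    show "(\<lambda>x. k (\<epsilon> n) x * ((cmod (u x))\<^sup>2 + (cmod (h x))\<^sup>2)) \<in> borel_measurable S1" for n
      using kint[OF \<epsilon>] by (rule borel_measurable_integrable)
    show "AE x in S1. (\<lambda>n. k (\<epsilon> n) x * ((cmod (u x))\<^sup>2 + (cmod (h x))\<^sup>2)) \<longlonglongrightarrow> 0"
      using nzl by eventually_elim (rule tendsto_mult_left_zero, simp)
    show "AE x in S1. norm (k (\<epsilon> n) x * ((cmod (u x))\<^sup>2 + (cmod (h x))\<^sup>2)) \<le> (cmod (u x))\<^sup>2 + (cmod (h x))\<^sup>2" for n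
    proof (rule AE_I2)
      fix x
      have "k (\<epsilon> n) x * ((cmod (u x))\<^sup>2 + (cmod (h x))\<^sup>2) \<le> 1 * ((cmod (u x))\<^sup>2 + (cmod (h x))\<^sup>2)"
        using bnds(6)[OF \<epsilon>, of n x] by (intro mult_right_mono) auto
      then show "norm (k (\<epsilon> n) x * ((cmod (u x))\<^sup>2 + (cmod (h x))\<^sup>2)) \<le> (cmod (u x))\<^sup>2 + (cmod (h x))\<^sup>2"
        using bnds(5)[OF \<epsilon>, of n x] by simp
    qed
  qed simp
  then have Il: "(\<lambda>n. 2 * C' * (LINT x|S1. k (\<epsilon> n) x * ((cmod (u x))\<^sup>2 + (cmod (h x))\<^sup>2))) \<longlonglongrightarrow> 0"
    by (intro tendsto_mult_right_zero) simp
  have Ql: "(\<lambda>n. sqn (Q (\<epsilon> n))) \<longlonglongrightarrow> 0"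
    by (rule tendsto_sandwich[OF _ _ tendsto_const Il]) (auto intro!: always_eventually energy \<epsilon>)
  define g where "g n x = chi (\<epsilon> n) x * u x" for n x
  define R where "R n x = (chi (\<epsilon> n) x - 1) * v x + (q1 (\<epsilon> n) x - \<i> * (chi1 (\<epsilon> n) x * B x)) * u x" for n x
  \<comment> \<open>\<open>P (chi u)\<close> as expanded by the Leibniz rule; \<open>R\<close> is
    what remains of \<open>w - v\<close> without the term \<open>2 * Q\<close>.\<close>
  define w where "w n x = chi (\<epsilon> n) x * v x + 2 * Q (\<epsilon> n) x + (q1 (\<epsilon> n) x - \<i> * (chi1 (\<epsilon> n) x * B x)) * u x" for n x
  have q1C: "q1 (\<epsilon> n) \<in> Cinf_S1" for n unfolding q1_def by (rule Cinf_ddx[OF qC[OF \<epsilon>]])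
  have gL: "g n \<in> L2_S1" for n unfolding g_def[abs_def] by (intro L2_Cmult chiC uL \<epsilon>)
  have wL: "w n \<in> L2_S1" for n
    unfolding w_def[abs_def] by (intro L2_add L2_cmult L2_Cmult chiC uL vL \<epsilon> QL Cinf_diff Cinf_mult Cinf_const q1C \<tau>C AC)
  have RL: "R n \<in> L2_S1" for n
    unfolding R_def[abs_def] by (intro L2_add L2_cmult L2_Cmult chiC uL vL \<epsilon> QL Cinf_diff Cinf_mult Cinf_const q1C \<tau>C AC)
  have gl: "(\<lambda>n. sqn (\<lambda>x. g n x - u x)) \<longlonglongrightarrow> 0"
  proof (rule sqn_tendsto_0[OF L2_measurable[OF L2_diff[OF gL uL]] _ L2_sq_integrable[OF uL]])
    have ge: "g n x - u x = (chi (\<epsilon> n) x - 1) * u x" for n x by (simp add: g_def algebra_simps)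
    show "AE x in S1. (\<lambda>n. g n x - u x) \<longlonglongrightarrow> 0"
      unfolding ge using nzl by eventually_elim (rule tendsto_mult_left_zero, simp)
    have "(cmod ((chi (\<epsilon> n) x - 1) * u x))\<^sup>2 \<le> (1 * cmod (u x))\<^sup>2" for n x
      unfolding norm_mult using chi_bound(1)[OF \<epsilon>] by (intro power_mono mult_right_mono) auto
    then show "AE x in S1. (cmod (g n x - u x))\<^sup>2 \<le> (cmod (u x))\<^sup>2" for n unfolding ge by simp
  qed
  have sb: "cmod (q1 (\<epsilon> n) x - \<i> * (chi1 (\<epsilon> n) x * B x)) \<le> C * k (\<epsilon> n) x" for n x
  proof -
    have "cmod (q1 (\<epsilon> n) x - \<i> * (chi1 (\<epsilon> n) x * B x)) \<le> cmod (q1 (\<epsilon> n) x) + cmod (\<i> * (chi1 (\<epsilon> n) x * B x))"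
      by (rule norm_triangle_ineq4)
    also have "cmod (\<i> * (chi1 (\<epsilon> n) x * B x)) = cmod (chi1 (\<epsilon> n) x * B x)" by (simp add: norm_mult)
    also have "cmod (q1 (\<epsilon> n) x) + cmod (chi1 (\<epsilon> n) x * B x) \<le> (12 * K + 2 * M) * k (\<epsilon> n) x + 2 * K * k (\<epsilon> n) x"
      by (intro add_mono bnds \<epsilon>)
    also have "\<dots> = (14 * K + 2 * M) * k (\<epsilon> n) x" by (simp add: algebra_simps)
    also have "\<dots> \<le> C * k (\<epsilon> n) x"
      using bnds(5)[OF \<epsilon>, of n x] K(1) M(1) by (intro mult_right_mono) (simp_all add: C_def)
    finally show ?thesis .
  qed
  have Rl: "(\<lambda>n. sqn (R n)) \<longlonglongrightarrow> 0"
  proof (rule sqn_tendsto_0[OF L2_measurable[OF RL], where w="\<lambda>x. 2 * (cmod (v x))\<^sup>2 + 2 * (C\<^sup>2 * (cmod (u x))\<^sup>2)"])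
    show "integrable S1 (\<lambda>x. 2 * (cmod (v x))\<^sup>2 + 2 * (C\<^sup>2 * (cmod (u x))\<^sup>2))"
      by (intro Bochner_Integration.integrable_add integrable_mult_right L2_sq_integrable uL vL)
    show "AE x in S1. (\<lambda>n. R n x) \<longlonglongrightarrow> 0"
      using nzl
    proof eventually_elim
      case (elim x)
      have "(\<lambda>n. C * k (\<epsilon> n) x) \<longlonglongrightarrow> 0" using elim by (intro tendsto_mult_right_zero) simp
      then have "(\<lambda>n. q1 (\<epsilon> n) x - \<i> * (chi1 (\<epsilon> n) x * B x)) \<longlonglongrightarrow> 0"
        by (rule Lim_null_comparison[OF always_eventually[OF allI[OF sb]]])
      then show ?case unfolding R_def using elim by (intro tendsto_add_zero tendsto_mult_left_zero) auto
    qed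
    show "AE x in S1. (cmod (R n x))\<^sup>2 \<le> 2 * (cmod (v x))\<^sup>2 + 2 * (C\<^sup>2 * (cmod (u x))\<^sup>2)" for n
    proof (rule AE_I2)
      fix x
      have "(cmod (R n x))\<^sup>2 \<le> 2 * (cmod ((chi (\<epsilon> n) x - 1) * v x))\<^sup>2 + 2 * (cmod ((q1 (\<epsilon> n) x - \<i> * (chi1 (\<epsilon> n) x * B x)) * u x))\<^sup>2"
        unfolding R_def by (rule sum_sq_bound)
      also have "\<dots> \<le> 2 * (1 * cmod (v x))\<^sup>2 + 2 * (C * cmod (u x))\<^sup>2"
      proof (intro add_mono mult_left_mono power_mono)
        show "cmod ((chi (\<epsilon> n) x - 1) * v x) \<le> 1 * cmod (v x)"
          unfolding norm_mult using chi_bound(1)[OF \<epsilon>] by (intro mult_right_mono) auto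
        have "C * k (\<epsilon> n) x \<le> C * 1" using bnds(6)[OF \<epsilon>, of n x] C by (intro mult_left_mono) auto
        then show "cmod ((q1 (\<epsilon> n) x - \<i> * (chi1 (\<epsilon> n) x * B x)) * u x) \<le> C * cmod (u x)"
          unfolding norm_mult using sb[of n x] by (intro mult_right_mono) auto
      qed auto
      finally show "(cmod (R n x))\<^sup>2 \<le> 2 * (cmod (v x))\<^sup>2 + 2 * (C\<^sup>2 * (cmod (u x))\<^sup>2)" by (simp add: power_mult_distrib)
    qed
  qed
  have wl: "(\<lambda>n. sqn (\<lambda>x. w n x - v x)) \<longlonglongrightarrow> 0"
  proof (rule tendsto_sandwich[OF _ _ tendsto_const])
    show "(\<lambda>n. 2 * sqn (R n) + 2 * (4 * sqn (Q (\<epsilon> n)))) \<longlonglongrightarrow> 0"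
      using tendsto_add_zero[OF tendsto_mult_right_zero[OF Rl, of 2] tendsto_mult_right_zero[OF Ql, of 8]] by simp
    have "sqn (\<lambda>x. w n x - v x) \<le> 2 * sqn (R n) + 2 * (4 * sqn (Q (\<epsilon> n)))" for n
    proof -
      have "(\<lambda>x. w n x - v x) = (\<lambda>x. R n x + 2 * Q (\<epsilon> n) x)" by (rule ext) (simp add: w_def R_def algebra_simps)
      moreover have "sqn (\<lambda>x. 2 * Q (\<epsilon> n) x) \<le> 2\<^sup>2 * sqn (Q (\<epsilon> n))"
        by (rule sqn_mono[OF L2_cmult QL]) (auto simp: norm_mult intro: QL \<epsilon>)
      ultimately show ?thesis using sqn_add[OF RL[of n] L2_cmult[OF QL[OF \<epsilon>[of n]], of 2]] by simp
    qed
    then show "\<forall>\<^sub>F n in sequentially. sqn (\<lambda>x. w n x - v x) \<le> 2 * sqn (R n) + 2 * (4 * sqn (Q (\<epsilon> n)))" by simp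
  qed simp
  have approx: "\<exists>\<phi>\<in>Cinf_S1. sqn (\<lambda>x. \<phi> x - g n x) < d \<and> sqn (\<lambda>x. op_P a b c \<phi> x - w n x) < d" if d: "d > 0" for n d
  proof (rule second_order_approx[OF _ weak_deriv_add[OF Wchi1[OF \<epsilon>] Wchi2[OF \<epsilon>]] d wL])
    show "weak_deriv (g n) (\<lambda>x. chi1 (\<epsilon> n) x * u x + chi (\<epsilon> n) x * u1 x)"
      unfolding g_def[abs_def] by (rule Wchi[OF \<epsilon>])
    fix x
    define c0 c1 c2 where "c0 = chi (\<epsilon> n) x" and "c1 = chi1 (\<epsilon> n) x" and "c2 = ddx (chi1 (\<epsilon> n)) x"
    have q1e: "q1 (\<epsilon> n) x = A x * c2 + A1 x * c1" unfolding c1_def c2_def by (rule q1_sum[OF \<epsilon>])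
    have Qe: "Q (\<epsilon> n) x = A x * c1 * u1 x" by (simp add: Q_def q_def c1_def)
    have "c0 * v x + 2 * (A x * c1 * u1 x) + ((A x * c2 + A1 x * c1) - \<i> * (c1 * B x)) * u x =
      A x * (c2 * u x + c1 * u1 x + (c1 * u1 x + c0 * u2 x)) + A1 x * (c1 * u x + c0 * u1 x)
      - \<i> * B x * (c1 * u x + c0 * u1 x) - \<i> / 2 * B1 x * (c0 * u x) + of_real (c x) * (c0 * u x)"
    \<comment> \<open>The identity is needed at every point. At a zero of \<open>a\<close> the
      cutoff and its derivative vanish as well.\<close>
    proof (cases "A x = 0")
      case True
      then have "a x = 0" by (simp add: A_0)
      then have "c0 = 0" "c1 = 0" by (auto simp: c0_def c1_def chi_def chi1_def)
      with True show ?thesis by simp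
    next
      case False
      have v: "v x = h x + (\<i> / 2 * B1 x + of_real (c x)) * u x" by (simp add: h_def B1_def)
      have "A x * (c2 * u x + c1 * u1 x + (c1 * u1 x + c0 * u2 x)) = A x * c2 * u x + 2 * (A x * c1 * u1 x) + c0 * (A x * u2 x)"
        by (simp add: algebra_simps)
      also have "\<dots> = A x * c2 * u x + 2 * (A x * c1 * u1 x) + c0 * (\<i> * B1 x * u x + \<i> * B x * u1 x + h x - A1 x * u1 x)"
        by (simp only: Au2[OF False])
      finally show ?thesis unfolding v by (simp only:) (simp add: field_simps)
    qed
    then show "w n x = of_real (a x) * (ddx (chi1 (\<epsilon> n)) x * u x + chi1 (\<epsilon> n) x * u1 x + (chi1 (\<epsilon> n) x * u1 x + chi (\<epsilon> n) x * u2 x))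
      + of_real (ddx a x) * (chi1 (\<epsilon> n) x * u x + chi (\<epsilon> n) x * u1 x)
      - \<i> * of_real (b x) * (chi1 (\<epsilon> n) x * u x + chi (\<epsilon> n) x * u1 x) - \<i> / 2 * of_real (ddx b x) * g n x + of_real (c x) * g n x"
      unfolding w_def q1e Qe unfolding g_def c0_def c1_def c2_def A_def A1_def B_def B1_def .
  qed
  show ?thesis
  proof (rule closureI[OF uL vL])
    fix d :: real assume d: "d > 0"
    then have d4: "d / 4 > 0" by simp
    from order_tendstoD(2)[OF gl d4] order_tendstoD(2)[OF wl d4]
    have "\<forall>\<^sub>F n in sequentially. sqn (\<lambda>x. g n x - u x) < d / 4 \<and> sqn (\<lambda>x. w n x - v x) < d / 4"
      by (rule eventually_conj)
    then obtain n where n: "sqn (\<lambda>x. g n x - u x) < d / 4" "sqn (\<lambda>x. w n x - v x) < d / 4"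
      by (auto simp: eventually_sequentially)
    obtain \<phi> where \<phi>: "\<phi> \<in> Cinf_S1" "sqn (\<lambda>x. \<phi> x - g n x) < d / 4" "sqn (\<lambda>x. op_P a b c \<phi> x - w n x) < d / 4"
      using approx[OF d4] by blast
    have "sqn (\<lambda>x. \<phi> x - u x) < d"
      using sqn_trans[OF Cinf_L2[OF \<phi>(1)] gL[of n] uL] n(1) \<phi>(2) by linarith
    moreover have "sqn (\<lambda>x. op_P a b c \<phi> x - v x) < d"
      using sqn_trans[OF Cinf_L2[OF op_P_Cinf[OF \<phi>(1)]] wL[of n] vL] n(2) \<phi>(3) by linarith
    ultimately show "\<exists>\<phi>\<in>Cinf_S1. sqn (\<lambda>x. \<phi> x - u x) < d \<and> sqn (\<lambda>x. op_P a b c \<phi> x - v x) < d"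
      using \<phi>(1) by blast
  qed
qed

end

section \<open>Periodisation\<close>

text \<open>The period starting at \<open>l\<close> is cut at \<open>l + t\<close>, where
  \<open>t\<close> is the fractional part of \<open>m - l\<close>; translating the right piece by
  \<open>n\<close> and the left piece by \<open>n + 1\<close> yields the period starting at
  \<open>m\<close>. Half-open intervals make the pieces fit without overlap.\<close>

lemma periodic_shift:
  fixes f :: "real \<Rightarrow> 'a::{banach, second_countable_topology}"
  assumes per: "periodic1 f" and int: "integrable lborel (\<lambda>x. indicator {l..<l+1} x *\<^sub>R f x)"
  shows "integrable lborel (\<lambda>x. indicator {m..<m+1} x *\<^sub>R f x)"
    and "(LINT x|lborel. indicator {m..<m+1} x *\<^sub>R f x) = (LINT x|lborel. indicator {l..<l+1} x *\<^sub>R f x)"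
proof -
  define n where "n = \<lfloor>m - l\<rfloor>"
  define t where "t = frac (m - l)"
  have m: "m = l + of_int n + t" by (simp add: n_def t_def frac_def)
  have t: "0 \<le> t" "t < 1" by (auto simp: t_def frac_lt_1)
  define g1 where "g1 x = indicator {l..<l+t} x *\<^sub>R f x" for x
  define g2 where "g2 x = indicator {l+t..<l+1} x *\<^sub>R f x" for x
  have "integrable lborel (\<lambda>x. indicator {l..<l+t} x *\<^sub>R (indicator {l..<l+1} x *\<^sub>R f x))"
    "integrable lborel (\<lambda>x. indicator {l+t..<l+1} x *\<^sub>R (indicator {l..<l+1} x *\<^sub>R f x))"
    by (rule integrable_mult_indicator[OF _ int]; simp)+
  moreover have "(\<lambda>x. indicator {l..<l+t} x *\<^sub>R (indicator {l..<l+1} x *\<^sub>R f x)) = g1"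
    "(\<lambda>x. indicator {l+t..<l+1} x *\<^sub>R (indicator {l..<l+1} x *\<^sub>R f x)) = g2"
    using t by (auto simp: g1_def g2_def indicator_def)
  ultimately have g: "integrable lborel g1" "integrable lborel g2" by simp_all
  have s: "(\<lambda>x. indicator {l..<l+1} x *\<^sub>R f x) = (\<lambda>x. g1 x + g2 x)"
    using t by (auto simp: g1_def g2_def indicator_def)
  have h: "integrable lborel (\<lambda>x. g1 (- of_int (n + 1) + 1 * x))" "integrable lborel (\<lambda>x. g2 (- of_int n + 1 * x))"
    by (rule lborel_integrable_real_affine[OF g(1)] lborel_integrable_real_affine[OF g(2)]; simp)+
  have hi: "(LINT x|lborel. g1 (- of_int (n + 1) + 1 * x)) = (LINT x|lborel. g1 x)"
    "(LINT x|lborel. g2 (- of_int n + 1 * x)) = (LINT x|lborel. g2 x)"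
    using lborel_integral_real_affine[of 1 g1 "- of_int (n + 1)"] lborel_integral_real_affine[of 1 g2 "- of_int n"] by simp_all
  have fs: "f (- of_int j + x) = f x" for j x
    using periodic1_int[OF per, of x "-j"] by (simp add: add.commute)
  have e: "(\<lambda>x. indicator {m..<m+1} x *\<^sub>R f x) = (\<lambda>x. g1 (- of_int (n + 1) + 1 * x) + g2 (- of_int n + 1 * x))"
  proof
    fix x
    have "indicator {m..<m+1} x = (indicator {l..<l+t} (- of_int (n + 1) + x) + indicator {l+t..<l+1} (- of_int n + x) :: real)"
      using t by (auto simp: indicator_def m)
    then show "indicator {m..<m+1} x *\<^sub>R f x = g1 (- of_int (n + 1) + 1 * x) + g2 (- of_int n + 1 * x)"
      unfolding g1_def g2_def mult_1 fs by (simp only: scaleR_left_distrib)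
  qed
  show "integrable lborel (\<lambda>x. indicator {m..<m+1} x *\<^sub>R f x)"
    unfolding e by (rule Bochner_Integration.integrable_add[OF h])
  show "(LINT x|lborel. indicator {m..<m+1} x *\<^sub>R f x) = (LINT x|lborel. indicator {l..<l+1} x *\<^sub>R f x)"
    unfolding e s Bochner_Integration.integral_add[OF h] Bochner_Integration.integral_add[OF g] hi ..
qed

lemma S1_half_open:
  fixes f :: "real \<Rightarrow> 'a::{banach, second_countable_topology}"
  assumes f: "f \<in> borel_measurable borel"
  shows "integrable S1 f \<longleftrightarrow> integrable lborel (\<lambda>x. indicator {0..<0+1} x *\<^sub>R f x)"
    and "(LINT x|S1. f x) = (LINT x|lborel. indicator {0..<0+1} x *\<^sub>R f x)"
proof -
  have "AE x in lborel. x \<noteq> (1::real)" by (rule AE_lborel_singleton)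
  then have ae: "AE x in lborel. indicator {0..1} x *\<^sub>R f x = indicator {0..<0+1} x *\<^sub>R f x"
    by eventually_elim (auto simp: indicator_def)
  have m: "(\<lambda>x. indicator {0..1} x *\<^sub>R f x) \<in> borel_measurable lborel"
    "(\<lambda>x. indicator {0..<0+1} x *\<^sub>R f x) \<in> borel_measurable lborel"
    using f by measurable
  show "integrable S1 f \<longleftrightarrow> integrable lborel (\<lambda>x. indicator {0..<0+1} x *\<^sub>R f x)"
    unfolding integrable_restrict_space[of "{0..1::real}" lborel, simplified]
    by (rule integrable_cong_AE[OF m ae])
  show "(LINT x|S1. f x) = (LINT x|lborel. indicator {0..<0+1} x *\<^sub>R f x)"
    unfolding integral_restrict_space[of "{0..1::real}" lborel, simplified]
    by (rule integral_cong_AE[OF m ae])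
qed

text \<open>The fundamental period starts at \<open>l\<close>, not at 0, so that a function
  supported near a zero of \<open>a\<close> is never cut at an integer.\<close>

definition periodise :: "real \<Rightarrow> (real \<Rightarrow> complex) \<Rightarrow> real \<Rightarrow> complex" where
  "periodise l U x = U (l + frac (x - l))"

definition L2_on :: "real \<Rightarrow> real \<Rightarrow> (real \<Rightarrow> complex) \<Rightarrow> bool" where
  "L2_on l r U \<longleftrightarrow> U \<in> borel_measurable borel \<and> (\<forall>x. x \<notin> {l<..<r} \<longrightarrow> U x = 0) \<and> integrable lborel (\<lambda>x. (cmod (U x))\<^sup>2)"

lemma periodise_periodic: "periodic1 (periodise l U)"
proof -
  have "frac (x + 1 - l) = frac (x - l)" for x
    using frac_1_eq[of "x - l"] by (simp only: diff_add_eq)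
  then show ?thesis by (simp add: periodic1_def periodise_def)
qed

lemma periodise_eq: "x \<in> {l..<l+1} \<Longrightarrow> periodise l U x = U x"
  by (simp add: periodise_def frac_eq_id)

lemma periodise_measurable: "U \<in> borel_measurable borel \<Longrightarrow> periodise l U \<in> borel_measurable borel"
proof (rule measurable_compose[of "\<lambda>x. l + frac (x - l)" borel borel U borel, folded periodise_def])
  have "(\<lambda>x. real_of_int \<lfloor>x - l\<rfloor>) \<in> borel_measurable borel"
    by (rule measurable_compose[OF _ borel_measurable_real_floor]) simp
  then show "(\<lambda>x. l + frac (x - l)) \<in> borel_measurable borel" unfolding frac_def by simp
qed

lemma integral_periodise:
  fixes f G :: "real \<Rightarrow> 'a::{banach, second_countable_topology}"
  assumes f: "periodic1 f" "f \<in> borel_measurable borel" and eq: "\<And>x. x \<in> {l..<l+1} \<Longrightarrow> f x = G x"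
    and G: "\<And>x. x \<notin> {l<..<r} \<Longrightarrow> G x = 0" and r: "r \<le> l + 1"
  shows "integrable S1 f \<longleftrightarrow> integrable lborel G" and "integrable S1 f \<Longrightarrow> (LINT x|S1. f x) = (LINT x|lborel. G x)"
proof -
  have e: "(\<lambda>x. indicator {l..<l+1} x *\<^sub>R f x) = G"
  proof
    fix x
    show "indicator {l..<l+1} x *\<^sub>R f x = G x"
      using eq[of x] G[of x] r by (cases "x \<in> {l..<l+1}") auto
  qed
  show "integrable S1 f \<longleftrightarrow> integrable lborel G"
    unfolding S1_half_open(1)[OF f(2)] e[symmetric]
    using periodic_shift(1)[OF f(1), of 0 l] periodic_shift(1)[OF f(1), of l 0] by blast
  show "(LINT x|S1. f x) = (LINT x|lborel. G x)" if "integrable S1 f"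
    unfolding S1_half_open(2)[OF f(2)] e[symmetric]
    using that unfolding S1_half_open(1)[OF f(2)] by (rule periodic_shift(2)[OF f(1), symmetric])
qed

lemma periodise_L2:
  assumes "L2_on l r U" "r \<le> l + 1" shows "periodise l U \<in> L2_S1"
proof -
  have U: "U \<in> borel_measurable borel" "\<And>x. x \<notin> {l<..<r} \<Longrightarrow> U x = 0" "integrable lborel (\<lambda>x. (cmod (U x))\<^sup>2)"
    using assms by (auto simp: L2_on_def)
  have "integrable S1 (\<lambda>x. (cmod (periodise l U x))\<^sup>2)"
  proof (subst integral_periodise(1)[where G="\<lambda>x. (cmod (U x))\<^sup>2" and l=l and r=r])
    show "periodic1 (\<lambda>x. (cmod (periodise l U x))\<^sup>2)" using periodise_periodic[of l U] by (simp add: periodic1_def)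
    show "(\<lambda>x. (cmod (periodise l U x))\<^sup>2) \<in> borel_measurable borel" using periodise_measurable[OF U(1)] by measurable
  qed (use U assms in \<open>auto simp: periodise_eq\<close>)
  then show ?thesis using periodise_periodic periodise_measurable[OF U(1)] by (simp add: L2_S1_iff)
qed

lemma periodise_pairing:
  assumes U: "L2_on l r U" and V: "L2_on l r V" and r: "r \<le> l + 1"
  shows "(LINT x|S1. periodise l U x * cnj (periodise l V x)) = (LINT x|lborel. U x * cnj (V x))"
proof (rule integral_periodise(2)[OF _ _ _ _ r])
  note L = periodise_L2[OF U r] periodise_L2[OF V r]
  show "integrable S1 (\<lambda>x. periodise l U x * cnj (periodise l V x))" by (intro L2_prod_integrable L2_cnj L)
  show "periodic1 (\<lambda>x. periodise l U x * cnj (periodise l V x))" using L by (auto simp: L2_S1_iff periodic1_def)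
  show "(\<lambda>x. periodise l U x * cnj (periodise l V x)) \<in> borel_measurable borel"
    using L(1) L2_cnj[OF L(2)] by (intro borel_measurable_times) (auto simp: L2_S1_iff)
qed (use U in \<open>auto simp: periodise_eq L2_on_def\<close>)

lemma L2_on_cnj: "L2_on l r U \<Longrightarrow> L2_on l r (\<lambda>x. cnj (U x))"
  unfolding L2_on_def by (auto intro: borel_measurable_continuous_on[OF continuous_on_cnj[OF continuous_on_id]])

lemma L2_on_prod_integrable:
  assumes "L2_on l r U" "L2_on l r V" shows "integrable lborel (\<lambda>x. U x * V x)"
proof (rule Bochner_Integration.integrable_bound)
  show "integrable lborel (\<lambda>x. (cmod (U x))\<^sup>2 + (cmod (V x))\<^sup>2)" using assms by (simp add: L2_on_def)
  show "(\<lambda>x. U x * V x) \<in> borel_measurable lborel"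
    using assms by (auto simp: L2_on_def intro: borel_measurable_times)
  have "cmod (U x * V x) \<le> (cmod (U x))\<^sup>2 + (cmod (V x))\<^sup>2" for x
  proof -
    have "2 * (cmod (U x) * cmod (V x)) \<le> (cmod (U x))\<^sup>2 + (cmod (V x))\<^sup>2"
      using sum_squares_bound[of "cmod (U x)" "cmod (V x)"] by (simp add: mult.assoc)
    moreover have "0 \<le> cmod (U x) * cmod (V x)" by simp
    ultimately show ?thesis unfolding norm_mult by linarith
  qed
  then show "AE x in lborel. norm (U x * V x) \<le> norm ((cmod (U x))\<^sup>2 + (cmod (V x))\<^sup>2)" by simp
qed

lemma L2_on_bounded:
  assumes "U \<in> borel_measurable borel" "\<And>x. x \<notin> {l<..<r} \<Longrightarrow> U x = 0" "\<And>x. x \<in> {l<..<r} \<Longrightarrow> cmod (U x) \<le> B"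
  shows "L2_on l r U"
proof -
  have "integrable lborel (\<lambda>x. (cmod (U x))\<^sup>2)"
  proof (rule Bochner_Integration.integrable_bound)
    show "integrable lborel (\<lambda>x. indicator {l..r} x *\<^sub>R B\<^sup>2)"
      by (intro integrable_scaleR_left integrable_real_indicator) (auto simp: emeasure_lborel_Icc_eq)
    have "(cmod (U x))\<^sup>2 \<le> indicator {l..r} x *\<^sub>R B\<^sup>2" for x
      using assms(2)[of x] assms(3)[of x] by (cases "x \<in> {l<..<r}") (auto simp: indicator_def intro: power_mono)
    then show "AE x in lborel. norm ((cmod (U x))\<^sup>2) \<le> norm (indicator {l..r} x *\<^sub>R B\<^sup>2)" by simp
  qed (use assms in simp)
  then show ?thesis using assms by (simp add: L2_on_def)
qed

lemma lborel_FTC: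
  fixes W :: "real \<Rightarrow> complex"
  assumes W: "continuous_on {l..r} W" and lr: "l \<le> r" and K: "finite K"
    and d: "\<And>x. x \<in> {l<..<r} - K \<Longrightarrow> (W has_vector_derivative G x) (at x)"
    and int: "integrable lborel G" and 0: "\<And>x. x \<notin> {l<..<r} \<Longrightarrow> G x = 0"
  shows "(LINT x|lborel. G x) = W r - W l"
proof -
  have e: "(\<lambda>x. indicator {l..r} x *\<^sub>R G x) = G"
  proof
    show "indicator {l..r} x *\<^sub>R G x = G x" for x using 0[of x] by (cases "x \<in> {l..r}") auto
  qed
  have s: "set_integrable lborel {l..r} G" unfolding set_integrable_def e by (rule int)
  have "(LINT x|lborel. G x) = (LINT x:{l..r}|lborel. G x)" unfolding set_lebesgue_integral_def e ..
  also have "\<dots> = integral {l..r} G" by (rule set_borel_integral_eq_integral(2)[OF s])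
  also have "\<dots> = W r - W l"
    by (rule integral_unique[OF fundamental_theorem_of_calculus_interior_strong[OF K lr d W]])
  finally show ?thesis .
qed

context circle_operator
begin

text \<open>\<open>W\<close> is the boundary form of \<open>U\<close> and the test function. If it
  stays continuous across the singular points \<open>K\<close> and vanishes at both ends, the
  adjoint identity follows from the fundamental theorem, even if the square integrable
  \<open>U\<close> is unbounded there.\<close>

lemma periodise_adjI:
  assumes U: "L2_on l r U" and V: "L2_on l r V" and lr: "l \<le> r" "r \<le> l + 1" and K: "finite K"
    and ex: "\<And>\<phi>. \<phi> \<in> Cinf_S1 \<Longrightarrow> \<exists>W. continuous_on {l..r} W \<and> W l = 0 \<and> W r = 0 \<and>
      (\<forall>x\<in>{l<..<r} - K. (W has_vector_derivative (U x * opQ a b c \<phi> x - V x * \<phi> x)) (at x))"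
  shows "(periodise l U, periodise l V) \<in> graph_P_adj a b c"
  unfolding adj_iff
proof (intro conjI ballI periodise_L2[OF U lr(2)] periodise_L2[OF V lr(2)])
  fix \<phi> :: "real \<Rightarrow> complex" assume \<phi>: "\<phi> \<in> Cinf_S1"
  note L = periodise_L2[OF U lr(2)] periodise_L2[OF V lr(2)] Cinf_L2[OF \<phi>] Cinf_L2[OF opQ_Cinf[OF \<phi>]]
  define f where "f x = periodise l U x * opQ a b c \<phi> x - periodise l V x * \<phi> x" for x
  define G where "G x = U x * opQ a b c \<phi> x - V x * \<phi> x" for x
  have I: "integrable S1 (\<lambda>x. periodise l U x * opQ a b c \<phi> x)" "integrable S1 (\<lambda>x. periodise l V x * \<phi> x)"
    by (intro L2_prod_integrable L)+
  have fI: "integrable S1 f" unfolding f_def by (rule Bochner_Integration.integrable_diff[OF I])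
  have fp: "periodic1 f" using L by (auto simp: f_def L2_S1_iff periodic1_def)
  have fm: "f \<in> borel_measurable borel" unfolding f_def using L by (auto simp: L2_S1_iff)
  have fG: "f x = G x" if "x \<in> {l..<l+1}" for x by (simp add: f_def G_def periodise_eq[OF that])
  have G0: "G x = 0" if "x \<notin> {l<..<r}" for x using U V that by (simp add: G_def L2_on_def)
  have GI: "integrable lborel G" using integral_periodise(1)[OF fp fm fG G0 lr(2)] fI by simp
  obtain W where W: "continuous_on {l..r} W" "W l = 0" "W r = 0"
    "\<And>x. x \<in> {l<..<r} - K \<Longrightarrow> (W has_vector_derivative G x) (at x)"
    using ex[OF \<phi>] unfolding G_def by blast
  have "(LINT x|S1. f x) = (LINT x|lborel. G x)" by (rule integral_periodise(2)[OF fp fm fG G0 lr(2) fI])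
  also have "\<dots> = 0" using lborel_FTC[OF W(1) lr(1) K W(4) GI G0] W(2,3) by simp
  finally show "(LINT x|S1. periodise l U x * opQ a b c \<phi> x) = (LINT x|S1. periodise l V x * \<phi> x)"
    unfolding f_def using Bochner_Integration.integral_diff[OF I] by simp
qed

text \<open>\<open>closure_adj_pairing\<close> read on a single interval. Under self-adjointness the
  boundary form must vanish, so one pair with a nonzero value is a contradiction.\<close>

lemma periodise_form_zero:
  assumes esa: "graph_P_adj a b c = L2_graph_closure (graph_P a b c)"
    and uv: "(periodise l U, periodise l V) \<in> graph_P_adj a b c" and fg: "(periodise l F, periodise l G) \<in> graph_P_adj a b c"
    and L: "L2_on l r U" "L2_on l r V" "L2_on l r F" "L2_on l r G" and r: "r \<le> l + 1"
  shows "(LINT x|lborel. V x * cnj (F x) - U x * cnj (G x)) = 0"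
proof -
  have "(LINT x|S1. periodise l V x * cnj (periodise l F x)) = (LINT x|S1. periodise l U x * cnj (periodise l G x))"
    using uv fg unfolding esa[symmetric] by (intro closure_adj_pairing) (simp_all add: esa[symmetric])
  then have "(LINT x|lborel. V x * cnj (F x)) = (LINT x|lborel. U x * cnj (G x))"
    unfolding periodise_pairing[OF L(2,3) r] periodise_pairing[OF L(1,4) r] .
  then show ?thesis
    using L2_on_prod_integrable[OF L(2) L2_on_cnj[OF L(3)]] L2_on_prod_integrable[OF L(1) L2_on_cnj[OF L(4)]]
    by simp
qed


end

section \<open>Non-degenerate zeros destroy essential self-adjointness\<close>

text \<open>\<open>E\<close> may oscillate without limit at the ends; as it is bounded by 1, the
  vanishing of \<open>G\<close> there is enough for continuity.\<close>

lemma continuous_on_times_bounded: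
  fixes E G :: "real \<Rightarrow> complex"
  assumes E: "\<And>x. x \<in> {l<..<r} \<Longrightarrow> isCont E x" "\<And>x. x \<in> {l<..<r} \<Longrightarrow> cmod (E x) \<le> 1"
    and G: "\<And>x. isCont G x" "G l = 0" "G r = 0"
  shows "continuous_on {l..r} (\<lambda>x. if x \<in> {l<..<r} then E x * G x else 0)" (is "continuous_on _ ?W")
proof (rule continuous_at_imp_continuous_on, rule ballI)
  fix x assume x: "x \<in> {l..r}"
  show "isCont ?W x"
  proof (cases "x \<in> {l<..<r}")
    case True
    have "\<forall>\<^sub>F y in nhds x. ?W y = E y * G y"
      using eventually_nhds_in_open[OF open_greaterThanLessThan True] by eventually_elim simp
    then have "isCont ?W x \<longleftrightarrow> isCont (\<lambda>x. E x * G x) x" by (rule isCont_cong)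
    moreover have "isCont (\<lambda>x. E x * G x) x" using E(1)[OF True] G(1) by (rule isCont_mult)
    ultimately show ?thesis by blast
  next
    case False
    then have Gx: "G x = 0" "?W x = 0" using x G by auto
    have "G \<midarrow>x\<rightarrow> 0" using G(1)[of x] Gx(1) by (simp add: isCont_def)
    then have lim: "(\<lambda>y. cmod (G y)) \<midarrow>x\<rightarrow> 0" by (rule tendsto_norm_zero)
    have "cmod (?W y) \<le> cmod (G y)" for y
      using mult_right_mono[OF E(2)[of y], of "cmod (G y)"] by (simp add: norm_mult)
    then have "?W \<midarrow>x\<rightarrow> 0" by (intro Lim_null_comparison[OF always_eventually[OF allI] lim])
    then show ?thesis unfolding isCont_def Gx(2) .
  qed
qed

context circle_operator
begin

text \<open>\<open>E = exp (i \<integral> b / a)\<close> solves \<open>a E' = i b E\<close>, so in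
  \<open>P (X E)\<close> the singular terms in \<open>b^2 / a\<close> cancel. Truncation at
  \<open>x0\<close> creates no boundary term against test functions, because that form carries a
  factor \<open>a\<close>; against its own conjugate, however, the form is \<open>i b X^2\<close>,
  which is nonzero at \<open>x0\<close>.\<close>

lemma not_esa_transversal:
  assumes fm: "finite_multiplicity_zero a x0" and b0: "b x0 \<noteq> 0"
  shows "graph_P_adj a b c \<noteq> L2_graph_closure (graph_P a b c)"
proof
  assume esa: "graph_P_adj a b c = L2_graph_closure (graph_P a b c)"
  obtain d0 where d0: "d0 > 0" "\<And>y. \<bar>y - x0\<bar> < d0 \<Longrightarrow> y \<noteq> x0 \<Longrightarrow> a y \<noteq> 0"
    using zeros_isolated[OF smooth_coeffs(1) fm] by auto
  have a0: "a x0 = 0" using fm by (simp add: finite_multiplicity_zero_def)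
  define r where "r = x0 + min d0 1"
  have r: "x0 < r" "r \<le> x0 + 1" using d0 by (auto simp: r_def)
  have nz: "a x \<noteq> 0" if "x \<in> {x0<..<r}" for x
  proof -
    have "x0 < x" "x < x0 + min d0 1" "min d0 1 \<le> d0" using that by (auto simp: r_def)
    then have "\<bar>x - x0\<bar> < d0" by linarith
    then show ?thesis using d0(2)[of x] that by simp
  qed
  have "\<exists>S. \<forall>x. ereal x0 < ereal x \<longrightarrow> ereal x < ereal r \<longrightarrow> (S has_vector_derivative b x / a x) (at x)"
  proof (rule einterval_antiderivative)
    show "isCont (\<lambda>x. b x / a x) x" if "ereal x0 < ereal x" "ereal x < ereal r" for x
      using nz[of x] that smooth_continuous[OF smooth_coeffs(1), of UNIV] smooth_continuous[OF smooth_coeffs(2), of UNIV]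
      by (intro isCont_divide) (auto simp: continuous_on_eq_continuous_at)
  qed (use r in simp)
  then obtain S where S: "\<And>x. x \<in> {x0<..<r} \<Longrightarrow> (S has_vector_derivative b x / a x) (at x)" by auto
  define E where "E x = cis (S x)" for x
  have Ed: "(E has_vector_derivative (\<i> * of_real (b x / a x)) * E x) (at x)" if "x \<in> {x0<..<r}" for x
    using has_derivative_cis[OF S[OF that, unfolded has_vector_derivative_def]]
    unfolding E_def[abs_def] has_vector_derivative_def
    by (rule has_derivative_eq_rhs) (auto simp: scaleR_conv_of_real algebra_simps)
  have E1: "cmod (E x) = 1" "E x * cnj (E x) = 1" for x
    by (simp_all add: E_def complex_norm_square[symmetric])
  define A where "A x = complex_of_real (a x)" for x
  define A1 where "A1 x = complex_of_real (ddx a x)" for x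
  define B where "B x = complex_of_real (b x)" for x
  define B1 where "B1 x = complex_of_real (ddx b x)" for x
  \<comment> \<open>A cutoff on the right only: a double zero at \<open>r\<close>, so that
    \<open>X\<close> and \<open>X1\<close> vanish there, and a nonzero value at
    \<open>x0\<close>.\<close>
  define X where "X x = (complex_of_real (r - x))\<^sup>2" for x
  define X1 where "X1 x = complex_of_real (- 2 * (r - x))" for x
  have dX: "(X has_vector_derivative X1 x) (at x)" "(X1 has_vector_derivative 2) (at x)" for x
  proof -
    have "((\<lambda>x. (r - x)\<^sup>2) has_real_derivative - 2 * (r - x)) (at x)" "((\<lambda>x. - 2 * (r - x)) has_real_derivative 2) (at x)"
      by (auto intro!: derivative_eq_intros)
    from this[THEN has_vector_derivative_of_real]
    show "(X has_vector_derivative X1 x) (at x)" "(X1 has_vector_derivative 2) (at x)"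
      by (simp_all add: X_def[abs_def] X1_def[abs_def])
  qed
  have dA: "(A has_vector_derivative A1 x) (at x)" "(B has_vector_derivative B1 x) (at x)" for x
    unfolding A_def[abs_def] A1_def B_def[abs_def] B1_def by (intro has_vector_derivative_of_real smooth_DERIV smooth_coeffs)+
  \<comment> \<open>Chosen so that \<open>P (X E) = v E\<close>: after inserting
    \<open>a E' = i b E\<close> only smooth coefficients are left. The constant 2 is X''.\<close>
  define v where "v x = (A1 x * X1 x + 2 * A x) + \<i> * B x * X1 x + (\<i> / 2 * B1 x + of_real (c x)) * X x" for x
  define U where "U x = (if x \<in> {x0<..<r} then X x * E x else 0)" for x
  define V where "V x = (if x \<in> {x0<..<r} then v x * E x else 0)" for x
  have cont: "continuous_on UNIV X" "continuous_on UNIV X1" "continuous_on UNIV v"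
    unfolding v_def[abs_def] A_def A1_def B_def B1_def X_def[abs_def] X1_def[abs_def]
    by (intro continuous_intros smooth_continuous smooth_coeffs)+
  have Em: "(\<lambda>x. indicator {x0<..<r} x *\<^sub>R E x) \<in> borel_measurable borel"
    by (rule borel_measurable_continuous_on_indicator)
      (auto intro!: continuous_at_imp_continuous_on has_vector_derivative_continuous[OF Ed])
  have L: "L2_on x0 r (\<lambda>x. if x \<in> {x0<..<r} then f x * E x else 0)" if f: "continuous_on UNIV f" for f
  proof -
    have "compact (f ` {x0..r})" by (intro compact_continuous_image continuous_on_subset[OF f]) auto
    then obtain M where M: "\<forall>y\<in>f ` {x0..r}. cmod y \<le> M" by (meson bounded_iff compact_imp_bounded)
    have e: "(\<lambda>x. if x \<in> {x0<..<r} then f x * E x else 0) = (\<lambda>x. f x * (indicator {x0<..<r} x *\<^sub>R E x))"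
      by auto
    show ?thesis
    proof (rule L2_on_bounded)
      show "(\<lambda>x. if x \<in> {x0<..<r} then f x * E x else 0) \<in> borel_measurable borel"
        unfolding e by (rule borel_measurable_times[OF borel_measurable_continuous_onI[OF f] Em])
      show "cmod (if x \<in> {x0<..<r} then f x * E x else 0) \<le> M" if "x \<in> {x0<..<r}" for x
        using M that by (simp add: norm_mult E1)
    qed auto
  qed
  have UL: "L2_on x0 r U" and VL: "L2_on x0 r V" unfolding U_def[abs_def] V_def[abs_def] by (intro L cont)+
  have adj: "(periodise x0 U, periodise x0 V) \<in> graph_P_adj a b c"
  proof (rule periodise_adjI[OF UL VL, where K="{}"])
    fix \<phi> :: "real \<Rightarrow> complex" assume \<phi>: "\<phi> \<in> Cinf_S1"
    have d\<phi>: "(\<phi> has_vector_derivative ddx \<phi> x) (at x)" "(ddx \<phi> has_vector_derivative ddx (ddx \<phi>) x) (at x)" for x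
      by (intro Cinf_vd Cinf_ddx \<phi>)+
    \<comment> \<open>In the boundary form \<open>a (u \<phi>' - u' \<phi>) + i b u \<phi>\<close>
      of \<open>u = X E\<close> the terms with \<open>b\<close> cancel. The result
      \<open>E G\<close> has the factor \<open>a\<close>, hence tends to 0 at \<open>x0\<close> in
      spite of the oscillation.\<close>
    define G where "G x = A x * (X x * ddx \<phi> x - X1 x * \<phi> x)" for x
    have Gd: "(G has_vector_derivative (A x * ((X x * ddx (ddx \<phi>) x + X1 x * ddx \<phi> x) - (X1 x * ddx \<phi> x + 2 * \<phi> x))
       + A1 x * (X x * ddx \<phi> x - X1 x * \<phi> x))) (at x)" for x
      unfolding G_def by (intro has_vector_derivative_mult has_vector_derivative_diff dA dX d\<phi>)
    define W where "W x = (if x \<in> {x0<..<r} then E x * G x else 0)" for x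
    have "continuous_on {x0..r} W"
      unfolding W_def
    proof (rule continuous_on_times_bounded)
      show "isCont E x" if "x \<in> {x0<..<r}" for x using has_vector_derivative_continuous[OF Ed[OF that]] .
      show "isCont G x" for x using has_vector_derivative_continuous[OF Gd] .
    qed (simp_all add: E1 G_def A_def a0 X_def X1_def)
    moreover have "(W has_vector_derivative U x * opQ a b c \<phi> x - V x * \<phi> x) (at x)" if x: "x \<in> {x0<..<r} - {}" for x
    proof -
      have x': "x \<in> {x0<..<r}" using x by simp
      have "((\<lambda>x. E x * G x) has_vector_derivative E x * (A x * ((X x * ddx (ddx \<phi>) x + X1 x * ddx \<phi> x) - (X1 x * ddx \<phi> x + 2 * \<phi> x))
       + A1 x * (X x * ddx \<phi> x - X1 x * \<phi> x)) + ((\<i> * of_real (b x / a x)) * E x) * G x) (at x)"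
        by (rule has_vector_derivative_mult[OF Ed[OF x'] Gd])
      then have "((\<lambda>x. E x * G x) has_vector_derivative U x * opQ a b c \<phi> x - V x * \<phi> x) (at x)"
      proof (rule has_vector_derivative_eq_rhs)
        have 1: "of_real (b x / a x) * G x = B x * (X x * ddx \<phi> x - X1 x * \<phi> x)"
          using nz[OF x'] by (simp add: G_def A_def B_def)
        have "((\<i> * of_real (b x / a x)) * E x) * G x = \<i> * E x * (of_real (b x / a x) * G x)"
          by (simp only: mult_ac)
        then show "E x * (A x * ((X x * ddx (ddx \<phi>) x + X1 x * ddx \<phi> x) - (X1 x * ddx \<phi> x + 2 * \<phi> x))
       + A1 x * (X x * ddx \<phi> x - X1 x * \<phi> x)) + ((\<i> * of_real (b x / a x)) * E x) * G x = U x * opQ a b c \<phi> x - V x * \<phi> x"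
          using x' unfolding 1 by (simp only:) (simp add: U_def V_def v_def opQ_def A_def A1_def B_def B1_def algebra_simps)
      qed
      then show ?thesis
        by (rule has_vector_derivative_transform_within_open[of _ _ _ "{x0<..<r}"]) (use x' in \<open>auto simp: W_def\<close>)
    qed
    ultimately show "\<exists>W. continuous_on {x0..r} W \<and> W x0 = 0 \<and> W r = 0 \<and>
        (\<forall>x\<in>{x0<..<r} - {}. (W has_vector_derivative U x * opQ a b c \<phi> x - V x * \<phi> x) (at x))"
      by (intro exI[of _ W]) (auto simp: W_def)
  qed (use r in auto)
  have z: "(LINT x|lborel. V x * cnj (U x) - U x * cnj (V x)) = 0"
    by (rule periodise_form_zero[OF esa adj adj UL VL UL VL r(2)])
  \<comment> \<open>Since \<open>|E| = 1\<close>, the phase drops out of the form of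
    \<open>U\<close> with itself, and the primitive extends smoothly to \<open>x0\<close>, where it
    does not vanish.\<close>
  define Z where "Z x = \<i> * (B x * (X x)\<^sup>2)" for x
  have Zd: "(Z has_vector_derivative \<i> * (B x * (X x * X1 x + X1 x * X x) + B1 x * (X x * X x))) (at x)" for x
    unfolding Z_def[abs_def] power2_eq_square
    by (intro has_vector_derivative_mult_right has_vector_derivative_mult dA dX)
  have "(LINT x|lborel. V x * cnj (U x) - U x * cnj (V x)) = Z r - Z x0"
  proof (rule lborel_FTC[where K="{}"])
    show "continuous_on {x0..r} Z"
      using has_vector_derivative_continuous[OF Zd] by (intro continuous_at_imp_continuous_on) blast
    show "integrable lborel (\<lambda>x. V x * cnj (U x) - U x * cnj (V x))"
      by (intro Bochner_Integration.integrable_diff L2_on_prod_integrable[OF VL L2_on_cnj[OF UL]] L2_on_prod_integrable[OF UL L2_on_cnj[OF VL]])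
    fix x assume x: "x \<in> {x0<..<r} - {}"
    have "V x * cnj (U x) - U x * cnj (V x) = (v x * cnj (X x) - X x * cnj (v x)) * (E x * cnj (E x))"
      using x by (simp add: U_def V_def algebra_simps)
    also have "\<dots> = \<i> * (B x * (X x * X1 x + X1 x * X x) + B1 x * (X x * X x))"
      by (simp add: E1 v_def X_def X1_def A_def A1_def B_def B1_def algebra_simps)
    finally show "(Z has_vector_derivative V x * cnj (U x) - U x * cnj (V x)) (at x)" using Zd by simp
  qed (use r in \<open>auto simp: U_def\<close>)
  then show False using z b0 r by (simp add: Z_def X_def B_def)
qed

end

text \<open>From \<open>ln y <= y - 1\<close> at \<open>y = t^(-1/4)\<close>. The exponent suits
  both uses: the square of \<open>t^(-1/4)\<close> is integrable at 0, and
  \<open>t * t^(-1/4)\<close> tends to 0.\<close>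

lemma abs_ln_bound:
  fixes t :: real assumes "t \<ge> 0" shows "\<bar>ln t\<bar> \<le> 4 / sqrt (sqrt t) + t"
proof (cases "t = 0 \<or> t \<ge> 1")
  \<comment> \<open>At 0 both sides are 0, by the default values of \<open>ln\<close> and of
    division.\<close>
  case True
  then show ?thesis
  proof
    assume t: "t \<ge> 1"
    then have "\<bar>ln t\<bar> \<le> t" using ln_le_minus_one[of t] by simp
    moreover have "0 \<le> 4 / sqrt (sqrt t)" using t by simp
    ultimately show ?thesis by linarith
  qed simp
next
  case False
  then have t: "0 < t" "t < 1" using assms by auto
  define y where "y = sqrt (sqrt t)"
  have y: "y > 0" using t by (simp add: y_def)
  have "ln t = 4 * ln y" using t by (simp add: y_def ln_sqrt)
  moreover have "ln (1 / y) \<le> 1 / y - 1" using y by (intro ln_le_minus_one) simp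
  then have "- ln y \<le> 1 / y" using y by (simp add: ln_div)
  moreover have "ln t < 0" using t by simp
  ultimately have "\<bar>ln t\<bar> \<le> 4 / y" by (simp add: field_simps)
  then show ?thesis using t by (simp add: y_def)
qed

lemma inverse_sqrt_integrable:
  fixes x0 d :: real assumes d: "d > 0"
  shows "integrable lborel (\<lambda>x. indicator {x0-d..x0+d} x *\<^sub>R (1 / sqrt \<bar>x - x0\<bar>))"
proof -
  \<comment> \<open>The signed square root is a primitive on both sides and continuous at
    \<open>x0\<close>, the one exceptional point.\<close>
  define H where "H x = sgn (x - x0) * (2 * sqrt \<bar>x - x0\<bar>)" for x
  have "continuous_on {x0-d..x0+d} H"
  proof (rule continuous_at_imp_continuous_on, rule ballI)
    fix x
    show "isCont H x"
    proof (cases "x = x0")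
      case True
      have lim: "(\<lambda>y. 2 * sqrt \<bar>y - x0\<bar>) \<midarrow>x0\<rightarrow> 0"
        by (rule tendsto_eq_intros refl | simp)+
      have "norm (H y) \<le> 2 * sqrt \<bar>y - x0\<bar>" for y
        by (simp add: H_def abs_mult sgn_if)
      then have "H \<midarrow>x0\<rightarrow> 0" by (intro Lim_null_comparison[OF always_eventually[OF allI] lim])
      then show ?thesis by (simp add: isCont_def True H_def)
    next
      case False
      then show ?thesis unfolding H_def by (intro continuous_intros isCont_sgn) auto
    qed
  qed
  moreover have "(H has_vector_derivative 1 / sqrt \<bar>x - x0\<bar>) (at x)" if "x \<in> {x0-d<..<x0+d} - {x0}" for x
  proof (cases "x > x0")
    case True
    have "((\<lambda>x. 2 * sqrt (x - x0)) has_real_derivative 1 / sqrt \<bar>x - x0\<bar>) (at x)"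
      using True by (auto intro!: derivative_eq_intros simp: field_simps)
    then have "((\<lambda>x. 2 * sqrt (x - x0)) has_vector_derivative 1 / sqrt \<bar>x - x0\<bar>) (at x)"
      by (simp add: has_real_derivative_iff_has_vector_derivative)
    then show ?thesis
      by (rule has_vector_derivative_transform_within_open[of _ _ _ "{x0<..}"]) (use True in \<open>auto simp: H_def\<close>)
  next
    case False
    then have x: "x < x0" using that by auto
    have "((\<lambda>x. - (2 * sqrt (x0 - x))) has_real_derivative 1 / sqrt \<bar>x - x0\<bar>) (at x)"
      using x by (auto intro!: derivative_eq_intros simp: field_simps)
    then have "((\<lambda>x. - (2 * sqrt (x0 - x))) has_vector_derivative 1 / sqrt \<bar>x - x0\<bar>) (at x)"
      by (simp add: has_real_derivative_iff_has_vector_derivative)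
    then show ?thesis
      by (rule has_vector_derivative_transform_within_open[of _ _ _ "{..<x0}"]) (use x in \<open>auto simp: H_def\<close>)
  qed
  ultimately have "((\<lambda>x. 1 / sqrt \<bar>x - x0\<bar>) has_integral (H (x0+d) - H (x0-d))) {x0-d..x0+d}"
    using d by (intro fundamental_theorem_of_calculus_interior_strong[where S="{x0}"]) auto
  then have "(\<lambda>x. 1 / sqrt \<bar>x - x0\<bar>) absolutely_integrable_on {x0-d..x0+d}"
    by (intro nonnegative_absolutely_integrable_1) (auto intro: has_integral_integrable)
  then have "integrable lebesgue (\<lambda>x. indicator {x0-d..x0+d} x *\<^sub>R (1 / sqrt \<bar>x - x0\<bar>))"
    by (simp add: set_integrable_def)
  moreover have "(\<lambda>x. indicator {x0-d..x0+d} x *\<^sub>R (1 / sqrt \<bar>x - x0\<bar>)) \<in> borel_measurable lborel"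
    by measurable
  ultimately show ?thesis using integrable_completion by blast
qed

context circle_operator
begin

text \<open>Here \<open>a (ln |a|)' = a'\<close> is smooth, so the step at \<open>x0\<close> and
  \<open>ln |a|\<close> both belong locally to the adjoint domain: their boundary forms with test
  functions are continuous across \<open>x0\<close>. Between the two of them the form contains
  \<open>- a (ln |a|)' = - a'\<close>, which does not vanish at \<open>x0\<close> although
  \<open>a\<close> does. The step confines the integral to one side; without it the two sides would
  cancel.\<close>

lemma not_esa_simple:
  assumes fm: "finite_multiplicity_zero a x0" and b0: "b x0 = 0" and a1: "ddx a x0 \<noteq> 0"
  shows "graph_P_adj a b c \<noteq> L2_graph_closure (graph_P a b c)"
proof
  assume esa: "graph_P_adj a b c = L2_graph_closure (graph_P a b c)"
  have a0: "a x0 = 0" using fm by (simp add: finite_multiplicity_zero_def)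
  obtain m \<kappa> d1 where m: "m \<ge> 1" "\<And>k. k < m \<Longrightarrow> (ddx ^^ k) a x0 = 0" and \<kappa>: "\<kappa> > 0" and d1: "d1 > 0"
    and lo: "\<And>h. \<bar>h\<bar> < d1 \<Longrightarrow> \<kappa> * \<bar>h\<bar> ^ m \<le> \<bar>a (x0 + h)\<bar>"
    using zero_order[OF smooth_coeffs(1) fm] by metis
  have "m = 1" using m(1) m(2)[of 1] a1 by (cases "m = 1") auto
  \<comment> \<open>The half keeps the closed interval where \<open>lo\<close> applies, and its
    length \<open>2 * d\<close> within one period.\<close>
  define d where "d = min d1 1 / 2"
  have d: "d > 0" "2 * d \<le> 1" "d < d1" using d1 by (auto simp: d_def min_def)
  define l r where "l = x0 - d" and "r = x0 + d"
  have lr: "l < x0" "x0 < r" "l \<le> r" "r \<le> l + 1" using d by (auto simp: l_def r_def)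
  have alo: "\<kappa> * \<bar>x - x0\<bar> \<le> \<bar>a x\<bar>" if "x \<in> {l..r}" for x
    using lo[of "x - x0"] that d \<open>m = 1\<close> by (auto simp: l_def r_def abs_le_iff abs_less_iff)
  have nz: "a x \<noteq> 0" if "x \<in> {l..r}" "x \<noteq> x0" for x
  proof -
    have "0 < \<kappa> * \<bar>x - x0\<bar>" using \<kappa> that by simp
    then show ?thesis using alo[OF that(1)] by auto
  qed
  obtain B' where B': "B' > 0" "\<And>y. \<bar>ddx b y\<bar> \<le> B'" using Cinf_bounded[OF Cinf_ddx[OF b]] by auto
  \<comment> \<open>\<open>b\<close> vanishes at \<open>x0\<close>, where the zero of
    \<open>a\<close> is simple, so \<open>b / a\<close> is bounded.\<close>
  have bup: "\<bar>b x\<bar> \<le> B' / \<kappa> * \<bar>a x\<bar>" if "x \<in> {l..r}" for x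
  proof -
    obtain t where "b (x0 + (x - x0)) = (ddx ^^ 1) b (x0 + t) / fact 1 * (x - x0) ^ 1"
      using smooth_taylor[OF smooth_coeffs(2), of 1 x0 "x - x0"] b0 by auto
    then have "\<bar>b x\<bar> \<le> B' * \<bar>x - x0\<bar>" using B' by (simp add: abs_mult mult_right_mono)
    also have "\<dots> = B' / \<kappa> * (\<kappa> * \<bar>x - x0\<bar>)" using \<kappa> by simp
    also have "\<dots> \<le> B' / \<kappa> * \<bar>a x\<bar>" using alo[OF that] \<kappa> B' by (intro mult_left_mono) auto
    finally show ?thesis .
  qed
  define A where "A x = complex_of_real (a x)" for x
  define A1 where "A1 x = complex_of_real (ddx a x)" for x
  define A2 where "A2 x = complex_of_real (ddx (ddx a) x)" for x
  define B where "B x = complex_of_real (b x)" for x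
  define B1 where "B1 x = complex_of_real (ddx b x)" for x
  define Cc where "Cc x = complex_of_real (c x)" for x
  \<comment> \<open>A polynomial bump with double zeros at \<open>l\<close> and \<open>r\<close>,
    where it vanishes together with \<open>X1\<close>.\<close>
  define X where "X x = complex_of_real ((d\<^sup>2 - (x - x0)\<^sup>2)\<^sup>2)" for x
  define X1 where "X1 x = complex_of_real (- 4 * (x - x0) * (d\<^sup>2 - (x - x0)\<^sup>2))" for x
  define X2 where "X2 x = complex_of_real (8 * (x - x0)\<^sup>2 - 4 * (d\<^sup>2 - (x - x0)\<^sup>2))" for x
  have dX: "(X has_vector_derivative X1 x) (at x)" "(X1 has_vector_derivative X2 x) (at x)" for x
  proof -
    have 1: "((\<lambda>x. (d\<^sup>2 - (x - x0)\<^sup>2)\<^sup>2) has_real_derivative - 4 * (x - x0) * (d\<^sup>2 - (x - x0)\<^sup>2)) (at x)"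
      by (rule derivative_eq_intros refl)+ (simp add: algebra_simps)
    have 2: "((\<lambda>x. - 4 * (x - x0) * (d\<^sup>2 - (x - x0)\<^sup>2)) has_real_derivative 8 * (x - x0)\<^sup>2 - 4 * (d\<^sup>2 - (x - x0)\<^sup>2)) (at x)"
      by (rule derivative_eq_intros refl)+ (simp add: algebra_simps power2_eq_square)
    show "(X has_vector_derivative X1 x) (at x)" unfolding X_def[abs_def] X1_def by (rule has_vector_derivative_of_real[OF 1])
    show "(X1 has_vector_derivative X2 x) (at x)" unfolding X1_def[abs_def] X2_def by (rule has_vector_derivative_of_real[OF 2])
  qed
  have X0: "X l = 0" "X r = 0" "X1 l = 0" "X1 r = 0" by (auto simp: X_def X1_def l_def r_def)
  have dA: "(A has_vector_derivative A1 x) (at x)" "(A1 has_vector_derivative A2 x) (at x)" "(B has_vector_derivative B1 x) (at x)" for x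
    unfolding A_def[abs_def] A1_def[abs_def] A2_def B_def[abs_def] B1_def
    by (intro has_vector_derivative_of_real smooth_DERIV smooth_coeffs smooth_ddx)+
  \<comment> \<open>This is \<open>ln |a|\<close>, written with a square so that the chain rule
    differentiates it on both sides of the zero. At \<open>x0\<close> it takes the default value
    \<open>ln 0 = 0\<close>, harmless next to the factors \<open>a\<close> and
    \<open>b\<close>.\<close>
  define Lr where "Lr x = ln ((a x)\<^sup>2) / 2" for x
  define L where "L x = complex_of_real (Lr x)" for x
  have Lb: "\<bar>Lr x\<bar> \<le> 4 / sqrt (sqrt \<bar>a x\<bar>) + \<bar>a x\<bar>" for x
  proof -
    have "Lr x = ln \<bar>a x\<bar>"
    proof (cases "a x = 0")
      case False
      have "ln ((a x)\<^sup>2) = ln (\<bar>a x\<bar> ^ 2)" by simp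
      also have "\<dots> = 2 * ln \<bar>a x\<bar>" using False by (subst ln_realpow) auto
      finally show ?thesis by (simp add: Lr_def)
    qed (simp add: Lr_def)
    then show ?thesis using abs_ln_bound[of "\<bar>a x\<bar>"] by simp
  qed
  have dL: "(L has_vector_derivative A1 x / A x) (at x)" if "a x \<noteq> 0" for x
  proof -
    have p: "(a x)\<^sup>2 > 0" using that by simp
    have "((\<lambda>x. (a x)\<^sup>2) has_real_derivative 2 * a x * ddx a x) (at x)"
      by (rule derivative_eq_intros smooth_DERIV[OF smooth_coeffs(1)] refl | simp)+
    from DERIV_cdivide[OF DERIV_chain2[OF DERIV_ln[OF p] this], of 2]
    have "(Lr has_real_derivative inverse ((a x)\<^sup>2) * (2 * a x * ddx a x) / 2) (at x)"
      unfolding Lr_def[abs_def] .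
    also have "inverse ((a x)\<^sup>2) * (2 * a x * ddx a x) / 2 = ddx a x / a x"
      using that by (simp add: field_simps power2_eq_square)
    finally have "((\<lambda>x. complex_of_real (Lr x)) has_vector_derivative complex_of_real (ddx a x / a x)) (at x)"
      by (rule has_vector_derivative_of_real)
    then show ?thesis by (simp add: L_def[abs_def] A1_def A_def)
  qed
  have aL: "cmod (A x * L x) \<le> 4 * sqrt \<bar>a x\<bar> * sqrt (sqrt \<bar>a x\<bar>) + \<bar>a x\<bar>\<^sup>2" for x
  proof -
    have "cmod (A x * L x) = \<bar>a x\<bar> * \<bar>Lr x\<bar>" by (simp add: A_def L_def norm_mult)
    also have "\<dots> \<le> \<bar>a x\<bar> * (4 / sqrt (sqrt \<bar>a x\<bar>) + \<bar>a x\<bar>)" by (intro mult_left_mono Lb) simp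
    also have "\<dots> = 4 * sqrt \<bar>a x\<bar> * sqrt (sqrt \<bar>a x\<bar>) + \<bar>a x\<bar>\<^sup>2"
    proof (cases "a x = 0")
      case False
      define y where "y = sqrt (sqrt \<bar>a x\<bar>)"
      have y: "y > 0" "sqrt \<bar>a x\<bar> = y * y" "\<bar>a x\<bar> = (y * y) * (y * y)"
        using False by (auto simp: y_def)
      show ?thesis unfolding y_def[symmetric] y(2) using y(1) by (simp add: y(3) power2_eq_square field_simps)
    qed simp
    finally show ?thesis .
  qed
  have cA: "isCont a x" for x using smooth_continuous[OF smooth_coeffs(1), of UNIV] by (simp add: continuous_on_eq_continuous_at)
  have lim0: "(\<lambda>x. 4 * sqrt \<bar>a x\<bar> * sqrt (sqrt \<bar>a x\<bar>) + \<bar>a x\<bar>\<^sup>2) \<midarrow>x0\<rightarrow> 0"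
  proof -
    have "isCont (\<lambda>x. 4 * sqrt \<bar>a x\<bar> * sqrt (sqrt \<bar>a x\<bar>) + \<bar>a x\<bar>\<^sup>2) x0" by (intro continuous_intros cA)
    then show ?thesis by (simp add: isCont_def a0)
  qed
  have cAL: "continuous_on {l..r} (\<lambda>x. A x * L x)" and cBL: "continuous_on {l..r} (\<lambda>x. B x * L x)"
  proof -
    have AL0: "(\<lambda>x. A x * L x) \<midarrow>x0\<rightarrow> 0"
      by (rule Lim_null_comparison[OF always_eventually[OF allI[OF aL]] lim0])
    then have AL0': "(\<lambda>x. B' / \<kappa> * cmod (A x * L x)) \<midarrow>x0\<rightarrow> 0"
      by (intro tendsto_mult_right_zero tendsto_norm_zero)
    have "\<forall>\<^sub>F x in at x0. x \<in> {l<..<r}"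
      using lr by (intro eventually_at_in_open') auto
    then have "\<forall>\<^sub>F x in at x0. cmod (B x * L x) \<le> B' / \<kappa> * cmod (A x * L x)"
    proof eventually_elim
      case (elim x)
      then have "\<bar>b x\<bar> * \<bar>Lr x\<bar> \<le> B' / \<kappa> * \<bar>a x\<bar> * \<bar>Lr x\<bar>" by (intro mult_right_mono bup) auto
      then show ?case by (simp add: A_def B_def L_def norm_mult)
    qed
    then have BL0: "(\<lambda>x. B x * L x) \<midarrow>x0\<rightarrow> 0" using AL0' by (rule Lim_null_comparison)
    have L0: "A x0 = 0" "B x0 = 0" by (simp_all add: A_def B_def a0 b0)
    have cL: "isCont L x" if "x \<in> {l..r}" "x \<noteq> x0" for x
      using has_vector_derivative_continuous[OF dL[OF nz[OF that]]] .
    have cAB: "isCont A x" "isCont B x" for x using has_vector_derivative_continuous[OF dA(1)] has_vector_derivative_continuous[OF dA(3)] by blast+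
    have "isCont (\<lambda>x. A x * L x) x \<and> isCont (\<lambda>x. B x * L x) x" if "x \<in> {l..r}" for x
    proof (cases "x = x0")
      case True
      show ?thesis unfolding True isCont_def using AL0 BL0 L0 by simp
    next
      case False
      show ?thesis by (intro conjI isCont_mult cAB cL that False)
    qed
    then show "continuous_on {l..r} (\<lambda>x. A x * L x)" "continuous_on {l..r} (\<lambda>x. B x * L x)"
      by (intro continuous_at_imp_continuous_on; blast)+
  qed
  \<comment> \<open>\<open>m1\<close> is \<open>P X\<close>, and
    \<open>P (X L) = L * m1 + m0\<close>. The identity \<open>a L' = a'\<close> has removed the
    singular derivatives, and the quotient \<open>B / A\<close> left in \<open>m0\<close> is
    bounded.\<close>
  define m1 where "m1 x = (A1 x * X1 x + A x * X2 x) - \<i> * B x * X1 x - \<i> / 2 * B1 x * X x + Cc x * X x" for x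
  define m0 where "m0 x = 2 * X1 x * A1 x + X x * A2 x - \<i> * X x * A1 x * (B x / A x)" for x
  define U where "U x = (if x \<in> {x0<..<r} then X x else 0)" for x
  define V where "V x = (if x \<in> {x0<..<r} then m1 x else 0)" for x
  define F where "F x = (if x \<in> {l<..<r} then X x * L x else 0)" for x
  define G where "G x = (if x \<in> {l<..<r} then L x * m1 x + m0 x else 0)" for x
  have cf: "continuous_on UNIV X" "continuous_on UNIV m1" "continuous_on UNIV (\<lambda>x. 2 * X1 x * A1 x + X x * A2 x)" "continuous_on UNIV (\<lambda>x. \<i> * X x * A1 x)"
    "continuous_on UNIV A" "continuous_on UNIV B"
    unfolding m1_def[abs_def] A_def[abs_def] A1_def A2_def B_def[abs_def] B1_def X_def[abs_def] X1_def X2_def Cc_def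
    by (intro continuous_intros smooth_continuous smooth_coeffs smooth_ddx)+
  have bdd: "\<exists>M>0. \<forall>x\<in>{l..r}. cmod (f x) \<le> M" if "continuous_on UNIV f" for f :: "real \<Rightarrow> complex"
  proof -
    have "compact (f ` {l..r})" by (intro compact_continuous_image continuous_on_subset[OF that]) auto
    then have "bounded (f ` {l..r})" by (rule compact_imp_bounded)
    then show ?thesis unfolding bounded_pos by auto
  qed
  obtain M1 where M1: "M1 > 0" "\<And>x. x \<in> {l..r} \<Longrightarrow> cmod (X x) \<le> M1" using bdd[OF cf(1)] by blast
  obtain M2 where M2: "M2 > 0" "\<And>x. x \<in> {l..r} \<Longrightarrow> cmod (m1 x) \<le> M2" using bdd[OF cf(2)] by blast
  obtain M3 where M3: "M3 > 0" "\<And>x. x \<in> {l..r} \<Longrightarrow> cmod (2 * X1 x * A1 x + X x * A2 x) \<le> M3" using bdd[OF cf(3)] by blast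
  obtain M4 where M4: "M4 > 0" "\<And>x. x \<in> {l..r} \<Longrightarrow> cmod (\<i> * X x * A1 x) \<le> M4" using bdd[OF cf(4)] by blast
  obtain M5 where M5: "M5 > 0" "\<And>x. x \<in> {l..r} \<Longrightarrow> cmod (A x) \<le> M5" using bdd[OF cf(5)] by blast
  note M = M1(1) M2(1) M3(1) M4(1) M5(1) and Mb = M1(2) M2(2) M3(2) M4(2) M5(2)
  have m0b: "cmod (m0 x) \<le> M3 + M4 * (B' / \<kappa>)" if x: "x \<in> {l..r}" for x
  proof -
    have "\<bar>b x\<bar> / \<bar>a x\<bar> \<le> B' / \<kappa>"
    proof (cases "a x = 0")
      case False
      then show ?thesis using bup[OF x] by (simp add: divide_le_eq)
    qed (use B' \<kappa> in simp)
    then have "cmod (B x / A x) \<le> B' / \<kappa>" by (simp add: A_def B_def norm_divide)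
    then have "cmod (\<i> * X x * A1 x * (B x / A x)) \<le> M4 * (B' / \<kappa>)"
      unfolding norm_mult[of "\<i> * X x * A1 x"] using Mb(4)[OF x] M by (intro mult_mono) auto
    then show ?thesis unfolding m0_def
      using norm_triangle_ineq4[of "2 * X1 x * A1 x + X x * A2 x" "\<i> * X x * A1 x * (B x / A x)"] Mb(3)[OF x] by linarith
  qed
  have meas: "L \<in> borel_measurable borel" "A \<in> borel_measurable borel" "B \<in> borel_measurable borel"
  proof -
    have "a \<in> borel_measurable borel" by (rule Cinf_measurable[OF a])
    then show "L \<in> borel_measurable borel" unfolding L_def[abs_def] Lr_def by measurable
    show "A \<in> borel_measurable borel" "B \<in> borel_measurable borel" by (intro borel_measurable_continuous_onI cf)+
  qed
  \<comment> \<open>The square of the fourth-root bound for the logarithm; the linear lower bound on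
    \<open>|a|\<close> at the simple zero turns it into an integrable inverse square root of the
    distance.\<close>
  have L2: "(Lr x)\<^sup>2 \<le> 32 / sqrt \<kappa> * (1 / sqrt \<bar>x - x0\<bar>) + 2 * M5\<^sup>2" if x: "x \<in> {l..r}" for x
  proof (cases "x = x0")
    case True
    then show ?thesis by (simp add: Lr_def a0)
  next
    case False
    define y where "y = sqrt (sqrt \<bar>a x\<bar>)"
    have y: "y > 0" "y\<^sup>2 = sqrt \<bar>a x\<bar>" using nz[OF x False] by (auto simp: y_def)
    have "(Lr x)\<^sup>2 = \<bar>Lr x\<bar>\<^sup>2" by simp
    also have "\<dots> \<le> (4 / y + \<bar>a x\<bar>)\<^sup>2" using Lb[of x] by (intro power_mono) (auto simp: y_def)
    also have "\<dots> \<le> 2 * (4 / y)\<^sup>2 + 2 * \<bar>a x\<bar>\<^sup>2"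
      using sum_squares_bound[of "4 / y" "\<bar>a x\<bar>"] by (simp add: power2_sum)
    also have "2 * (4 / y)\<^sup>2 = 32 / sqrt \<bar>a x\<bar>" by (simp add: power_divide y(2))
    also have "\<dots> \<le> 32 / sqrt (\<kappa> * \<bar>x - x0\<bar>)"
      using alo[OF x] \<kappa> False nz[OF x False] by (intro divide_left_mono mult_pos_pos) auto
    also have "\<dots> = 32 / sqrt \<kappa> * (1 / sqrt \<bar>x - x0\<bar>)" by (simp add: real_sqrt_mult)
    also have "\<bar>a x\<bar>\<^sup>2 \<le> M5\<^sup>2" using Mb(5)[OF x] by (intro power_mono) (auto simp: A_def)
    finally show ?thesis by simp
  qed
  have LL: "L2_on l r f" if fm: "f \<in> borel_measurable borel" and f0: "\<And>x. x \<notin> {l<..<r} \<Longrightarrow> f x = 0"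
    and fb: "\<And>x. x \<in> {l<..<r} \<Longrightarrow> cmod (f x) \<le> p * \<bar>Lr x\<bar> + q" for f and p q :: real
  proof -
    define w where "w x = (2 * p\<^sup>2 * (32 / sqrt \<kappa>)) * (indicator {x0-d..x0+d} x *\<^sub>R (1 / sqrt \<bar>x - x0\<bar>)) + (2 * p\<^sup>2 * (2 * M5\<^sup>2) + 2 * q\<^sup>2) * indicator {x0-d..x0+d} x" for x
    have "integrable lborel (\<lambda>x. (cmod (f x))\<^sup>2)"
    proof (rule Bochner_Integration.integrable_bound)
      show "integrable lborel w" unfolding w_def
        by (intro Bochner_Integration.integrable_add integrable_mult_right inverse_sqrt_integrable d integrable_real_indicator)
          (auto simp: emeasure_lborel_Icc_eq)
      have "(cmod (f x))\<^sup>2 \<le> w x" for x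
      proof (cases "x \<in> {l<..<r}")
        case True
        then have x: "x \<in> {l..r}" "x \<in> {x0-d..x0+d}" by (auto simp: l_def r_def)
        have "(cmod (f x))\<^sup>2 \<le> (p * \<bar>Lr x\<bar> + q)\<^sup>2" using fb[OF True] by (intro power_mono) auto
        also have "\<dots> \<le> 2 * (p * \<bar>Lr x\<bar>)\<^sup>2 + 2 * q\<^sup>2"
          using sum_squares_bound[of "p * \<bar>Lr x\<bar>" q] by (simp add: power2_sum)
        also have "\<dots> = 2 * p\<^sup>2 * (Lr x)\<^sup>2 + 2 * q\<^sup>2" by (simp add: power_mult_distrib)
        also have "\<dots> \<le> 2 * p\<^sup>2 * (32 / sqrt \<kappa> * (1 / sqrt \<bar>x - x0\<bar>) + 2 * M5\<^sup>2) + 2 * q\<^sup>2"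
          by (intro add_right_mono mult_left_mono L2 x) simp
        also have "\<dots> = w x" using x by (simp add: w_def algebra_simps)
        finally show ?thesis .
      next
        case False
        then show ?thesis using f0 \<kappa> by (auto simp: w_def intro!: add_nonneg_nonneg mult_nonneg_nonneg)
      qed
      then have "norm ((cmod (f x))\<^sup>2) \<le> norm (w x)" for x using abs_ge_self[of "w x"] order_trans by fastforce
      then show "AE x in lborel. norm ((cmod (f x))\<^sup>2) \<le> norm (w x)" by simp
    qed (use fm in simp)
    then show ?thesis using fm f0 by (simp add: L2_on_def)
  qed
  have ifm: "(\<lambda>x. if x \<in> {s<..<t} then f x else 0) \<in> borel_measurable borel"
    if "f \<in> borel_measurable borel" for f :: "real \<Rightarrow> complex" and s t
    using that by (intro measurable_If) auto
  have UL: "L2_on l r U" unfolding U_def[abs_def]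
    by (rule LL[where p=0 and q=M1, OF ifm[OF borel_measurable_continuous_onI[OF cf(1)]]]) (use Mb M lr in auto)
  have VL: "L2_on l r V" unfolding V_def[abs_def]
    by (rule LL[where p=0 and q=M2, OF ifm[OF borel_measurable_continuous_onI[OF cf(2)]]]) (use Mb M lr in auto)
  have FL: "L2_on l r F" unfolding F_def[abs_def]
  proof (rule LL[where p=M1 and q=0])
    show "(\<lambda>x. if x \<in> {l<..<r} then X x * L x else 0) \<in> borel_measurable borel"
      by (intro ifm borel_measurable_times meas borel_measurable_continuous_onI cf)
    show "cmod (if x \<in> {l<..<r} then X x * L x else 0) \<le> M1 * \<bar>Lr x\<bar> + 0" if "x \<in> {l<..<r}" for x
      using that Mb(1)[of x] by (auto simp: norm_mult L_def intro!: mult_right_mono)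
  qed auto
  have GL: "L2_on l r G" unfolding G_def[abs_def]
  proof (rule LL[where p=M2 and q="M3 + M4 * (B' / \<kappa>)"])
    have "m0 \<in> borel_measurable borel" unfolding m0_def[abs_def]
      by (intro borel_measurable_diff borel_measurable_times[OF borel_measurable_continuous_onI[OF cf(4)]]
        borel_measurable_divide meas borel_measurable_continuous_onI[OF cf(3)])
    then show "(\<lambda>x. if x \<in> {l<..<r} then L x * m1 x + m0 x else 0) \<in> borel_measurable borel"
      by (intro ifm borel_measurable_add borel_measurable_times meas borel_measurable_continuous_onI[OF cf(2)])
    show "cmod (if x \<in> {l<..<r} then L x * m1 x + m0 x else 0) \<le> M2 * \<bar>Lr x\<bar> + (M3 + M4 * (B' / \<kappa>))" if x: "x \<in> {l<..<r}" for x
    proof -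
      have "cmod (L x * m1 x) = cmod (m1 x) * \<bar>Lr x\<bar>" by (simp add: norm_mult L_def)
      also have "\<dots> \<le> M2 * \<bar>Lr x\<bar>" using x Mb(2)[of x] by (intro mult_right_mono) auto
      finally have "cmod (L x * m1 x) \<le> M2 * \<bar>Lr x\<bar>" .
      moreover have "cmod (m0 x) \<le> M3 + M4 * (B' / \<kappa>)" using m0b[of x] x by simp
      ultimately have "cmod (L x * m1 x + m0 x) \<le> M2 * \<bar>Lr x\<bar> + (M3 + M4 * (B' / \<kappa>))" by (rule norm_triangle_mono)
      then show ?thesis using x by simp
    qed
  qed auto
  have adjU: "(periodise l U, periodise l V) \<in> graph_P_adj a b c"
  proof (rule periodise_adjI[OF UL VL, where K="{x0}"])
    fix \<phi> :: "real \<Rightarrow> complex" assume \<phi>: "\<phi> \<in> Cinf_S1"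
    have d\<phi>: "(\<phi> has_vector_derivative ddx \<phi> x) (at x)" "(ddx \<phi> has_vector_derivative ddx (ddx \<phi>) x) (at x)" for x
      by (intro Cinf_vd Cinf_ddx \<phi>)+
    define H where "H x = A x * (X x * ddx \<phi> x - X1 x * \<phi> x) + \<i> * (B x * (X x * \<phi> x))" for x
    have Hd: "(H has_vector_derivative (A x * ((X x * ddx (ddx \<phi>) x + X1 x * ddx \<phi> x) - (X1 x * ddx \<phi> x + X2 x * \<phi> x))
       + A1 x * (X x * ddx \<phi> x - X1 x * \<phi> x)) + \<i> * (B x * (X x * ddx \<phi> x + X1 x * \<phi> x) + B1 x * (X x * \<phi> x))) (at x)" for x
      unfolding H_def by (intro has_vector_derivative_add has_vector_derivative_mult has_vector_derivative_mult_right has_vector_derivative_diff dA dX d\<phi>)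
    have H0: "H x0 = 0" "H r = 0" by (simp_all add: H_def A_def B_def a0 b0 X0)
    \<comment> \<open>\<open>H\<close> is the boundary form of \<open>X\<close>. It vanishes at
      \<open>x0\<close> with \<open>a\<close> and \<open>b\<close>, so freezing it to the left of
      \<open>x0\<close> gives the continuous form of the one-sided step.\<close>
    define W where "W x = H (max x0 x)" for x
    have cH: "continuous_on UNIV H"
      using has_vector_derivative_continuous[OF Hd] by (intro continuous_at_imp_continuous_on) blast
    have "continuous_on {l..r} W" unfolding W_def
      by (rule continuous_on_compose2[OF cH]) (auto intro!: continuous_intros)
    moreover have "(W has_vector_derivative U x * opQ a b c \<phi> x - V x * \<phi> x) (at x)" if x: "x \<in> {l<..<r} - {x0}" for x
    proof (cases "x < x0")
      case True
      have "((\<lambda>x. 0) has_vector_derivative U x * opQ a b c \<phi> x - V x * \<phi> x) (at x)"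
        using True by (simp add: U_def V_def)
      then show ?thesis
        by (rule has_vector_derivative_transform_within_open[of _ _ _ "{..<x0}"]) (use True H0 in \<open>auto simp: W_def max_def\<close>)
    next
      case False
      then have x': "x \<in> {x0<..<r}" using x by auto
      have "(H has_vector_derivative U x * opQ a b c \<phi> x - V x * \<phi> x) (at x)"
        by (rule has_vector_derivative_eq_rhs[OF Hd])
          (use x' in \<open>simp add: U_def V_def m1_def opQ_def A_def A1_def B_def B1_def Cc_def algebra_simps\<close>)
      then show ?thesis
        by (rule has_vector_derivative_transform_within_open[of _ _ _ "{x0<..<r}"]) (use x' in \<open>auto simp: W_def max_def\<close>)
    qed
    ultimately show "\<exists>W. continuous_on {l..r} W \<and> W l = 0 \<and> W r = 0 \<and>
        (\<forall>x\<in>{l<..<r} - {x0}. (W has_vector_derivative U x * opQ a b c \<phi> x - V x * \<phi> x) (at x))"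
      using lr H0 by (intro exI[of _ W]) (auto simp: W_def max_def)
  qed (use lr in auto)
  have adjF: "(periodise l F, periodise l G) \<in> graph_P_adj a b c"
  proof (rule periodise_adjI[OF FL GL, where K="{x0}"])
    fix \<phi> :: "real \<Rightarrow> complex" assume \<phi>: "\<phi> \<in> Cinf_S1"
    have d\<phi>: "(\<phi> has_vector_derivative ddx \<phi> x) (at x)" "(ddx \<phi> has_vector_derivative ddx (ddx \<phi>) x) (at x)" for x
      by (intro Cinf_vd Cinf_ddx \<phi>)+
    \<comment> \<open>The boundary form of \<open>X L\<close>, with \<open>a L'\<close> replaced by
      \<open>a'\<close>; every remaining factor, \<open>a L\<close> and \<open>b L\<close> included,
      is continuous at \<open>x0\<close>.\<close>
    define W where "W x = (A x * L x) * (X x * ddx \<phi> x - X1 x * \<phi> x) - X x * (A1 x * \<phi> x) + \<i> * ((B x * L x) * (X x * \<phi> x))" for x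
    have cc: "continuous_on {l..r} X" "continuous_on {l..r} X1" "continuous_on {l..r} A1" "continuous_on {l..r} \<phi>" "continuous_on {l..r} (ddx \<phi>)"
      by (intro continuous_at_imp_continuous_on ballI has_vector_derivative_continuous[OF dX(1)] has_vector_derivative_continuous[OF dX(2)]
        has_vector_derivative_continuous[OF dA(2)] has_vector_derivative_continuous[OF d\<phi>(1)] has_vector_derivative_continuous[OF d\<phi>(2)])+
    have "continuous_on {l..r} W" unfolding W_def by (intro continuous_intros cAL cBL cc)
    moreover have "(W has_vector_derivative F x * opQ a b c \<phi> x - G x * \<phi> x) (at x)" if x: "x \<in> {l<..<r} - {x0}" for x
    proof -
      have ax: "a x \<noteq> 0" using nz[of x] x by auto
      then have Ax: "A x \<noteq> 0" by (simp add: A_def)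
      define t where "t = A1 x / A x"
      have tA: "A x * t = A1 x" "A1 x * (B x / A x) = B x * t" using Ax by (simp_all add: t_def)
      have Lt: "(L has_vector_derivative t) (at x)" using dL[OF ax] by (simp add: t_def)
      have "(W has_vector_derivative
        ((A x * L x) * ((X x * ddx (ddx \<phi>) x + X1 x * ddx \<phi> x) - (X1 x * ddx \<phi> x + X2 x * \<phi> x)) + (A x * t + A1 x * L x) * (X x * ddx \<phi> x - X1 x * \<phi> x)
          - (X x * (A1 x * ddx \<phi> x + A2 x * \<phi> x) + X1 x * (A1 x * \<phi> x))
          + \<i> * ((B x * L x) * (X x * ddx \<phi> x + X1 x * \<phi> x) + (B x * t + B1 x * L x) * (X x * \<phi> x)))) (at x)"
        unfolding W_def by (intro has_vector_derivative_add has_vector_derivative_diff has_vector_derivative_mult has_vector_derivative_mult_right dA dX d\<phi> Lt)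
      then show ?thesis
      proof (rule has_vector_derivative_eq_rhs)
        have G: "G x = L x * m1 x + (2 * X1 x * A1 x + X x * A2 x - \<i> * X x * (B x * t))"
          using x unfolding G_def m0_def tA(2)[symmetric] by (simp add: mult.assoc)
        have F: "F x = X x * L x" using x by (simp add: F_def)
        show "((A x * L x) * ((X x * ddx (ddx \<phi>) x + X1 x * ddx \<phi> x) - (X1 x * ddx \<phi> x + X2 x * \<phi> x)) + (A x * t + A1 x * L x) * (X x * ddx \<phi> x - X1 x * \<phi> x)
          - (X x * (A1 x * ddx \<phi> x + A2 x * \<phi> x) + X1 x * (A1 x * \<phi> x))
          + \<i> * ((B x * L x) * (X x * ddx \<phi> x + X1 x * \<phi> x) + (B x * t + B1 x * L x) * (X x * \<phi> x))) = F x * opQ a b c \<phi> x - G x * \<phi> x"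
          unfolding tA(1) F G m1_def opQ_def A_def[symmetric] A1_def[symmetric] B_def[symmetric] B1_def[symmetric] Cc_def[symmetric]
          by (simp add: field_simps)
      qed
    qed
    ultimately show "\<exists>W. continuous_on {l..r} W \<and> W l = 0 \<and> W r = 0 \<and>
        (\<forall>x\<in>{l<..<r} - {x0}. (W has_vector_derivative F x * opQ a b c \<phi> x - G x * \<phi> x) (at x))"
      by (intro exI[of _ W]) (auto simp: W_def X0)
  qed (use lr in auto)
  have z: "(LINT x|lborel. V x * cnj (F x) - U x * cnj (G x)) = 0"
    by (rule periodise_form_zero[OF esa adjU adjF UL VL FL GL lr(4)])
  \<comment> \<open>The boundary form of \<open>X\<close> and \<open>X L\<close>. At
    \<open>x0\<close> it reduces to \<open>- X^2 a'\<close>, the nonzero value that contradicts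
    \<open>z\<close>.\<close>
  define Z where "Z x = - (X x * X x * A1 x + \<i> * ((B x * L x) * (X x * X x)))" for x
  have "(LINT x|lborel. V x * cnj (F x) - U x * cnj (G x)) = Z r - Z x0"
  proof (rule lborel_FTC[where K="{}"])
    have c1: "continuous_on {x0..r} (\<lambda>x. B x * L x)" using lr by (intro continuous_on_subset[OF cBL]) auto
    have c2: "continuous_on {x0..r} X" "continuous_on {x0..r} A1"
      by (intro continuous_at_imp_continuous_on ballI has_vector_derivative_continuous[OF dX(1)] has_vector_derivative_continuous[OF dA(2)])+
    show "continuous_on {x0..r} Z" unfolding Z_def by (intro continuous_intros c1 c2)
    show "integrable lborel (\<lambda>x. V x * cnj (F x) - U x * cnj (G x))"
      by (intro Bochner_Integration.integrable_diff L2_on_prod_integrable[OF VL L2_on_cnj[OF FL]] L2_on_prod_integrable[OF UL L2_on_cnj[OF GL]])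
    fix x assume x: "x \<in> {x0<..<r} - {}"
    have ax: "a x \<noteq> 0" using nz[of x] x lr by auto
    define t where "t = A1 x / A x"
    have tB: "A1 x * (B x / A x) = B x * t" by (simp add: t_def)
    have Lt: "(L has_vector_derivative t) (at x)" using dL[OF ax] by (simp add: t_def)
    have "(Z has_vector_derivative - ((X x * X x * A2 x + (X x * X1 x + X1 x * X x) * A1 x)
        + \<i> * ((B x * L x) * (X x * X1 x + X1 x * X x) + (B x * t + B1 x * L x) * (X x * X x)))) (at x)"
      unfolding Z_def by (intro has_vector_derivative_minus has_vector_derivative_add has_vector_derivative_mult has_vector_derivative_mult_right dA dX Lt)
    then show "(Z has_vector_derivative V x * cnj (F x) - U x * cnj (G x)) (at x)"
    proof (rule has_vector_derivative_eq_rhs)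
      have G: "G x = L x * m1 x + (2 * X1 x * A1 x + X x * A2 x - \<i> * X x * (B x * t))"
        using x lr unfolding G_def m0_def tB[symmetric] by (simp add: mult.assoc)
      have F: "F x = X x * L x" "U x = X x" "V x = m1 x" using x lr by (simp_all add: F_def U_def V_def)
      have cn: "cnj (X x) = X x" "cnj (X1 x) = X1 x" "cnj (X2 x) = X2 x" "cnj (A x) = A x" "cnj (A1 x) = A1 x" "cnj (A2 x) = A2 x"
        "cnj (B x) = B x" "cnj (B1 x) = B1 x" "cnj (L x) = L x" "cnj (Cc x) = Cc x" "cnj t = t"
        by (simp_all add: X_def X1_def X2_def A_def A1_def A2_def B_def B1_def L_def Cc_def t_def)
      show "- ((X x * X x * A2 x + (X x * X1 x + X1 x * X x) * A1 x)
        + \<i> * ((B x * L x) * (X x * X1 x + X1 x * X x) + (B x * t + B1 x * L x) * (X x * X x))) = V x * cnj (F x) - U x * cnj (G x)"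
        unfolding F G m1_def by (simp add: cn field_simps)
    qed
  qed (use lr in \<open>auto simp: U_def V_def\<close>)
  moreover have "Z r = 0" by (simp add: Z_def X0)
  moreover have "Z x0 \<noteq> 0" using a1 d by (simp add: Z_def X_def A1_def B_def b0)
  ultimately show False using z by simp
qed

end

section \<open>The equivalence\<close>

lemma flow_complete_iff_degenerate:
  assumes a: "a \<in> Cinf_S1" and b: "b \<in> Cinf_S1" and fm: "\<And>x. a x = 0 \<Longrightarrow> finite_multiplicity_zero a x"
  shows "hamiltonian_flow_complete (symbol_p a b) \<longleftrightarrow> degenerate_zeros a b"
proof
  assume "degenerate_zeros a b"
  then obtain K where "K > 0" "\<And>x. (ddx a x)\<^sup>2 \<le> K * \<bar>a x\<bar>" "\<And>x. \<bar>ddx a x * b x\<bar> \<le> K * \<bar>a x\<bar>"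
    using degenerate_bounds[OF a b fm] by blast
  then show "hamiltonian_flow_complete (symbol_p a b)" by (rule degenerate_flow_complete[OF a b])
next
  assume complete: "hamiltonian_flow_complete (symbol_p a b)"
  show "degenerate_zeros a b"
    unfolding degenerate_zeros_def
  proof (intro allI impI)
    fix x assume x: "a x = 0"
    \<comment> \<open>The vertical curve exists only where \<open>b\<close> vanishes, so the
      transversal case has to be excluded first.\<close>
    have "b x = 0" using incomplete_transversal[OF a b fm[OF x]] complete by blast
    moreover from this have "ddx a x = 0" using incomplete_vertical[OF a b x] complete by blast
    ultimately show "ddx a x = 0 \<and> b x = 0" by simp
  qed
qed

lemma (in circle_operator) esa_iff_degenerate:
  assumes fm: "\<And>x. a x = 0 \<Longrightarrow> finite_multiplicity_zero a x"
  shows "essentially_self_adjoint_P a b c \<longleftrightarrow> degenerate_zeros a b"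
proof
  assume deg: "degenerate_zeros a b"
  obtain K where K: "K > 0" "\<And>x. (ddx a x)\<^sup>2 \<le> K * \<bar>a x\<bar>" "\<And>x. \<bar>ddx a x * b x\<bar> \<le> K * \<bar>a x\<bar>"
    using degenerate_bounds[OF a b fm deg] by blast
  have "AE x in lborel. x \<notin> {x \<in> {0..1}. a x = 0}"
    by (intro AE_not_in countable_imp_null_set_lborel countable_finite zeros_finite[OF smooth_coeffs(1) fm])
  then have "AE x in S1. a x \<noteq> 0"
    by (simp add: AE_restrict_space_iff) (erule eventually_mono, auto)
  then have "graph_P_adj a b c \<subseteq> L2_graph_closure (graph_P a b c)"
    using degenerate_closure[OF K] deg by (auto simp: degenerate_zeros_def)
  then show "essentially_self_adjoint_P a b c"
    unfolding essentially_self_adjoint_P_def using closure_subset_adj by blast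
next
  assume "essentially_self_adjoint_P a b c"
  then have esa: "graph_P_adj a b c = L2_graph_closure (graph_P a b c)"
    by (simp add: essentially_self_adjoint_P_def)
  show "degenerate_zeros a b"
    unfolding degenerate_zeros_def
  proof (intro allI impI)
    fix x assume x: "a x = 0"
    have "b x = 0" using not_esa_transversal[OF fm[OF x]] esa by blast
    moreover from this have "ddx a x = 0" using not_esa_simple[OF fm[OF x]] esa by blast
    ultimately show "ddx a x = 0 \<and> b x = 0" by simp
  qed
qed

theorem theorem4p1:
  fixes a b c :: "real \<Rightarrow> real"
  assumes "a \<in> Cinf_S1" and "b \<in> Cinf_S1" and "c \<in> Cinf_S1"
    and "\<And>x. a x = 0 \<Longrightarrow> finite_multiplicity_zero a x"
  shows "hamiltonian_flow_complete (symbol_p a b) \<longleftrightarrow> essentially_self_adjoint_P a b c"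
proof -
  interpret circle_operator a b c by unfold_locales (use assms in auto)
  show ?thesis using flow_complete_iff_degenerate[OF a b assms(4)] esa_iff_degenerate[OF assms(4)] by simp
qed

end
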